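(* Let $T$ be an integral domain, $M$ a nonzero maximal ideal of $T$, $k=T/M$, and $\varphi:T\to k$ the canonical surjection. Let $D$ be a proper subring of $k$, and let $R=\varphi^{-1}(D)$. Let $F=qf(D)$ be the quotient field of $D$ (inside $k$) and let $d:=\operatorname{tr.deg.}(k/F)$. Then: (a) $w\text{-}\dim(R)=\max\{w\text{-}\dim(T),\, w\text{-}\dim(D)+\dim(T_M)\}$. (b) $w\text{-}\dim_v(R)=\max\{w\text{-}\dim_v(T),\, w\text{-}\dim_v(D)+\dim_v(T_M)+d\}$.
   Context: All rings are commutative integral domains with identity; $qf(R)$ is the quotient field of $R$, and an overring of $R$ is a ring between $R$ and $qf(R)$. $F(R)$ denotes the set of nonzero fractional ideals of $R$ and $f(R)$ the set of nonzero finitely generated fractional ideals. For $A\in F(R)$ put $A^{-1}=\{x\in qf(R): xA\subseteq R\}$, $A^v=(A^{-1})^{-1}$, and $A^w=\{x\in qf(R): xJ\subseteq A \text{ for some } J\subseteq R,\ J\in f(R),\ J^v=R\}$. A nonzero ideal $I$ of $R$ is a $w$-ideal if $I^w=I$; a $w$-prime ideal is a prime ideal that is a ($\neq 0$) $w$-ideal. The $w$-dimension is $w\text{-}\dim(R)=\sup\{n : P_1\subsetneq\cdots\subsetneq P_n,\ P_i \text{ } w\text{-prime ideals of } R\}$, with $w\text{-}\dim(R)=0$ if there are no $w$-prime ideals. A valuation overring $V$ of $R$ is a $w$-valuation overring if $F^w\subseteq FV$ for every $F\in f(R)$; the $w$-valuative dimension is $w\text{-}\dim_v(R)=\sup\{\dim(V):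 V \text{ a } w\text{-valuation overring of } R\}$. $\dim$ is Krull dimension; the valuative dimension is $\dim_v(R)=\sup\{\dim(V): V \text{ a valuation overring of } R\}$. All these quantities take values in $\{0,1,2,\dots\}\cup\{\infty\}$, with an infinite transcendence degree read as $\infty$. *)

theory Defs
  imports "HOL-Algebra.Algebra" "HOL-Library.Extended_Nat"
begin

text \<open>
  An integral domain is a subring of a field, called \<open>K\<close> below, and its quotient field is formed
  inside \<open>K\<close>.  Thus overrings and fractional ideals are subsets of \<open>K\<close>, and the inclusions between
  them are literal.  The notions for a domain \<open>R\<close> depend on \<open>K\<close> only through \<open>qf K R\<close>.
\<close>

definition qf :: "('a, 'b) ring_scheme \<Rightarrow> 'a set \<Rightarrow> 'a set" where
  "qf K R = {a \<otimes>\<^bsub>K\<^esub> inv\<^bsub>K\<^esub> b | a b. a \<in> R \<and> b \<in> R \<and> b \<noteq> \<zero>\<^bsub>K\<^esub>}"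

definition localize :: "('a, 'b) ring_scheme \<Rightarrow> 'a set \<Rightarrow> 'a set \<Rightarrow> 'a set" where
  "localize K R P = {a \<otimes>\<^bsub>K\<^esub> inv\<^bsub>K\<^esub> s | a s. a \<in> R \<and> s \<in> R - P}"

text \<open>Nonzero fractional ideals, and those that are finitely generated as \<open>R\<close>-modules; the
  library function \<open>Span\<close> is the set of finite linear combinations, with coefficients in \<open>R\<close>.\<close>

definition frac_ideals :: "('a, 'b) ring_scheme \<Rightarrow> 'a set \<Rightarrow> 'a set set" where
  "frac_ideals K R = {A. A \<subseteq> qf K R \<and> additive_subgroup A K \<and>
      (\<forall>r\<in>R. \<forall>x\<in>A. r \<otimes>\<^bsub>K\<^esub> x \<in> A) \<and>
      (\<exists>c\<in>R - {\<zero>\<^bsub>K\<^esub>}. \<forall>x\<in>A. c \<otimes>\<^bsub>K\<^esub> x \<in> R) \<and>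
      A \<noteq> {\<zero>\<^bsub>K\<^esub>}}"

definition fg_frac_ideals :: "('a, 'b) ring_scheme \<Rightarrow> 'a set \<Rightarrow> 'a set set" where
  "fg_frac_ideals K R =
     {A \<in> frac_ideals K R. \<exists>us. set us \<subseteq> qf K R \<and> A = ring.Span K R us}"

definition frac_inv :: "('a, 'b) ring_scheme \<Rightarrow> 'a set \<Rightarrow> 'a set \<Rightarrow> 'a set" where
  "frac_inv K R A = {x \<in> qf K R. \<forall>a\<in>A. x \<otimes>\<^bsub>K\<^esub> a \<in> R}"

definition v_closure :: "('a, 'b) ring_scheme \<Rightarrow> 'a set \<Rightarrow> 'a set \<Rightarrow> 'a set" where
  "v_closure K R A = frac_inv K R (frac_inv K R A)"

definition w_closure :: "('a, 'b) ring_scheme \<Rightarrow> 'a set \<Rightarrow> 'a set \<Rightarrow> 'a set" where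
  "w_closure K R A = {x \<in> qf K R.
      \<exists>J\<in>fg_frac_ideals K R. J \<subseteq> R \<and> v_closure K R J = R \<and> (\<forall>j\<in>J. x \<otimes>\<^bsub>K\<^esub> j \<in> A)}"

definition w_ideal :: "('a, 'b) ring_scheme \<Rightarrow> 'a set \<Rightarrow> 'a set \<Rightarrow> bool" where
  "w_ideal K R I \<longleftrightarrow>
     ideal I (K\<lparr>carrier := R\<rparr>) \<and> I \<noteq> {\<zero>\<^bsub>K\<^esub>} \<and> w_closure K R I = I"

definition w_prime :: "('a, 'b) ring_scheme \<Rightarrow> 'a set \<Rightarrow> 'a set \<Rightarrow> bool" where
  "w_prime K R P \<longleftrightarrow> primeideal P (K\<lparr>carrier := R\<rparr>) \<and> w_ideal K R P"

text \<open>In the \<open>w\<close>-dimension a chain is measured by its number of members (the zero ideal is not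
  a \<open>w\<close>-prime), in the Krull dimension by its number of inclusions.\<close>

definition w_dim :: "('a, 'b) ring_scheme \<Rightarrow> 'a set \<Rightarrow> enat" where
  "w_dim K R = (SUP n\<in>{n. \<exists>P :: nat \<Rightarrow> 'a set.
      (\<forall>i<n. w_prime K R (P i)) \<and> (\<forall>i. Suc i < n \<longrightarrow> P i \<subset> P (Suc i))}. enat n)"

definition krull_dim :: "('a, 'b) ring_scheme \<Rightarrow> enat" where
  "krull_dim A = (SUP n\<in>{n. \<exists>P :: nat \<Rightarrow> 'a set.
      (\<forall>i\<le>n. primeideal (P i) A) \<and> (\<forall>i<n. P i \<subset> P (Suc i))}. enat n)"

definition overring :: "('a, 'b) ring_scheme \<Rightarrow> 'a set \<Rightarrow> 'a set \<Rightarrow> bool" where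
  "overring K R V \<longleftrightarrow> subring V K \<and> R \<subseteq> V \<and> V \<subseteq> qf K R"

text \<open>The quotient field itself is allowed as a (trivial) valuation overring.\<close>

definition valuation_overring :: "('a, 'b) ring_scheme \<Rightarrow> 'a set \<Rightarrow> 'a set \<Rightarrow> bool" where
  "valuation_overring K R V \<longleftrightarrow> overring K R V \<and>
     (\<forall>x\<in>qf K V. x \<noteq> \<zero>\<^bsub>K\<^esub> \<longrightarrow> x \<in> V \<or> inv\<^bsub>K\<^esub> x \<in> V)"

definition val_dim :: "('a, 'b) ring_scheme \<Rightarrow> 'a set \<Rightarrow> enat" where
  "val_dim K R = (SUP V\<in>{V. valuation_overring K R V}. krull_dim (K\<lparr>carrier := V\<rparr>))"

text \<open>The product of \<open>F\<close> and \<open>V\<close> is the set of finite sums of products, the library's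
  \<open>ideal_prod\<close>.\<close>

definition w_valuation_overring :: "('a, 'b) ring_scheme \<Rightarrow> 'a set \<Rightarrow> 'a set \<Rightarrow> bool" where
  "w_valuation_overring K R V \<longleftrightarrow> valuation_overring K R V \<and>
     (\<forall>F\<in>fg_frac_ideals K R. w_closure K R F \<subseteq> F \<cdot>\<^bsub>K\<^esub> V)"

definition w_val_dim :: "('a, 'b) ring_scheme \<Rightarrow> 'a set \<Rightarrow> enat" where
  "w_val_dim K R = (SUP V\<in>{V. w_valuation_overring K R V}. krull_dim (K\<lparr>carrier := V\<rparr>))"

text \<open>Algebraic independence of a subset \<open>S\<close> of the field \<open>k\<close> over its subfield \<open>F\<close>.  A monomial in
  the elements of \<open>S\<close> is given by a finitely supported exponent function \<open>e\<close>, and a polynomial by a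
  finite set \<open>E\<close> of exponents with coefficients \<open>c\<close>: only the zero polynomial vanishes on \<open>S\<close>.\<close>

definition alg_independent :: "('a, 'b) ring_scheme \<Rightarrow> 'a set \<Rightarrow> 'a set \<Rightarrow> bool" where
  "alg_independent k F S \<longleftrightarrow> S \<subseteq> carrier k \<and>
     (\<forall>(E :: ('a \<Rightarrow> nat) set) c.
        finite E \<and> (\<forall>e\<in>E. finite {x. e x \<noteq> 0} \<and> {x. e x \<noteq> 0} \<subseteq> S) \<and> c \<in> E \<rightarrow> F \<and>
        (\<Oplus>\<^bsub>k\<^esub>e\<in>E. c e \<otimes>\<^bsub>k\<^esub> (\<Otimes>\<^bsub>k\<^esub>x\<in>{x. e x \<noteq> 0}. x [^]\<^bsub>k\<^esub> e x)) = \<zero>\<^bsub>k\<^esub>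
        \<longrightarrow> (\<forall>e\<in>E. c e = \<zero>\<^bsub>k\<^esub>))"

text \<open>The transcendence degree, the largest cardinality of an algebraically independent set, with
  every infinite cardinality read as \<open>\<infinity>\<close>.\<close>

definition trdeg :: "('a, 'b) ring_scheme \<Rightarrow> 'a set \<Rightarrow> enat" where
  "trdeg k F =
     (SUP S\<in>{S. alg_independent k F S}. if finite S then enat (card S) else \<infinity>)"

end

theory Submission
  imports Defs
begin

text \<open>The rings \<open>R\<close> and \<open>T\<close> have the same quotient field \<open>L\<close>, because \<open>M\<close> is a nonzero ideal common to \<open>R\<close> and \<open>T\<close>.  The closure operation
\<open>w\<close> enters only through one family of ideals: call \<open>J\<close> a Glaz-Vasconcelos ideal of a domain if it is
finitely generated with \<open>J\<^sup>-\<^sup>1\<close> equal to the domain.  A nonzero prime is a \<open>w\<close>-prime exactly when it contains no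
such ideal (\<open>w_prime_iff\<close>), and a valuation overring is a \<open>w\<close>-valuation overring exactly when its
maximal ideal contains none (\<open>w_valuation_overring_iff\<close>).  Everything about \<open>w\<close> therefore follows
from the way these ideals move through the pullback square: no such ideal of \<open>R\<close> lies in \<open>M\<close>; they
extend from \<open>R\<close> to \<open>T\<close> and map from \<open>R\<close> to \<open>D\<close>; those of \<open>D\<close> lift to \<open>R\<close>; and an ideal of \<open>T\<close>
that is not inside \<open>M\<close> and contains one of \<open>T\<close> also contains one of \<open>R\<close>.

For the \<open>w\<close>-dimension, the primes of \<open>R\<close> containing \<open>M\<close> correspond to the primes of \<open>D\<close>, the others to
the primes of \<open>T\<close> that do not contain \<open>M\<close>, and the nonzero primes inside \<open>M\<close> are all \<open>w\<close>-primes of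
\<open>R\<close>.  A chain of \<open>w\<close>-primes whose top contains \<open>M\<close> or lies inside it passes through primes of \<open>T\<close> inside \<open>M\<close>,
that is primes of \<open>T\<^sub>M\<close>, and then through primes given by \<open>w\<close>-primes of \<open>D\<close>; any other chain comes from
\<open>w\<close>-primes of \<open>T\<close>.

For the \<open>w\<close>-valuative dimension, the Krull dimension of a valuation ring \<open>V\<close> of \<open>L\<close> is the length of the
longest chain of rings between \<open>V\<close> and \<open>L\<close>, which turns the whole argument into one about subrings of \<open>L\<close>.
Let \<open>V\<close> be a \<open>w\<close>-valuation overring of \<open>R\<close>.  If its maximal ideal does not contain \<open>M\<close>, then \<open>V\<close>
contains \<open>T\<close>, and it is a \<open>w\<close>-valuation overring of \<open>T\<close> or an overring of \<open>T\<^sub>M\<close>.  Otherwise \<open>W = V T\<close> has centre \<open>M\<close> on \<open>T\<close>, and a chain over \<open>V\<close> splits at \<open>W\<close>.  Below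
\<open>W\<close> one counts twice with the rank inequality (\<open>rank_inequality\<close>): first over the subfield \<open>k\<close> of the
residue field of \<open>W\<close>, then over the subfield \<open>F\<close> of \<open>k\<close>.  Every step of the chain is either visible in the
smaller field, or it contributes an element independent over it.  The elements independent over \<open>k\<close> are
absorbed by a refinement of \<open>W\<close> over \<open>T\<close> (\<open>refine_by_independent_set\<close>), so they are counted by the
valuative dimension of \<open>T\<^sub>M\<close>; those independent over \<open>F\<close> number at most \<open>d\<close>; and the steps visible in
\<open>F\<close> belong to a \<open>w\<close>-valuation overring of \<open>D\<close>.  Conversely, valuation rings of \<open>L\<close>, \<open>k\<close> and \<open>F\<close> are
composed into one of \<open>L\<close> by refinement (\<open>val_ring_refine_prime\<close>), and chains of rings lift along it
(\<open>lift_ring_chain\<close>).\<close>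

section \<open>Ideals and fractions inside an ambient field\<close>

text \<open>Ideals and primes of a subring \<open>B\<close> are taken as closure conditions in the ambient field, so that one set
can be an ideal of several subrings without any change of the ring structure.\<close>

definition ideal_in :: "('a, 'b) ring_scheme \<Rightarrow> 'a set \<Rightarrow> 'a set \<Rightarrow> bool" where
  "ideal_in K B I \<longleftrightarrow> I \<subseteq> B \<and> \<zero>\<^bsub>K\<^esub> \<in> I \<and> (\<forall>x\<in>I. \<forall>y\<in>I. x \<oplus>\<^bsub>K\<^esub> y \<in> I) \<and>
     (\<forall>b\<in>B. \<forall>x\<in>I. b \<otimes>\<^bsub>K\<^esub> x \<in> I)"

definition prime_in :: "('a, 'b) ring_scheme \<Rightarrow> 'a set \<Rightarrow> 'a set \<Rightarrow> bool" where
  "prime_in K B P \<longleftrightarrow> ideal_in K B P \<and> \<one>\<^bsub>K\<^esub> \<notin> P \<and>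
     (\<forall>a\<in>B. \<forall>b\<in>B. a \<otimes>\<^bsub>K\<^esub> b \<in> P \<longrightarrow> a \<in> P \<or> b \<in> P)"

text \<open>The maximal ideal of a valuation ring \<open>V\<close>.  The value of the inverse at zero is unspecified, hence the separate
disjunct.\<close>

definition nonunits :: "('a, 'b) ring_scheme \<Rightarrow> 'a set \<Rightarrow> 'a set" where
  "nonunits K V = {x \<in> V. x = \<zero>\<^bsub>K\<^esub> \<or> inv\<^bsub>K\<^esub> x \<notin> V}"

text \<open>Valuation rings of the subfield \<open>L\<close>, the trivial one \<open>L\<close> included.\<close>

definition val_ring :: "('a, 'b) ring_scheme \<Rightarrow> 'a set \<Rightarrow> 'a set \<Rightarrow> bool" where
  "val_ring K L V \<longleftrightarrow> subring V K \<and> V \<subseteq> L \<and>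
     (\<forall>x\<in>L. x = \<zero>\<^bsub>K\<^esub> \<or> x \<in> V \<or> inv\<^bsub>K\<^esub> x \<in> V)"

text \<open>For a subring \<open>A\<close> with a multiplicative subset \<open>S\<close> this is the localization, for an ideal its extension to
the localization.\<close>

definition fracs :: "('a, 'b) ring_scheme \<Rightarrow> 'a set \<Rightarrow> 'a set \<Rightarrow> 'a set" where
  "fracs K A S = {a \<otimes>\<^bsub>K\<^esub> inv\<^bsub>K\<^esub> s | a s. a \<in> A \<and> s \<in> S}"

locale ambient_field = field K for K (structure)
begin

lemma inv_closed_nz [simp, intro]: "x \<in> carrier K \<Longrightarrow> x \<noteq> \<zero> \<Longrightarrow> inv x \<in> carrier K"
  by (simp add: field_Units)

lemma mult_inv [simp]: "x \<in> carrier K \<Longrightarrow> x \<noteq> \<zero> \<Longrightarrow> x \<otimes> inv x = \<one>"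
  by (simp add: field_Units)

lemma inv_mult_self [simp]: "x \<in> carrier K \<Longrightarrow> x \<noteq> \<zero> \<Longrightarrow> inv x \<otimes> x = \<one>"
  by (simp add: field_Units)

lemma inv_nonzero [simp]: "x \<in> carrier K \<Longrightarrow> x \<noteq> \<zero> \<Longrightarrow> inv x \<noteq> \<zero>"
  using mult_inv[of x] by force

lemma inv_inv_nz [simp]: "x \<in> carrier K \<Longrightarrow> x \<noteq> \<zero> \<Longrightarrow> inv (inv x) = x"
  by (simp add: field_Units)

lemma mult_nonzero [simp]:
  "x \<in> carrier K \<Longrightarrow> y \<in> carrier K \<Longrightarrow> x \<noteq> \<zero> \<Longrightarrow> y \<noteq> \<zero> \<Longrightarrow> x \<otimes> y \<noteq> \<zero>"
  by (simp add: integral_iff)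

lemma inv_unique_nz: "x \<in> carrier K \<Longrightarrow> y \<in> carrier K \<Longrightarrow> x \<otimes> y = \<one> \<Longrightarrow> inv x = y"
  by (rule comm_inv_char)

lemma inv_mult_nz:
  assumes "x \<in> carrier K" "y \<in> carrier K" "x \<noteq> \<zero>" "y \<noteq> \<zero>"
  shows "inv (x \<otimes> y) = inv x \<otimes> inv y"
proof (rule inv_unique_nz)
  have "inv x \<in> carrier K" "inv y \<in> carrier K" using assms by auto
  then have "x \<otimes> y \<otimes> (inv x \<otimes> inv y) = (x \<otimes> inv x) \<otimes> (y \<otimes> inv y)"
    using assms(1,2) by (simp only: m_ac m_closed)
  then show "x \<otimes> y \<otimes> (inv x \<otimes> inv y) = \<one>" using assms by simp
qed (use assms in auto)

lemma cancel_inv_right [simp]: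
  "x \<in> carrier K \<Longrightarrow> y \<in> carrier K \<Longrightarrow> y \<noteq> \<zero> \<Longrightarrow> x \<otimes> inv y \<otimes> y = x"
  "x \<in> carrier K \<Longrightarrow> y \<in> carrier K \<Longrightarrow> y \<noteq> \<zero> \<Longrightarrow> x \<otimes> y \<otimes> inv y = x"
  by (simp_all add: m_assoc)

lemma frac_add:
  assumes "a \<in> carrier K" "b \<in> carrier K" "c \<in> carrier K" "d \<in> carrier K" "b \<noteq> \<zero>" "d \<noteq> \<zero>"
  shows "a \<otimes> inv b \<oplus> c \<otimes> inv d = (a \<otimes> d \<oplus> c \<otimes> b) \<otimes> inv (b \<otimes> d)"
proof -
  have "inv b \<in> carrier K" "inv d \<in> carrier K" using assms by auto
  then have "(a \<otimes> d \<oplus> c \<otimes> b) \<otimes> (inv b \<otimes> inv d)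
      = a \<otimes> inv b \<otimes> (d \<otimes> inv d) \<oplus> c \<otimes> inv d \<otimes> (b \<otimes> inv b)"
    using assms(1-4) by (simp only: m_ac l_distr m_closed)
  then show ?thesis using assms by (simp add: inv_mult_nz)
qed

lemma frac_mult:
  assumes "a \<in> carrier K" "b \<in> carrier K" "c \<in> carrier K" "d \<in> carrier K" "b \<noteq> \<zero>" "d \<noteq> \<zero>"
  shows "(a \<otimes> inv b) \<otimes> (c \<otimes> inv d) = (a \<otimes> c) \<otimes> inv (b \<otimes> d)"
  using assms by (simp add: inv_mult_nz m_ac)

lemma subring_carrier: "subring B K \<Longrightarrow> x \<in> B \<Longrightarrow> x \<in> carrier K"
  using subringE(1) by blast

lemma subring_minus: "subring B K \<Longrightarrow> x \<in> B \<Longrightarrow> y \<in> B \<Longrightarrow> x \<ominus> y \<in> B"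
  by (simp add: minus_eq subringE(5,7))

lemmas subring_closed = subringE(2) subringE(3) subringE(5) subringE(6) subringE(7) subring_minus

lemma ideal_inD:
  assumes "ideal_in K B I"
  shows "I \<subseteq> B" "\<zero> \<in> I" "\<And>x y. x \<in> I \<Longrightarrow> y \<in> I \<Longrightarrow> x \<oplus> y \<in> I"
    "\<And>b x. b \<in> B \<Longrightarrow> x \<in> I \<Longrightarrow> b \<otimes> x \<in> I"
  using assms by (auto simp: ideal_in_def)

lemma ideal_in_r:
  assumes "subring B K" "ideal_in K B I" "b \<in> B" "x \<in> I"
  shows "x \<otimes> b \<in> I"
proof -
  have "x \<in> B" using assms ideal_inD by blast
  then have "x \<otimes> b = b \<otimes> x" using assms m_comm subring_carrier by blast
  then show ?thesis using assms ideal_inD by simp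
qed

lemma ideal_in_neg:
  assumes "subring B K" "ideal_in K B I" "x \<in> I"
  shows "\<ominus> x \<in> I"
proof -
  have x: "x \<in> carrier K" using assms ideal_inD subring_carrier by blast
  have "\<ominus> \<one> \<in> B" using assms by (simp add: subring_closed)
  then have "(\<ominus> \<one>) \<otimes> x \<in> I" using assms ideal_inD by blast
  then show ?thesis using x by (simp add: l_minus)
qed

lemma ideal_in_minus:
  assumes "subring B K" "ideal_in K B I" "x \<in> I" "y \<in> I"
  shows "x \<ominus> y \<in> I"
  using assms by (simp add: minus_eq ideal_in_neg ideal_inD)

lemma ideal_in_full:
  assumes "subring B K" "ideal_in K B I" "\<one> \<in> I" shows "I = B"
proof
  show "B \<subseteq> I"
  proof
    fix b assume "b \<in> B"
    then have "b \<otimes> \<one> \<in> I" using assms ideal_inD by blast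
    then show "b \<in> I" using \<open>b \<in> B\<close> assms subring_carrier by fastforce
  qed
qed (use assms ideal_inD in auto)

lemma ideal_in_iff:
  assumes B: "subring B K"
  shows "ideal I (K\<lparr>carrier := B\<rparr>) \<longleftrightarrow> ideal_in K B I"
proof
  assume I: "ideal I (K\<lparr>carrier := B\<rparr>)"
  interpret I: ideal I "K\<lparr>carrier := B\<rparr>" by (rule I)
  show "ideal_in K B I"
    unfolding ideal_in_def
    using I.a_subset I.I_l_closed additive_subgroup.a_closed[OF I.is_additive_subgroup] additive_subgroup.zero_closed[OF I.is_additive_subgroup]
    by simp
next
  assume I: "ideal_in K B I"
  note i = ideal_inD[OF I]
  interpret B: ring "K\<lparr>carrier := B\<rparr>" using B subring_is_ring by blast
  show "ideal I (K\<lparr>carrier := B\<rparr>)"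
  proof (rule idealI[OF B.ring_axioms])
    show "subgroup I (add_monoid (K\<lparr>carrier := B\<rparr>))"
    proof (rule B.add.subgroupI)
      fix x assume x: "x \<in> I"
      then have xB: "x \<in> B" using i(1) by blast
      have n: "\<ominus> x \<in> I" using ideal_in_neg B I x by blast
      have "\<ominus> x \<in> B" using n i(1) by blast
      then have e: "\<ominus>\<^bsub>K\<lparr>carrier := B\<rparr>\<^esub> x = \<ominus> x"
        using xB B.minus_equality[of "\<ominus> x" x] subring_carrier[OF B xB] by (simp add: l_neg)
      show "\<ominus>\<^bsub>K\<lparr>carrier := B\<rparr>\<^esub> x \<in> I" using n e by simp
    next
      show "I \<noteq> {}" using i(2) by blast
    qed (use i(1,3) in simp_all)
  next
    fix a x assume *: "a \<in> I" "x \<in> carrier (K\<lparr>carrier := B\<rparr>)"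
    show "x \<otimes>\<^bsub>K\<lparr>carrier := B\<rparr>\<^esub> a \<in> I" using i(4)[of x a] * by simp
    show "a \<otimes>\<^bsub>K\<lparr>carrier := B\<rparr>\<^esub> x \<in> I" using ideal_in_r[OF B I, of x a] * by simp
  qed
qed

lemma prime_inD:
  assumes "prime_in K B P"
  shows "ideal_in K B P" "\<one> \<notin> P" "\<And>a b. a \<in> B \<Longrightarrow> b \<in> B \<Longrightarrow> a \<otimes> b \<in> P \<Longrightarrow> a \<in> P \<or> b \<in> P"
    "P \<subseteq> B" "\<zero> \<in> P"
  using assms unfolding prime_in_def ideal_in_def by blast+

lemma prime_in_iff:
  assumes B: "subring B K"
  shows "primeideal P (K\<lparr>carrier := B\<rparr>) \<longleftrightarrow> prime_in K B P"
proof
  assume P: "primeideal P (K\<lparr>carrier := B\<rparr>)"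
  interpret P: primeideal P "K\<lparr>carrier := B\<rparr>" by (rule P)
  have i: "ideal_in K B P" using ideal_in_iff[OF B] P.is_ideal by blast
  have "\<one> \<notin> P" using ideal_in_full[OF B i] P.I_notcarr by auto
  then show "prime_in K B P" unfolding prime_in_def using i P.I_prime by simp
next
  assume P: "prime_in K B P"
  interpret B: cring "K\<lparr>carrier := B\<rparr>" using B subring_is_domain domain.axioms(1) by blast
  have 1: "\<one> \<in> B" using B by (rule subringE(3))
  note p = prime_inD[OF P]
  show "primeideal P (K\<lparr>carrier := B\<rparr>)"
  proof (rule primeidealI[OF _ B.cring_axioms])
    show "ideal P (K\<lparr>carrier := B\<rparr>)" using p(1) ideal_in_iff[OF B] by blast
    show "carrier (K\<lparr>carrier := B\<rparr>) \<noteq> P" using 1 p(2) by auto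
    show "a \<in> P \<or> b \<in> P"
      if "a \<in> carrier (K\<lparr>carrier := B\<rparr>)" "b \<in> carrier (K\<lparr>carrier := B\<rparr>)"
        "a \<otimes>\<^bsub>K\<lparr>carrier := B\<rparr>\<^esub> b \<in> P" for a b
      using p(3)[of a b] that by simp
  qed
qed

text \<open>Used whenever an ideal of \<open>T\<close> not inside \<open>M\<close> provides an element congruent to one modulo \<open>M\<close>.\<close>

lemma prime_in_no_complement:
  assumes P: "prime_in K B P" and q: "q \<in> P" "q \<in> carrier K" shows "\<one> \<ominus> q \<notin> P"
proof
  assume "\<one> \<ominus> q \<in> P"
  then have "(\<one> \<ominus> q) \<oplus> q \<in> P" using ideal_inD(3)[OF prime_inD(1)[OF P]] q by blast
  moreover have "(\<one> \<ominus> q) \<oplus> q = \<one>" using q(2) by algebra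
  ultimately show False using prime_inD(2)[OF P] by simp
qed

lemma prime_in_contract:
  assumes A: "subring A K" and B: "subring B K" "A \<subseteq> B" and P: "prime_in K B P"
  shows "prime_in K A (P \<inter> A)"
proof -
  note a = subringE(2,3,6,7)[OF A] and p = prime_inD[OF P] and i = ideal_inD[OF prime_inD(1)[OF P]]
  have "ideal_in K A (P \<inter> A)" unfolding ideal_in_def
  proof (intro conjI ballI)
    show "\<zero> \<in> P \<inter> A" using a(1) i(2) by simp
    show "x \<oplus> y \<in> P \<inter> A" if "x \<in> P \<inter> A" "y \<in> P \<inter> A" for x y
      using that i(3)[of x y] a(4)[of x y] by simp
    show "b \<otimes> x \<in> P \<inter> A" if "b \<in> A" "x \<in> P \<inter> A" for b x
      using that i(4)[of b x] a(3)[of b x] B(2) by auto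
  qed simp
  then show ?thesis unfolding prime_in_def using p(2,3) B(2) by blast
qed

lemma prime_in_zero: "subring B K \<Longrightarrow> prime_in K B {\<zero>}"
  unfolding prime_in_def ideal_in_def
  using subringE(1)[of B K] integral subringE(2)[of B K] by (auto simp: subset_iff)

section \<open>Rings of fractions\<close>

lemma fracs_mono: "A \<subseteq> A' \<Longrightarrow> S \<subseteq> S' \<Longrightarrow> fracs K A S \<subseteq> fracs K A' S'"
  unfolding fracs_def by blast

lemma fracsI: "a \<in> A \<Longrightarrow> s \<in> S \<Longrightarrow> a \<otimes> inv s \<in> fracs K A S"
  unfolding fracs_def by blast

lemma fracs_incl:
  assumes "A \<subseteq> carrier K" "\<one> \<in> S" shows "A \<subseteq> fracs K A S"
proof
  fix a assume "a \<in> A"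
  then have "a \<otimes> inv \<one> = a" using assms by auto
  then show "a \<in> fracs K A S" using fracsI[OF \<open>a \<in> A\<close> assms(2)] by simp
qed

definition mult_set :: "'a set \<Rightarrow> 'a set \<Rightarrow> bool" where
  "mult_set B S \<longleftrightarrow> S \<subseteq> B - {\<zero>} \<and> \<one> \<in> S \<and> (\<forall>s\<in>S. \<forall>t\<in>S. s \<otimes> t \<in> S)"

lemma mult_set_prime:
  assumes "subring B K" "prime_in K B P" shows "mult_set B (B - P)"
  using subringE(3,6)[OF assms(1)] prime_inD(2,3,5)[OF assms(2)] unfolding mult_set_def by blast

lemma mult_set_nonzero: "subring B K \<Longrightarrow> mult_set B (B - {\<zero>})"
  by (rule mult_set_prime[OF _ prime_in_zero])

lemma fracs_add_closed:
  assumes B: "subring B K" and S: "mult_set B S" and I: "ideal_in K B I"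
    and x: "x \<in> fracs K I S" and y: "y \<in> fracs K I S"
  shows "x \<oplus> y \<in> fracs K I S"
proof -
  obtain a b c d where *: "x = a \<otimes> inv b" "y = c \<otimes> inv d" "a \<in> I" "b \<in> S" "c \<in> I" "d \<in> S"
    using x y unfolding fracs_def by blast
  have BS: "b \<in> B" "d \<in> B" "b \<noteq> \<zero>" "d \<noteq> \<zero>" using * S unfolding mult_set_def by auto
  have IB: "a \<in> B" "c \<in> B" using * ideal_inD(1)[OF I] by auto
  have "x \<oplus> y = (a \<otimes> d \<oplus> c \<otimes> b) \<otimes> inv (b \<otimes> d)"
    using * BS IB B by (auto intro!: frac_add simp: subring_carrier[OF B])
  moreover have "a \<otimes> d \<oplus> c \<otimes> b \<in> I"
    using * BS B I by (auto intro!: ideal_inD(3)[OF I] ideal_in_r[OF B I])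
  moreover have "b \<otimes> d \<in> S" using * S unfolding mult_set_def by blast
  ultimately show ?thesis using fracsI by simp
qed

lemma fracs_mult_closed:
  assumes B: "subring B K" and S: "mult_set B S" and I: "ideal_in K B I"
    and x: "x \<in> fracs K B S" and y: "y \<in> fracs K I S"
  shows "x \<otimes> y \<in> fracs K I S"
proof -
  obtain a b c d where *: "x = a \<otimes> inv b" "y = c \<otimes> inv d" "a \<in> B" "b \<in> S" "c \<in> I" "d \<in> S"
    using x y unfolding fracs_def by blast
  have BS: "b \<in> B" "d \<in> B" "b \<noteq> \<zero>" "d \<noteq> \<zero>" using * S unfolding mult_set_def by auto
  have IB: "c \<in> B" using * ideal_inD(1)[OF I] by auto
  have "x \<otimes> y = (a \<otimes> c) \<otimes> inv (b \<otimes> d)"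
    using * BS IB by (auto intro!: frac_mult simp: subring_carrier[OF B])
  moreover have "a \<otimes> c \<in> I" using * I by (auto intro!: ideal_inD(4)[OF I])
  moreover have "b \<otimes> d \<in> S" using * S unfolding mult_set_def by blast
  ultimately show ?thesis using fracsI by simp
qed

lemma ideal_in_self: "subring B K \<Longrightarrow> ideal_in K B B"
  by (simp add: ideal_in_def subringE)

lemma fracs_carrier:
  assumes B: "subring B K" and S: "mult_set B S" shows "fracs K B S \<subseteq> carrier K"
proof
  fix x assume "x \<in> fracs K B S"
  then obtain b s where *: "x = b \<otimes> inv s" "b \<in> B" "s \<in> S" unfolding fracs_def by blast
  then have "b \<in> carrier K" "s \<in> carrier K" "s \<noteq> \<zero>"
    using S subringE(1)[OF B] unfolding mult_set_def by blast+
  then show "x \<in> carrier K" using * by simp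
qed

lemma fracs_subring:
  assumes B: "subring B K" and S: "mult_set B S"
  shows "subring (fracs K B S) K"
proof (rule subringI)
  show c: "fracs K B S \<subseteq> carrier K" by (rule fracs_carrier[OF B S])
  have inc: "B \<subseteq> fracs K B S"
    using S by (intro fracs_incl subringE(1)[OF B]) (auto simp: mult_set_def)
  then show "\<one> \<in> fracs K B S" using subringE(3)[OF B] by blast
  fix x y assume x: "x \<in> fracs K B S" and y: "y \<in> fracs K B S"
  show "x \<oplus> y \<in> fracs K B S" using fracs_add_closed[OF B S ideal_in_self[OF B] x y] .
  show "x \<otimes> y \<in> fracs K B S" using fracs_mult_closed[OF B S ideal_in_self[OF B] x y] .
  have "\<ominus> \<one> \<in> fracs K B S" using inc subring_closed[OF B] by blast
  then have "(\<ominus> \<one>) \<otimes> x \<in> fracs K B S" using fracs_mult_closed[OF B S ideal_in_self[OF B] _ x] by blast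
  then show "\<ominus> x \<in> fracs K B S" using c x by (auto simp: l_minus)
qed

lemma fracs_ideal:
  assumes B: "subring B K" and S: "mult_set B S" and I: "ideal_in K B I"
  shows "ideal_in K (fracs K B S) (fracs K I S)"
proof -
  have "I \<subseteq> fracs K I S" 
    using S ideal_inD(1)[OF I] subringE(1)[OF B] unfolding mult_set_def by (intro fracs_incl) auto
  then show ?thesis
    unfolding ideal_in_def
    using fracs_mono[OF ideal_inD(1)[OF I] subset_refl] ideal_inD(2)[OF I]
      fracs_add_closed[OF B S I] fracs_mult_closed[OF B S I] by blast
qed

lemma fracs_inv:
  assumes B: "subring B K" and S: "mult_set B S" and s: "s \<in> S" shows "inv s \<in> fracs K B S"
proof -
  have "s \<in> carrier K" "s \<noteq> \<zero>" using s S subringE(1)[OF B] unfolding mult_set_def by auto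
  then have "\<one> \<otimes> inv s = inv s" by simp
  then show ?thesis using fracsI[OF subringE(3)[OF B] s] by simp
qed

text \<open>The contraction of an extended ideal; for a prime disjoint from \<open>S\<close> the factor \<open>s\<close> cancels.\<close>

lemma fracs_mem_ideal:
  assumes B: "subring B K" and S: "mult_set B S" and I: "ideal_in K B I"
    and x: "x \<in> B" "x \<in> fracs K I S"
  shows "\<exists>s\<in>S. x \<otimes> s \<in> I"
proof -
  obtain a s where *: "x = a \<otimes> inv s" "a \<in> I" "s \<in> S" using x(2) unfolding fracs_def by blast
  have "s \<in> carrier K" "s \<noteq> \<zero>" "a \<in> carrier K"
    using * S ideal_inD(1)[OF I] subringE(1)[OF B] unfolding mult_set_def by blast+
  then have "x \<otimes> s = a" using * by simp
  then show ?thesis using * by blast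
qed

lemma fracs_proper:
  assumes B: "subring B K" and S: "mult_set B S" and I: "ideal_in K B I" and d: "I \<inter> S = {}"
  shows "\<one> \<notin> fracs K I S"
proof
  assume "\<one> \<in> fracs K I S"
  then obtain s where "s \<in> S" "\<one> \<otimes> s \<in> I"
    using fracs_mem_ideal[OF B S I] subringE(3)[OF B] by blast
  moreover have "s \<in> carrier K" using \<open>s \<in> S\<close> S subringE(1)[OF B] unfolding mult_set_def by blast
  ultimately show False using d by auto
qed

lemma qf_eq_fracs: "qf K B = fracs K B (B - {\<zero>})"
  unfolding qf_def fracs_def by auto

lemma localize_eq_fracs: "localize K B P = fracs K B (B - P)"
  unfolding localize_def fracs_def by auto

end

section \<open>Polynomial expressions over an ideal\<close>

context ambient_field
begin

lemma subfield_inv: "subfield L K \<Longrightarrow> x \<in> L \<Longrightarrow> x \<noteq> \<zero> \<Longrightarrow> inv x \<in> L"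
  using subfield_m_inv(1) by blast

text \<open>The values at \<open>x\<close> of the polynomials of degree at most \<open>n\<close> with coefficients in \<open>A\<close>, where \<open>A\<close> is a
subring or an ideal of one.  Horner's form makes the multiplication by \<open>x\<close> and the removal of the constant
term immediate.\<close>

fun horner :: "'a \<Rightarrow> 'a set \<Rightarrow> nat \<Rightarrow> 'a set" where
  "horner x A 0 = A"
| "horner x A (Suc n) = {a \<oplus> x \<otimes> p | a p. a \<in> A \<and> p \<in> horner x A n}"

lemma hornerI: "a \<in> A \<Longrightarrow> p \<in> horner x A n \<Longrightarrow> a \<oplus> x \<otimes> p \<in> horner x A (Suc n)"
  by auto

lemma hornerE:
  assumes "q \<in> horner x A (Suc n)"
  obtains a p where "q = a \<oplus> x \<otimes> p" "a \<in> A" "p \<in> horner x A n"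
  using assms by auto

lemma horner_in_carrier:
  assumes "A \<subseteq> carrier K" "x \<in> carrier K"
  shows "p \<in> horner x A n \<Longrightarrow> p \<in> carrier K"
proof (induction n arbitrary: p)
  case 0 then show ?case using assms by auto
next
  case (Suc n)
  obtain a q where *: "p = a \<oplus> x \<otimes> q" "a \<in> A" "q \<in> horner x A n" using hornerE[OF Suc.prems] .
  then show ?case using Suc.IH[of q] assms by auto
qed

context
  fixes B A x
  assumes B: "subring B K" and A: "ideal_in K B A" and x: "x \<in> carrier K"
begin

lemma A_carrier: "a \<in> A \<Longrightarrow> a \<in> carrier K"
  using ideal_inD(1)[OF A] subringE(1)[OF B] by blast

lemma horner_carrier: "p \<in> horner x A n \<Longrightarrow> p \<in> carrier K"
  using horner_in_carrier[of A x p n] x A_carrier by blast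

lemma horner_add: "p \<in> horner x A n \<Longrightarrow> q \<in> horner x A n \<Longrightarrow> p \<oplus> q \<in> horner x A n"
proof (induction n arbitrary: p q)
  case 0 then show ?case using ideal_inD(3)[OF A] by simp
next
  case (Suc n)
  obtain a p' where 1: "p = a \<oplus> x \<otimes> p'" "a \<in> A" "p' \<in> horner x A n" using hornerE[OF Suc.prems(1)] .
  obtain b q' where 2: "q = b \<oplus> x \<otimes> q'" "b \<in> A" "q' \<in> horner x A n" using hornerE[OF Suc.prems(2)] .
  have c: "a \<in> carrier K" "b \<in> carrier K" "p' \<in> carrier K" "q' \<in> carrier K"
    using 1 2 A_carrier horner_carrier by auto
  then have "p \<oplus> q = (a \<oplus> b) \<oplus> x \<otimes> (p' \<oplus> q')" using 1(1) 2(1) x by (simp add: r_distr a_ac)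
  moreover have "a \<oplus> b \<in> A" using ideal_inD(3)[OF A] 1 2 by blast
  ultimately show ?case using hornerI Suc.IH[OF 1(3) 2(3)] by metis
qed

lemma horner_smult: "b \<in> B \<Longrightarrow> p \<in> horner x A n \<Longrightarrow> b \<otimes> p \<in> horner x A n"
proof (induction n arbitrary: p)
  case 0 then show ?case using ideal_inD(4)[OF A] by simp
next
  case (Suc n)
  obtain a p' where 1: "p = a \<oplus> x \<otimes> p'" "a \<in> A" "p' \<in> horner x A n" using hornerE[OF Suc.prems(2)] .
  have c: "a \<in> carrier K" "b \<in> carrier K" "p' \<in> carrier K"
    using 1 A_carrier horner_carrier Suc.prems subring_carrier[OF B] by auto
  then have "b \<otimes> p = b \<otimes> a \<oplus> x \<otimes> (b \<otimes> p')" using 1(1) x by (simp add: r_distr m_ac)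
  moreover have "b \<otimes> a \<in> A" using ideal_inD(4)[OF A] 1 Suc.prems by blast
  ultimately show ?case using hornerI Suc.IH[OF Suc.prems(1) 1(3)] by metis
qed

lemma horner_shift: "p \<in> horner x A n \<Longrightarrow> x \<otimes> p \<in> horner x A (Suc n)"
  using hornerI[OF ideal_inD(2)[OF A], of p x n] horner_carrier[of p n] x by simp

lemma horner_Suc_mono: "horner x A n \<subseteq> horner x A (Suc n)"
proof (induction n)
  case 0
  show ?case
  proof
    fix a assume a: "a \<in> horner x A 0"
    then have "a \<oplus> x \<otimes> \<zero> \<in> horner x A (Suc 0)" using ideal_inD(2)[OF A] by (intro hornerI) auto
    then show "a \<in> horner x A (Suc 0)" using a A_carrier x by simp
  qed
next
  case (Suc n)
  show ?case
  proof
    fix p assume "p \<in> horner x A (Suc n)"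
    then obtain a q where "p = a \<oplus> x \<otimes> q" "a \<in> A" "q \<in> horner x A n" using hornerE by blast
    then show "p \<in> horner x A (Suc (Suc n))" using Suc hornerI by blast
  qed
qed

lemma horner_mono: "n \<le> m \<Longrightarrow> horner x A n \<subseteq> horner x A m"
  by (rule lift_Suc_mono_le[of "horner x A"]) (use horner_Suc_mono in auto)

lemma horner_mult:
  "p \<in> horner x B m \<Longrightarrow> q \<in> horner x A n \<Longrightarrow> p \<otimes> q \<in> horner x A (m + n)"
proof (induction m arbitrary: p)
  case 0 then show ?case using horner_smult by simp
next
  case (Suc m)
  obtain b p' where 1: "p = b \<oplus> x \<otimes> p'" "b \<in> B" "p' \<in> horner x B m" using hornerE[OF Suc.prems(1)] .
  have c: "b \<in> carrier K" "q \<in> carrier K" "p' \<in> carrier K"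
    using 1 horner_carrier Suc.prems subring_carrier[OF B] horner_in_carrier[OF subringE(1)[OF B] x 1(3)] by auto
  then have e: "p \<otimes> q = b \<otimes> q \<oplus> x \<otimes> (p' \<otimes> q)" using 1(1) x by (simp add: l_distr r_distr m_ac)
  have "b \<otimes> q \<in> horner x A (Suc m + n)"
    using horner_smult[OF 1(2) Suc.prems(2)] horner_mono[of n "Suc m + n"] by auto
  moreover have "x \<otimes> (p' \<otimes> q) \<in> horner x A (Suc m + n)"
    using horner_shift[OF Suc.IH[OF 1(3) Suc.prems(2)]] by simp
  ultimately show ?case unfolding e by (rule horner_add)
qed

lemma horner_pow_shift: "p \<in> horner x A n \<Longrightarrow> x [^] (k::nat) \<otimes> p \<in> horner x A (k + n)"
proof (induction k)
  case 0 then show ?case using horner_carrier by simp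
next
  case (Suc k)
  have "p \<in> carrier K" using horner_carrier Suc.prems by blast
  then have "x [^] Suc k \<otimes> p = x \<otimes> (x [^] k \<otimes> p)" using x by (simp add: m_ac)
  then show ?case using horner_shift[OF Suc.IH[OF Suc.prems]] by simp
qed

text \<open>The leading term can be split off as well.\<close>

lemma horner_top:
  "p \<in> horner x A (Suc n) \<Longrightarrow> \<exists>q\<in>horner x A n. \<exists>a\<in>A. p = q \<oplus> x [^] Suc n \<otimes> a"
proof (induction n arbitrary: p)
  case 0
  obtain a q where "p = a \<oplus> x \<otimes> q" "a \<in> A" "q \<in> A" using hornerE[OF 0] by auto
  then show ?case using x A_carrier by auto
next
  case (Suc n)
  obtain a q where 1: "p = a \<oplus> x \<otimes> q" "a \<in> A" "q \<in> horner x A (Suc n)" using hornerE[OF Suc.prems] .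
  obtain r b where 2: "r \<in> horner x A n" "b \<in> A" "q = r \<oplus> x [^] Suc n \<otimes> b" using Suc.IH[OF 1(3)] by blast
  have c: "a \<in> carrier K" "b \<in> carrier K" "r \<in> carrier K" using 1 2 A_carrier horner_carrier by auto
  have "p = (a \<oplus> x \<otimes> r) \<oplus> x [^] Suc (Suc n) \<otimes> b"
    unfolding 1(1) 2(3) using c x by (simp add: r_distr m_ac a_ac)
  then show ?case using hornerI[OF 1(2) 2(1)] 2(2) by blast
qed

text \<open>Multiplying a polynomial of degree \<open>n\<close> in \<open>inv x\<close> by \<open>x\<close> to the power \<open>n\<close> reverses its coefficients.\<close>

lemma horner_reverse:
  assumes nz: "x \<noteq> \<zero>"
  shows "q \<in> horner (inv x) A n \<Longrightarrow> x [^] n \<otimes> q \<in> horner x A n"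
proof (induction n arbitrary: q)
  case 0 then show ?case using A_carrier by simp
next
  case (Suc n)
  obtain a p where 1: "q = a \<oplus> inv x \<otimes> p" "a \<in> A" "p \<in> horner (inv x) A n" using hornerE[OF Suc.prems] .
  have c: "a \<in> carrier K" "p \<in> carrier K" "inv x \<in> carrier K" "x [^] n \<in> carrier K"
    using 1 A_carrier x nz horner_in_carrier[of A "inv x" p n] by auto
  have "x [^] Suc n \<otimes> q = x [^] Suc n \<otimes> a \<oplus> x [^] n \<otimes> ((x \<otimes> inv x) \<otimes> p)"
    unfolding 1(1) nat_pow_Suc using c x by (simp only: r_distr m_ac m_closed)
  also have "\<dots> = x [^] Suc n \<otimes> a \<oplus> x [^] n \<otimes> p" using x nz c by simp
  also have "\<dots> \<in> horner x A (Suc n)"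
  proof (rule horner_add)
    show "x [^] Suc n \<otimes> a \<in> horner x A (Suc n)" using horner_pow_shift[of a 0 "Suc n"] 1(2) by simp
    show "x [^] n \<otimes> p \<in> horner x A (Suc n)" using Suc.IH[OF 1(3)] horner_Suc_mono by blast
  qed
  finally show ?case .
qed

end

definition adjoin :: "'a \<Rightarrow> 'a set \<Rightarrow> 'a set" where
  "adjoin x A = (\<Union>n. horner x A n)"

lemma adjoin_incl: "A \<subseteq> adjoin x A"
  unfolding adjoin_def using horner.simps(1)[of x A] by blast

lemma horner_pairs:
  assumes B: "subring B K" and A: "ideal_in K B A" and x: "x \<in> carrier K"
    and "p \<in> adjoin x A" "q \<in> adjoin x A"
  obtains n where "p \<in> horner x A n" "q \<in> horner x A n"
proof -
  obtain m n where *: "p \<in> horner x A m" "q \<in> horner x A n" using assms(4,5) unfolding adjoin_def by blast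
  then have "p \<in> horner x A (max m n)" "q \<in> horner x A (max m n)"
    using horner_mono[OF B A x, of m "max m n"] horner_mono[OF B A x, of n "max m n"] by auto
  then show thesis by (rule that)
qed

lemma adjoin_add:
  assumes B: "subring B K" and A: "ideal_in K B A" and x: "x \<in> carrier K"
    and "p \<in> adjoin x A" "q \<in> adjoin x A"
  shows "p \<oplus> q \<in> adjoin x A"
proof -
  obtain n where "p \<in> horner x A n" "q \<in> horner x A n" using horner_pairs[OF assms] .
  then have "p \<oplus> q \<in> horner x A n" by (rule horner_add[OF B A x])
  then show ?thesis unfolding adjoin_def by blast
qed

lemma adjoin_mult:
  assumes B: "subring B K" and A: "ideal_in K B A" and x: "x \<in> carrier K"
    and "p \<in> adjoin x B" "q \<in> adjoin x A"
  shows "p \<otimes> q \<in> adjoin x A"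
proof -
  obtain m n where *: "p \<in> horner x B m" "q \<in> horner x A n" using assms(4,5) unfolding adjoin_def by blast
  have "p \<otimes> q \<in> horner x A (m + n)"
    by (rule horner_mult[OF B A x *])
  then show ?thesis unfolding adjoin_def by blast
qed

lemma adjoin_subring:
  assumes B: "subring B K" and x: "x \<in> carrier K"
  shows "subring (adjoin x B) K"
proof (rule subringI)
  note I = ideal_in_self[OF B]
  show c: "adjoin x B \<subseteq> carrier K"
    unfolding adjoin_def using horner_carrier[OF B I x] by blast
  show "\<one> \<in> adjoin x B" using adjoin_incl subringE(3)[OF B] by blast
  fix p q assume p: "p \<in> adjoin x B" and q: "q \<in> adjoin x B"
  show "p \<oplus> q \<in> adjoin x B" using adjoin_add[OF B I x p q] .
  show "p \<otimes> q \<in> adjoin x B" using adjoin_mult[OF B I x p q] .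
  have "\<ominus> \<one> \<in> adjoin x B" using adjoin_incl subringE(3,5)[OF B] by blast
  then have "(\<ominus> \<one>) \<otimes> p \<in> adjoin x B" using adjoin_mult[OF B I x _ p] by blast
  then show "\<ominus> p \<in> adjoin x B" using c p by (auto simp: l_minus)
qed

lemma adjoin_ideal:
  assumes B: "subring B K" and A: "ideal_in K B A" and x: "x \<in> carrier K"
  shows "ideal_in K (adjoin x B) (adjoin x A)"
  unfolding ideal_in_def
proof (intro conjI ballI)
  have "horner x A n \<subseteq> horner x B n" for n
  proof (induction n)
    case 0 then show ?case using ideal_inD(1)[OF A] by simp
  next
    case (Suc n)
    then show ?case using ideal_inD(1)[OF A] by (auto 0 3)
  qed
  then show "adjoin x A \<subseteq> adjoin x B" unfolding adjoin_def by blast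
  show "\<zero> \<in> adjoin x A" using adjoin_incl ideal_inD(2)[OF A] by blast
qed (use adjoin_add[OF B A x] adjoin_mult[OF B A x] in blast)+

lemma adjoin_mem:
  assumes B: "subring B K" and x: "x \<in> carrier K" shows "x \<in> adjoin x B"
proof -
  have "\<zero> \<oplus> x \<otimes> \<one> \<in> horner x B (Suc 0)"
    using subringE(2,3)[OF B] by (intro hornerI) auto
  then have "x \<in> horner x B (Suc 0)" using x by simp
  then show ?thesis unfolding adjoin_def by blast
qed

lemma adjoin_subset:
  assumes "subring L K" "B \<subseteq> L" "x \<in> L" shows "adjoin x B \<subseteq> L"
proof -
  have "horner x B n \<subseteq> L" for n
  proof (induction n)
    case (Suc n)
    show ?case
    proof
      fix p assume "p \<in> horner x B (Suc n)"
      then obtain a q where "p = a \<oplus> x \<otimes> q" "a \<in> B" "q \<in> horner x B n" using hornerE by blast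
      then show "p \<in> L" using Suc subringE(6,7)[OF assms(1)] assms(2,3) by blast
    qed
  qed (use assms in simp)
  then show ?thesis unfolding adjoin_def by blast
qed

text \<open>Let \<open>1 = b + q / x\<close> with \<open>b\<close> in \<open>J\<close> and \<open>q\<close> of degree \<open>m\<close> in \<open>inv x\<close>.  Since \<open>1 - b\<close> is a unit, \<open>x\<close> is
itself such a polynomial of degree \<open>m\<close>, and after multiplication by a power of \<open>x\<close> the power with exponent
\<open>m + 1\<close> is a combination of lower ones with coefficients in \<open>J\<close>.  Hence all terms of degree above \<open>m\<close> can
be eliminated from a polynomial in \<open>x\<close> with coefficients in \<open>J\<close>.\<close>

lemma horner_degree_drop:
  assumes C: "subring C K" and J: "ideal_in K C J"
    and loc: "\<And>s. s \<in> C \<Longrightarrow> \<one> \<ominus> s \<in> J \<Longrightarrow> s \<noteq> \<zero> \<and> inv s \<in> C"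
    and x: "x \<in> carrier K" "x \<noteq> \<zero>"
    and one: "\<one> \<in> horner (inv x) J (Suc m)"
    and n: "\<one> \<in> horner x J n"
  shows "\<one> \<in> horner x J m"
proof -
  have ix: "inv x \<in> carrier K" using x by simp
  note hc = horner_carrier[OF C J]
  obtain b q where 1: "\<one> = b \<oplus> inv x \<otimes> q" "b \<in> J" "q \<in> horner (inv x) J m" using hornerE[OF one] .
  have c: "b \<in> carrier K" "q \<in> carrier K" using 1 A_carrier[OF C J] hc[OF ix] by auto
  define s where "s = \<one> \<ominus> b"
  have bC: "b \<in> C" using 1 ideal_inD(1)[OF J] by blast
  have sC: "s \<in> C" unfolding s_def using subring_minus[OF C subringE(3)[OF C] bC] .
  have "\<one> \<ominus> s = b" unfolding s_def using c by algebra
  then have s: "s \<noteq> \<zero>" "inv s \<in> C" using loc[OF sC] 1 by auto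
  have sc: "s \<in> carrier K" "inv s \<in> carrier K" using sC s subring_carrier[OF C] by auto
  have "s = (b \<oplus> inv x \<otimes> q) \<ominus> b" unfolding s_def using 1(1) by simp
  also have "\<dots> = inv x \<otimes> q" using c ix by algebra
  finally have "x \<otimes> s = (x \<otimes> inv x) \<otimes> q" using x(1) ix c(2) by (simp only: m_assoc)
  then have xs: "x \<otimes> s = q" using x c by simp
  have "x \<otimes> s \<otimes> inv s = x" using x(1) sc(1) s(1) by simp
  then have "x = q \<otimes> inv s" unfolding xs by simp
  then have x_eq: "x = inv s \<otimes> q" using m_comm[OF c(2) sc(2)] by simp
  have mem: "inv s \<otimes> q \<in> horner (inv x) J m" using horner_smult[OF C J ix s(2) 1(3)] .
  have pow: "x [^] Suc m \<in> horner x J m"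
  proof -
    have "x [^] m \<otimes> (inv s \<otimes> q) \<in> horner x J m"
      by (rule horner_reverse[OF C J x mem])
    then show ?thesis using x_eq by simp
  qed
  have "horner x J (m + j) \<subseteq> horner x J m" for j
  proof (induction j)
    case (Suc j)
    show ?case
    proof
      fix p assume "p \<in> horner x J (m + Suc j)"
      then obtain q a where 2: "q \<in> horner x J (m + j)" "a \<in> J" "p = q \<oplus> x [^] Suc (m + j) \<otimes> a"
        using horner_top[OF C J x(1), of p "m + j"] by auto
      have ac: "a \<in> carrier K" "a \<in> C" using 2 A_carrier[OF C J] ideal_inD(1)[OF J] by auto
      have "x [^] Suc (m + j) = x [^] j \<otimes> x [^] Suc m"
        using x by (simp add: add.commute[of m j] nat_pow_mult[symmetric] m_assoc)
      then have "x [^] Suc (m + j) \<in> horner x J (m + j)"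
        using horner_pow_shift[OF C J x(1) pow, of j] by (simp add: add.commute)
      then have "x [^] Suc (m + j) \<otimes> a \<in> horner x J (m + j)"
        using horner_smult[OF C J x(1) ac(2)] ac x by (metis m_comm nat_pow_closed)
      then have "p \<in> horner x J (m + j)" using 2 horner_add[OF C J x(1)] by simp
      then show "p \<in> horner x J m" using Suc.IH by blast
    qed
  qed simp
  moreover have "\<one> \<in> horner x J (m + n)" using n horner_mono[OF C J x(1), of n "m + n"] by auto
  ultimately show ?thesis by blast
qed

text \<open>The two minimal degrees of expressions for one would each be smaller than the other.\<close>

lemma horner_no_both:
  assumes C: "subring C K" and J: "ideal_in K C J" and one: "\<one> \<notin> J"
    and loc: "\<And>s. s \<in> C \<Longrightarrow> \<one> \<ominus> s \<in> J \<Longrightarrow> s \<noteq> \<zero> \<and> inv s \<in> C"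
    and x: "x \<in> carrier K" "x \<noteq> \<zero>"
  shows "\<not> (\<one> \<in> adjoin x J \<and> \<one> \<in> adjoin (inv x) J)"
proof
  assume "\<one> \<in> adjoin x J \<and> \<one> \<in> adjoin (inv x) J"
  then obtain a b where ab: "\<one> \<in> horner x J a" "\<one> \<in> horner (inv x) J b" unfolding adjoin_def by blast
  define n m where "n = (LEAST a. \<one> \<in> horner x J a)" and "m = (LEAST b. \<one> \<in> horner (inv x) J b)"
  have nm: "\<one> \<in> horner x J n" "\<one> \<in> horner (inv x) J m"
    unfolding n_def m_def 
    using LeastI[of "\<lambda>a. \<one> \<in> horner x J a", OF ab(1)]
      LeastI[of "\<lambda>b. \<one> \<in> horner (inv x) J b", OF ab(2)] by auto
  have min: "\<one> \<in> horner x J a \<Longrightarrow> n \<le> a" "\<one> \<in> horner (inv x) J a \<Longrightarrow> m \<le> a" for a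
    unfolding n_def m_def by (auto intro: Least_le)
  have "n \<noteq> 0" "m \<noteq> 0" using nm one horner.simps(1) by metis+
  then obtain n' m' where S: "n = Suc n'" "m = Suc m'" using not0_implies_Suc by blast
  have "\<one> \<in> horner x J m'"
    by (rule horner_degree_drop[OF C J loc x _ nm(1)]) (use nm(2) S in simp_all)
  moreover have "\<one> \<in> horner (inv x) J n'"
    by (rule horner_degree_drop[OF C J loc _ _ _ nm(2)]) (use nm(1) S x in simp_all)
  ultimately show False using min S by fastforce
qed

end

section \<open>Existence and domination of valuation rings\<close>

context ambient_field
begin

lemma val_ringD:
  assumes "val_ring K L V"
  shows "subring V K" "V \<subseteq> L" "\<And>x. x \<in> L \<Longrightarrow> x \<noteq> \<zero> \<Longrightarrow> x \<in> V \<or> inv x \<in> V"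
  using assms unfolding val_ring_def by blast+

text \<open>Localizing at the elements congruent to one modulo \<open>J\<close> enlarges \<open>C\<close> and keeps \<open>J\<close> proper, so by maximality
these elements are units of \<open>C\<close>.  Adjoining an element \<open>x\<close> outside \<open>C\<close> must make \<open>J\<close> improper, and
this cannot happen both for \<open>x\<close> and for \<open>inv x\<close>.\<close>

lemma dominating_maximal_is_val_ring:
  assumes L: "subfield L K" and C: "subring C K" "C \<subseteq> L" and J: "ideal_in K C J" "\<one> \<notin> J"
    and max: "\<And>C' J'. subring C' K \<Longrightarrow> C' \<subseteq> L \<Longrightarrow> C \<subseteq> C' \<Longrightarrow> ideal_in K C' J' \<Longrightarrow> \<one> \<notin> J' \<Longrightarrow> J \<subseteq> J' \<Longrightarrow>
        C' = C"
  shows "val_ring K L C \<and> J \<subseteq> nonunits K C"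
proof -
  note L' = subfieldE(1)[OF L]
  have loc: "s \<noteq> \<zero> \<and> inv s \<in> C" if s: "s \<in> C" "\<one> \<ominus> s \<in> J" for s
  proof -
    \<comment> \<open>the elements congruent to one modulo \<open>J\<close>\<close>
    define S where "S = {s \<in> C. \<one> \<ominus> s \<in> J}"
    have nz: "s \<noteq> \<zero>" if "s \<in> S" for s
    proof
      assume "s = \<zero>"
      then have "\<one> \<ominus> s = \<one>" by (simp add: minus_eq)
      then show False using that J(2) unfolding S_def by simp
    qed
    have S: "mult_set C S"
      unfolding mult_set_def
    proof (intro conjI ballI)
      show "S \<subseteq> C - {\<zero>}" using nz unfolding S_def by blast
      show "\<one> \<in> S" using subringE(3)[OF C(1)] ideal_inD(2)[OF J(1)] by (simp add: S_def minus_eq r_neg)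
      fix s t assume st: "s \<in> S" "t \<in> S"
      then have c: "s \<in> C" "t \<in> C" "s \<in> carrier K" "t \<in> carrier K" "\<one> \<ominus> s \<in> J" "\<one> \<ominus> t \<in> J"
        using subring_carrier[OF C(1)] by (auto simp: S_def)
      have "\<one> \<ominus> s \<otimes> t = (\<one> \<ominus> s) \<oplus> s \<otimes> (\<one> \<ominus> t)" using c by algebra
      moreover have "s \<otimes> (\<one> \<ominus> t) \<in> J" using ideal_inD(4)[OF J(1)] c by blast
      ultimately have "\<one> \<ominus> s \<otimes> t \<in> J" using ideal_inD(3)[OF J(1)] c by simp
      then show "s \<otimes> t \<in> S" using c subringE(6)[OF C(1)] by (simp add: S_def)
    qed
    have "J \<inter> S = {}"
    proof (rule ccontr)
      assume "J \<inter> S \<noteq> {}"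
      then obtain s where *: "s \<in> J" "\<one> \<ominus> s \<in> J" "s \<in> C" unfolding S_def by blast
      have sc: "s \<in> carrier K" using * subring_carrier[OF C(1)] by blast
      have "(\<one> \<ominus> s) \<oplus> s \<in> J" using ideal_inD(3)[OF J(1)] * by blast
      moreover have "(\<one> \<ominus> s) \<oplus> s = \<one>" using sc by algebra
      ultimately show False using J(2) by simp
    qed
    then have "\<one> \<notin> fracs K J S" using fracs_proper[OF C(1) S J(1)] by blast
    moreover have "fracs K C S \<subseteq> L"
    proof
      fix x assume "x \<in> fracs K C S"
      then obtain a b where "x = a \<otimes> inv b" "a \<in> C" "b \<in> S" unfolding fracs_def by blast
      then show "x \<in> L" using nz C(2) subringE(6)[OF L'] subfield_inv[OF L] unfolding S_def by blast
    qed
    moreover have "C \<subseteq> fracs K C S" "J \<subseteq> fracs K J S"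
      using fracs_incl[of C S] fracs_incl[of J S] S subringE(1)[OF C(1)] ideal_inD(1)[OF J(1)]
      unfolding mult_set_def by auto
    ultimately have "fracs K C S = C"
      using max[OF fracs_subring[OF C(1) S] _ _ fracs_ideal[OF C(1) S J(1)]] by blast
    moreover have "s \<in> S" using s by (simp add: S_def)
    ultimately show ?thesis using fracs_inv[OF C(1) S] nz by blast
  qed
  have ad: "\<one> \<in> adjoin x J" if x: "x \<in> L" "x \<notin> C" for x
  proof (rule ccontr)
    assume no: "\<one> \<notin> adjoin x J"
    have xc: "x \<in> carrier K" using subring_carrier[OF L'] x by blast
    have "adjoin x C = C"
      by (rule max[OF adjoin_subring[OF C(1) xc] adjoin_subset[OF L' C(2) x(1)] adjoin_incl
            adjoin_ideal[OF C(1) J(1) xc] no adjoin_incl])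
    then show False using adjoin_mem[OF C(1) xc] x by simp
  qed
  have "x = \<zero> \<or> x \<in> C \<or> inv x \<in> C" if x: "x \<in> L" for x
  proof (rule ccontr)
    assume n: "\<not> (x = \<zero> \<or> x \<in> C \<or> inv x \<in> C)"
    have xc: "x \<in> carrier K" using subring_carrier[OF L'] x by blast
    have "\<one> \<in> adjoin x J" "\<one> \<in> adjoin (inv x) J" using ad n x subfield_inv[OF L x] by auto
    then show False using horner_no_both[OF C(1) J loc xc] n by blast
  qed
  moreover have "J \<subseteq> nonunits K C"
  proof
    fix j assume j: "j \<in> J"
    then have jC: "j \<in> C" "j \<in> carrier K" using ideal_inD(1)[OF J(1)] subring_carrier[OF C(1)] by auto
    have "inv j \<notin> C" if "j \<noteq> \<zero>"
    proof
      assume "inv j \<in> C"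
      then have "inv j \<otimes> j \<in> J" using ideal_inD(4)[OF J(1)] j by blast
      then show False using that jC J(2) by simp
    qed
    then show "j \<in> nonunits K C" using jC unfolding nonunits_def by blast
  qed
  ultimately show ?thesis using C unfolding val_ring_def by blast
qed

text \<open>Chevalley's extension theorem, by Zorn's lemma for pairs of a subring and a proper ideal of it, ordered by
inclusion in both components.\<close>

lemma val_ring_exists:
  assumes L: "subfield L K" and B: "subring B K" "B \<subseteq> L" and I: "ideal_in K B I" "\<one> \<notin> I"
  shows "\<exists>V. val_ring K L V \<and> B \<subseteq> V \<and> I \<subseteq> nonunits K V"
proof -
  define A where "A = {(C, J). subring C K \<and> C \<subseteq> L \<and> B \<subseteq> C \<and> ideal_in K C J \<and> \<one> \<notin> J \<and> I \<subseteq> J}"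
  define P :: "'a set \<times> 'a set \<Rightarrow> 'a set \<times> 'a set \<Rightarrow> bool" where "P = (\<lambda>p q. fst p \<subseteq> fst q \<and> snd p \<subseteq> snd q)"
  have "\<exists>m\<in>A. \<forall>a\<in>A. P m a \<longrightarrow> a = m"
  proof (rule predicate_Zorn)
    show "partial_order_on A (relation_of P A)"
      by (rule partial_order_on_relation_ofI) (auto simp: P_def intro: prod_eqI)
    fix Ch assume Ch: "Ch \<in> Chains (relation_of P A)"
    have chA: "Ch \<subseteq> A" using Ch unfolding Chains_def relation_of_def by blast
    have chP: "P p q \<or> P q p" if "p \<in> Ch" "q \<in> Ch" for p q
      using Ch that unfolding Chains_def relation_of_def by blast
    show "\<exists>u\<in>A. \<forall>a\<in>Ch. P a u"
    proof (cases "Ch = {}")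
      case True
      have "(B, I) \<in> A" using B I unfolding A_def by blast
      then show ?thesis using True by blast
    next
      case False
      define C J where "C = (\<Union>p\<in>Ch. fst p)" and "J = (\<Union>p\<in>Ch. snd p)"
      have el: "subring (fst p) K \<and> fst p \<subseteq> L \<and> B \<subseteq> fst p \<and> ideal_in K (fst p) (snd p) \<and> \<one> \<notin> snd p \<and> I \<subseteq> snd p"
        if "p \<in> Ch" for p using subsetD[OF chA that] by (simp add: A_def case_prod_beta)
      have two: "\<exists>r\<in>Ch. fst p \<subseteq> fst r \<and> snd p \<subseteq> snd r \<and> fst q \<subseteq> fst r \<and> snd q \<subseteq> snd r"
        if "p \<in> Ch" "q \<in> Ch" for p q
        using chP[OF that] that unfolding P_def by blast
      have "subring C K"
      proof (rule subringI)
        have sr: "subring (fst p) K" if "p \<in> Ch" for p using el[OF that] by blast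
        show "C \<subseteq> carrier K" unfolding C_def using subringE(1)[OF sr] by (rule UN_least)
        obtain p where p: "p \<in> Ch" using False by blast
        show "\<one> \<in> C" unfolding C_def using p subringE(3)[OF sr[OF p]] by (rule UN_I)
        show "\<ominus> x \<in> C" if x: "x \<in> C" for x
        proof -
          obtain p where p: "p \<in> Ch" "x \<in> fst p" using x unfolding C_def by blast
          show ?thesis unfolding C_def using p(1) subringE(5)[OF sr[OF p(1)] p(2)] by (rule UN_I)
        qed
        fix x y assume "x \<in> C" "y \<in> C"
        then obtain p q where pq: "p \<in> Ch" "q \<in> Ch" "x \<in> fst p" "y \<in> fst q" unfolding C_def by blast
        then obtain r where r: "r \<in> Ch" "x \<in> fst r" "y \<in> fst r" using two[OF pq(1,2)] by blast
        have "x \<otimes> y \<in> fst r" "x \<oplus> y \<in> fst r"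
          using subringE(6)[OF sr[OF r(1)] r(2,3)] subringE(7)[OF sr[OF r(1)] r(2,3)] .
        then show "x \<otimes> y \<in> C" "x \<oplus> y \<in> C" using r(1) unfolding C_def by blast+
      qed
      moreover have "ideal_in K C J"
        unfolding ideal_in_def
      proof (intro conjI ballI)
        have id: "ideal_in K (fst p) (snd p)" if "p \<in> Ch" for p using el[OF that] by blast
        show "J \<subseteq> C" using ideal_inD(1)[OF id] unfolding C_def J_def by (rule UN_mono[OF subset_refl])
        obtain p where p: "p \<in> Ch" using False by blast
        show "\<zero> \<in> J" unfolding J_def using p ideal_inD(2)[OF id[OF p]] by (rule UN_I)
      next
        fix x y assume "x \<in> J" "y \<in> J"
        then obtain p q where pq: "p \<in> Ch" "q \<in> Ch" "x \<in> snd p" "y \<in> snd q" unfolding J_def by blast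
        then obtain r where r: "r \<in> Ch" "x \<in> snd r" "y \<in> snd r" using two[OF pq(1,2)] by blast
        have "ideal_in K (fst r) (snd r)" using el[OF r(1)] by blast
        then have "x \<oplus> y \<in> snd r" using r(2,3) by (rule ideal_inD(3))
        then show "x \<oplus> y \<in> J" using r(1) unfolding J_def by blast
      next
        fix x y assume "x \<in> C" "y \<in> J"
        then obtain p q where pq: "p \<in> Ch" "q \<in> Ch" "x \<in> fst p" "y \<in> snd q" unfolding C_def J_def by blast
        then obtain r where r: "r \<in> Ch" "x \<in> fst r" "y \<in> snd r" using two[OF pq(1,2)] by blast
        have "ideal_in K (fst r) (snd r)" using el[OF r(1)] by blast
        then have "x \<otimes> y \<in> snd r" using r(2,3) by (rule ideal_inD(4))
        then show "x \<otimes> y \<in> J" using r(1) unfolding J_def by blast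
      qed
      moreover have "\<one> \<notin> J" using el unfolding J_def by blast
      moreover have "C \<subseteq> L" unfolding C_def using el by (intro UN_least) blast
      moreover obtain p where p: "p \<in> Ch" using False by blast
      have "B \<subseteq> C" "I \<subseteq> J" using el[OF p] p unfolding C_def J_def by blast+
      ultimately have "(C, J) \<in> A" unfolding A_def by blast
      moreover have "\<forall>a\<in>Ch. P a (C, J)" unfolding P_def C_def J_def by auto
      ultimately show ?thesis by blast
    qed
  qed
  then obtain C J where CJ: "(C, J) \<in> A" and m: "\<And>a. a \<in> A \<Longrightarrow> P (C, J) a \<Longrightarrow> a = (C, J)" by auto
  have C: "subring C K" "C \<subseteq> L" "B \<subseteq> C" "ideal_in K C J" "\<one> \<notin> J" "I \<subseteq> J" using CJ unfolding A_def by auto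
  have "val_ring K L C \<and> J \<subseteq> nonunits K C"
  proof (rule dominating_maximal_is_val_ring[OF L C(1,2,4,5)])
    fix C' J' assume "subring C' K" "C' \<subseteq> L" "C \<subseteq> C'" "ideal_in K C' J'" "\<one> \<notin> J'" "J \<subseteq> J'"
    then have "(C', J') \<in> A" "P (C, J) (C', J')" using C unfolding A_def P_def by auto
    then show "C' = C" using m by blast
  qed
  then show ?thesis using C by blast
qed

lemma fracs_subset:
  assumes L: "subfield L K" and B: "B \<subseteq> L" and S: "S \<subseteq> L - {\<zero>}" shows "fracs K B S \<subseteq> L"
proof
  fix x assume "x \<in> fracs K B S"
  then obtain a b where "x = a \<otimes> inv b" "a \<in> B" "b \<in> S" unfolding fracs_def by blast
  then show "x \<in> L" using B S subringE(6)[OF subfieldE(1)[OF L]] subfield_inv[OF L] by blast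
qed

lemma val_ring_unitD:
  assumes V: "val_ring K L V" and x: "x \<in> V" "x \<notin> nonunits K V"
  shows "x \<noteq> \<zero>" "inv x \<in> V"
  using x unfolding nonunits_def by auto

lemma nonunits_not_unit:
  assumes V: "subring V K" and x: "x \<in> nonunits K V" and y: "y \<in> V" shows "x \<otimes> y \<noteq> \<one>"
proof
  assume 1: "x \<otimes> y = \<one>"
  have c: "x \<in> carrier K" "y \<in> carrier K" using x y subring_carrier[OF V] unfolding nonunits_def by auto
  have "x \<noteq> \<zero>" using 1 c by force
  moreover have "inv x = y" using inv_unique_nz[OF c 1] .
  ultimately show False using x y unfolding nonunits_def by auto
qed

text \<open>For the sum of two nonunits, one of the two quotients lies in \<open>V\<close>, and the sum is a multiple of one of them.\<close>

lemma nonunits_prime: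
  assumes L: "subfield L K" and V: "val_ring K L V" shows "prime_in K V (nonunits K V)"
proof -
  note V' = val_ringD[OF V]
  have sc: "x \<in> V \<Longrightarrow> x \<in> carrier K" for x using subring_carrier[OF V'(1)] .
  have smult: "b \<otimes> x \<in> nonunits K V" if b: "b \<in> V" and x: "x \<in> nonunits K V" for b x
  proof -
    have xV: "x \<in> V" using x unfolding nonunits_def by blast
    have bx: "b \<otimes> x \<in> V" using subringE(6)[OF V'(1) b xV] .
    have "inv (b \<otimes> x) \<notin> V" if nz: "b \<otimes> x \<noteq> \<zero>"
    proof
      assume i: "inv (b \<otimes> x) \<in> V"
      have "x \<otimes> (b \<otimes> inv (b \<otimes> x)) = (b \<otimes> x) \<otimes> inv (b \<otimes> x)"
        using sc[OF xV] sc[OF b] sc[OF i] by (simp add: m_ac)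
      also have "\<dots> = \<one>" using sc[OF bx] nz by simp
      finally show False using nonunits_not_unit[OF V'(1) x] subringE(6)[OF V'(1) b i] by blast
    qed
    then show ?thesis using bx unfolding nonunits_def by blast
  qed
  have add: "x \<oplus> y \<in> nonunits K V" if x: "x \<in> nonunits K V" and y: "y \<in> nonunits K V"
    and q: "x \<otimes> inv y \<in> V" and nz: "y \<noteq> \<zero>" for x y
  proof -
    have c: "x \<in> carrier K" "y \<in> carrier K" "inv y \<in> carrier K" using x y nz sc unfolding nonunits_def by auto
    have "(x \<otimes> inv y \<oplus> \<one>) \<otimes> y \<in> nonunits K V"
      using smult[OF _ y] q subringE(3,7)[OF V'(1)] by blast
    moreover have "(x \<otimes> inv y \<oplus> \<one>) \<otimes> y = x \<oplus> y" using c nz by (simp add: l_distr)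
    ultimately show ?thesis by simp
  qed
  have "ideal_in K V (nonunits K V)"
    unfolding ideal_in_def
  proof (intro conjI ballI)
    show "nonunits K V \<subseteq> V" unfolding nonunits_def by blast
    show "\<zero> \<in> nonunits K V" using subringE(2)[OF V'(1)] unfolding nonunits_def by blast
    fix x y assume x: "x \<in> nonunits K V" and y: "y \<in> nonunits K V"
    then have xy: "x \<in> V" "y \<in> V" "x \<in> carrier K" "y \<in> carrier K" using sc unfolding nonunits_def by auto
    consider "x = \<zero>" | "y = \<zero>" | "x \<noteq> \<zero>" "y \<noteq> \<zero>" by blast
    then show "x \<oplus> y \<in> nonunits K V"
    proof cases
      case 3
      have "x \<otimes> inv y \<in> L"
        using 3 xy V'(2) subfield_inv[OF L] subringE(6)[OF subfieldE(1)[OF L]] by blast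
      then have "x \<otimes> inv y \<in> V \<or> inv (x \<otimes> inv y) \<in> V" using V'(3) 3 xy by simp
      moreover have "inv (x \<otimes> inv y) = y \<otimes> inv x" using 3 xy by (simp add: inv_mult_nz m_comm)
      ultimately show ?thesis using add[OF x y] add[OF y x] 3 xy a_comm by auto
    qed (use x y xy in simp_all)
  qed (use smult in blast)
  moreover have "\<one> \<notin> nonunits K V" using nonunits_not_unit[OF V'(1), of \<one> \<one>] subringE(3)[OF V'(1)] by auto
  moreover have "a \<in> nonunits K V \<or> b \<in> nonunits K V"
    if ab: "a \<in> V" "b \<in> V" "a \<otimes> b \<in> nonunits K V" for a b
  proof (rule ccontr)
    assume n: "\<not> (a \<in> nonunits K V \<or> b \<in> nonunits K V)"
    then have u: "a \<noteq> \<zero>" "b \<noteq> \<zero>" "inv a \<in> V" "inv b \<in> V" using ab(1,2) unfolding nonunits_def by auto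
    then have "inv a \<otimes> inv b \<in> V" using subringE(6)[OF V'(1)] by blast
    moreover have "(a \<otimes> b) \<otimes> (inv a \<otimes> inv b) = \<one>" using u sc ab by (simp add: inv_mult_nz[symmetric])
    ultimately show False using nonunits_not_unit[OF V'(1) ab(3)] by blast
  qed
  ultimately show ?thesis unfolding prime_in_def by blast
qed

lemma not_in_val_ring:
  assumes L: "subfield L K" and V: "val_ring K L V" and x: "x \<in> L" "x \<notin> V"
  shows "x \<noteq> \<zero>" "inv x \<in> nonunits K V"
proof -
  note V' = val_ringD[OF V]
  show nz: "x \<noteq> \<zero>" using x subringE(2)[OF V'(1)] by blast
  have "x \<in> carrier K" using x(1) subringE(1)[OF subfieldE(1)[OF L]] by blast
  then show "inv x \<in> nonunits K V" using V'(3)[OF x(1) nz] x nz unfolding nonunits_def by simp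
qed

lemma val_ring_over:
  assumes L: "subfield L K" and V: "val_ring K L V" and W: "subring W K" "V \<subseteq> W" "W \<subseteq> L"
  shows "val_ring K L W" "nonunits K W \<subseteq> nonunits K V"
proof -
  note V' = val_ringD[OF V]
  show "val_ring K L W" using V' W unfolding val_ring_def by blast
  show "nonunits K W \<subseteq> nonunits K V"
  proof
    fix x assume x: "x \<in> nonunits K W"
    then have xW: "x \<in> W" "x = \<zero> \<or> inv x \<notin> W" unfolding nonunits_def by auto
    show "x \<in> nonunits K V"
    proof (cases "x = \<zero>")
      case True then show ?thesis using subringE(2)[OF V'(1)] unfolding nonunits_def by blast
    next
      case False
      then have "inv x \<notin> V" using xW W(2) by blast
      moreover have "x \<in> V" using V'(3)[of x] xW False W calculation by blast
      ultimately show ?thesis unfolding nonunits_def by blast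
    qed
  qed
qed

text \<open>An element of \<open>V\<close> outside \<open>W\<close> would have a nonunit of \<open>W\<close>, hence of \<open>V\<close>, as its inverse.\<close>

lemma val_ring_subset_if_nonunits:
  assumes L: "subfield L K" and V: "val_ring K L V" and W: "val_ring K L W"
    and sub: "nonunits K W \<subseteq> nonunits K V"
  shows "V \<subseteq> W"
proof
  fix x assume x: "x \<in> V"
  show "x \<in> W"
  proof (rule ccontr)
    assume n: "x \<notin> W"
    have xL: "x \<in> L" using x val_ringD(2)[OF V] by blast
    have "x \<noteq> \<zero>" "inv x \<in> nonunits K V" using not_in_val_ring[OF L W xL n] sub by auto
    moreover have "x \<in> carrier K" using subring_carrier[OF val_ringD(1)[OF V] x] .
    ultimately show False using nonunits_not_unit[OF val_ringD(1)[OF V], of "inv x" x] x by simp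
  qed
qed

lemma val_ring_overs_comparable:
  assumes L: "subfield L K" and V: "val_ring K L V"
    and A: "subring A K" "V \<subseteq> A" "A \<subseteq> L" and B: "subring B K" "V \<subseteq> B" "B \<subseteq> L"
  shows "A \<subseteq> B \<or> B \<subseteq> A"
proof (rule ccontr)
  assume "\<not> (A \<subseteq> B \<or> B \<subseteq> A)"
  then obtain x y where x: "x \<in> A" "x \<notin> B" and y: "y \<in> B" "y \<notin> A" by blast
  have nz: "x \<noteq> \<zero>" "y \<noteq> \<zero>" using x y subringE(2)[OF A(1)] subringE(2)[OF B(1)] by auto
  have c: "x \<in> carrier K" "y \<in> carrier K" using x y subring_carrier A B by blast+
  have "x \<otimes> inv y \<in> L"
    using x y nz A B subfield_inv[OF L] subringE(6)[OF subfieldE(1)[OF L]] by blast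
  then have "x \<otimes> inv y \<in> V \<or> inv (x \<otimes> inv y) \<in> V" using val_ringD(3)[OF V] nz c by simp
  moreover have "inv (x \<otimes> inv y) = y \<otimes> inv x" using nz c by (simp add: inv_mult_nz m_comm)
  ultimately have "x \<otimes> inv y \<otimes> y \<in> B \<or> y \<otimes> inv x \<otimes> x \<in> A"
    using A B x y subringE(6)[OF A(1)] subringE(6)[OF B(1)] by auto
  then show False using c nz x y by simp
qed

end

section \<open>Chains of overrings and Krull dimension\<close>

lemma enat_le_SUP_iff:
  fixes f :: "'i \<Rightarrow> enat"
  assumes "S \<noteq> {}"
  shows "enat n \<le> (SUP i\<in>S. f i) \<longleftrightarrow> (\<exists>i\<in>S. enat n \<le> f i)"
proof
  assume n: "enat n \<le> (SUP i\<in>S. f i)"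
  show "\<exists>i\<in>S. enat n \<le> f i"
  proof (rule ccontr)
    assume c: "\<not> (\<exists>i\<in>S. enat n \<le> f i)"
    obtain i where "i \<in> S" using assms by blast
    then have "n \<noteq> 0" using c zero_enat_def by (metis zero_le)
    then obtain m where m: "n = Suc m" using not0_implies_Suc by blast
    have "f i \<le> enat m" if "i \<in> S" for i
    proof -
      have "f i < enat (Suc m)" using c that m not_le by blast
      then show ?thesis by (cases "f i") auto
    qed
    then have "(SUP i\<in>S. f i) \<le> enat m" by (rule SUP_least)
    then have "enat n \<le> enat m" using n order_trans by blast
    then show False using m by simp
  qed
next
  assume "\<exists>i\<in>S. enat n \<le> f i"
  then show "enat n \<le> (SUP i\<in>S. f i)" using SUP_upper2 by metis
qed

lemma enat_leI: "(\<And>n. enat n \<le> x \<Longrightarrow> enat n \<le> y) \<Longrightarrow> x \<le> (y :: enat)"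
proof (cases y)
  case (enat m)
  assume a: "\<And>n. enat n \<le> x \<Longrightarrow> enat n \<le> y"
  show ?thesis
  proof (rule ccontr)
    assume "\<not> x \<le> y"
    then have "enat (Suc m) \<le> x" using enat by (simp add: Suc_ile_eq not_le)
    then show False using a[of "Suc m"] enat by simp
  qed
qed simp

text \<open>Inequalities between dimensions are proved by testing them on finite values; this splits such a test value
over a sum, also when a summand is infinite.\<close>

lemma enat_le_plusE:
  assumes "enat n \<le> x + y"
  obtains a b where "n = a + b" "enat a \<le> x" "enat b \<le> y"
proof (cases x)
  case infinity
  then show thesis using that[of n 0] by (simp add: zero_enat_def[symmetric])
next
  case (enat a)
  show thesis
  proof (cases "n \<le> a")
    case True
    then show thesis using that[of n 0] enat by (simp add: zero_enat_def[symmetric])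
  next
    case False
    have "enat (n - a) \<le> y" using assms enat by (cases y) auto
    then show thesis using that[of a "n - a"] enat False by simp
  qed
qed

text \<open>The primes of a valuation ring correspond, in reverse order, to its overrings.  Chains of subrings between
\<open>V\<close> and its quotient field \<open>W\<close> therefore measure the dimension of \<open>V\<close>; for a larger valuation ring \<open>W\<close>
they measure the dimension of the image of \<open>V\<close> in the residue field of \<open>W\<close>.  The endpoints need not occur in the
chain, so the predicate is monotone in all its arguments.\<close>

definition ring_chain :: "('a, 'b) ring_scheme \<Rightarrow> 'a set \<Rightarrow> 'a set \<Rightarrow> nat \<Rightarrow> bool" where
  "ring_chain K W V n \<longleftrightarrow> (\<exists>Xs :: nat \<Rightarrow> 'a set. (\<forall>i\<le>n. subring (Xs i) K \<and> V \<subseteq> Xs i \<and> Xs i \<subseteq> W) \<and>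
     (\<forall>i<n. Xs (Suc i) \<subset> Xs i))"

lemma ring_chainI:
  assumes "\<And>i. i \<le> n \<Longrightarrow> subring (Xs i) K" "\<And>i. i \<le> n \<Longrightarrow> V \<subseteq> Xs i" "\<And>i. i \<le> n \<Longrightarrow> Xs i \<subseteq> W"
    "\<And>i. i < n \<Longrightarrow> Xs (Suc i) \<subset> Xs i"
  shows "ring_chain K W V n"
  unfolding ring_chain_def using assms by blast

lemma ring_chainE:
  assumes "ring_chain K W V n"
  obtains Xs where "\<And>i. i \<le> n \<Longrightarrow> subring (Xs i) K" "\<And>i. i \<le> n \<Longrightarrow> V \<subseteq> Xs i" "\<And>i. i \<le> n \<Longrightarrow> Xs i \<subseteq> W"
    "\<And>i. i < n \<Longrightarrow> Xs (Suc i) \<subset> Xs i"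
  using assms unfolding ring_chain_def by blast

lemma ring_chain_mono:
  assumes "ring_chain K W V n" "W \<subseteq> W'" "V' \<subseteq> V" "n' \<le> n"
  shows "ring_chain K W' V' n'"
proof -
  obtain Xs where Xs: "\<And>i. i \<le> n \<Longrightarrow> subring (Xs i) K" "\<And>i. i \<le> n \<Longrightarrow> V \<subseteq> Xs i" "\<And>i. i \<le> n \<Longrightarrow> Xs i \<subseteq> W"
    "\<And>i. i < n \<Longrightarrow> Xs (Suc i) \<subset> Xs i" by (rule ring_chainE[OF assms(1)]) blast
  show ?thesis
  proof (rule ring_chainI)
    fix i assume "i \<le> n'"
    then have i: "i \<le> n" using assms(4) by simp
    show "subring (Xs i) K" "V' \<subseteq> Xs i" "Xs i \<subseteq> W'" using Xs(1-3)[OF i] assms(2,3) by auto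
  next
    fix i assume "i < n'"
    then show "Xs (Suc i) \<subset> Xs i" using Xs(4)[of i] assms(4) by simp
  qed
qed

lemma ring_chain_0: "subring W K \<Longrightarrow> V \<subseteq> W \<Longrightarrow> ring_chain K W V 0"
  by (rule ring_chainI[of _ "\<lambda>_. W"]) auto

lemma ring_chain_append:
  assumes "ring_chain K W V n" "ring_chain K V V' m"
  shows "ring_chain K W V' (n + m)"
proof -
  obtain Xs where Xs: "\<And>i. i \<le> n \<Longrightarrow> subring (Xs i) K" "\<And>i. i \<le> n \<Longrightarrow> V \<subseteq> Xs i" "\<And>i. i \<le> n \<Longrightarrow> Xs i \<subseteq> W"
    "\<And>i. i < n \<Longrightarrow> Xs (Suc i) \<subset> Xs i" by (rule ring_chainE[OF assms(1)]) blast
  obtain Y where Y: "\<And>i. i \<le> m \<Longrightarrow> subring (Y i) K" "\<And>i. i \<le> m \<Longrightarrow> V' \<subseteq> Y i" "\<And>i. i \<le> m \<Longrightarrow> Y i \<subseteq> V"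
    "\<And>i. i < m \<Longrightarrow> Y (Suc i) \<subset> Y i" by (rule ring_chainE[OF assms(2)]) blast
  have VW: "V \<subseteq> W" "V' \<subseteq> V" using Xs(2,3)[of n] Y(2,3)[of 0] by auto
  show ?thesis
  proof (rule ring_chainI[of _ "\<lambda>i. if i \<le> n then Xs i else Y (i - n)"])
    fix i assume i: "i \<le> n + m"
    consider "i \<le> n" | "\<not> i \<le> n" "i - n \<le> m" using i by linarith
    note cs = this
    show "subring (if i \<le> n then Xs i else Y (i - n)) K" using cs Xs(1) Y(1) by cases auto
    show "V' \<subseteq> (if i \<le> n then Xs i else Y (i - n))" using cs
    proof cases
      case 1 then show ?thesis using Xs(2)[of i] VW by auto
    next
      case 2 then show ?thesis using Y(2)[of "i - n"] by auto
    qed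
    show "(if i \<le> n then Xs i else Y (i - n)) \<subseteq> W" using cs
    proof cases
      case 1 then show ?thesis using Xs(3)[of i] by auto
    next
      case 2 then show ?thesis using Y(3)[of "i - n"] VW by auto
    qed
  next
    fix i assume i: "i < n + m"
    consider "i < n" | "i = n" "0 < m" | "n < i" "i - n < m" using i by linarith
    then show "(if Suc i \<le> n then Xs (Suc i) else Y (Suc i - n)) \<subset> (if i \<le> n then Xs i else Y (i - n))"
    proof cases
      case 1 then show ?thesis using Xs(4)[of i] by simp
    next
      case 2
      have "Y 1 \<subset> V" using Y(4)[of 0] Y(3)[of 0] 2 by auto
      then have "Y 1 \<subset> Xs n" using Xs(2)[of n] by auto
      then show ?thesis using 2 by simp
    next
      case 3 then show ?thesis using Y(4)[of "i - n"] by (simp add: Suc_diff_le)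
    qed
  qed
qed

context ambient_field
begin

text \<open>All overrings of \<open>V\<close> are comparable with \<open>W\<close>.  Inserting \<open>W\<close> into the chain can only lengthen it, hence the
inequality.\<close>

lemma ring_chain_split:
  assumes L: "subfield L K" and V: "val_ring K L V" and W: "subring W K" "V \<subseteq> W" "W \<subseteq> L"
    and ch: "ring_chain K L V n"
  obtains a b where "n \<le> a + b" "ring_chain K L W a" "ring_chain K W V b"
proof -
  obtain Xs where Xs: "\<And>i. i \<le> n \<Longrightarrow> subring (Xs i) K" "\<And>i. i \<le> n \<Longrightarrow> V \<subseteq> Xs i" "\<And>i. i \<le> n \<Longrightarrow> Xs i \<subseteq> L"
    "\<And>i. i < n \<Longrightarrow> Xs (Suc i) \<subset> Xs i" by (rule ring_chainE[OF ch]) blast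
  have anti: "Xs j \<subseteq> Xs i" if "i \<le> j" "j \<le> n" for i j
    using that
  proof (induction j)
    case (Suc j)
    then show ?case using Xs(4)[of j] by (cases "i = Suc j") auto
  qed simp
  have comp: "W \<subseteq> Xs i \<or> Xs i \<subset> W" if "i \<le> n" for i
    using val_ring_overs_comparable[OF L V W Xs(1-3)[OF that]] by blast
  \<comment> \<open>the index of the first member strictly below \<open>W\<close>, or \<open>n + 1\<close> if there is none\<close>
  define j where "j = (LEAST i. n < i \<or> Xs i \<subset> W)"
  have j: "n < j \<or> Xs j \<subset> W" unfolding j_def by (rule LeastI[of _ "Suc n"]) simp
  have "j \<le> Suc n" unfolding j_def by (rule Least_le) simp
  have below: "W \<subseteq> Xs i" if "i < j" for i
    using not_less_Least[of i "\<lambda>i. n < i \<or> Xs i \<subset> W"] that comp[of i] unfolding j_def by auto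
  have b: "ring_chain K W V (Suc n - j)"
  proof (rule ring_chainI[of _ "\<lambda>i. if i = 0 then W else Xs (j + (i - 1))"])
    have sub: "Xs (j + i) \<subset> W" if "j + i \<le> n" for i
      using anti[of j "j + i"] that j by auto
    fix i assume i: "i \<le> Suc n - j"
    have le: "j + (i - 1) \<le> n" if "i \<noteq> 0" using that i by linarith
    show "subring (if i = 0 then W else Xs (j + (i - 1))) K" using le Xs(1) W(1) by simp
    show "V \<subseteq> (if i = 0 then W else Xs (j + (i - 1)))" 
      using Xs(2)[OF le] W(2) by (cases "i = 0") simp_all
    show "(if i = 0 then W else Xs (j + (i - 1))) \<subseteq> W" 
    proof (cases "i = 0")
      case False then show ?thesis using sub[OF le[OF False]] by simp
    qed simp
  next
    have sub: "Xs j \<subset> W" if "j \<le> n" using that j by auto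
    fix i assume i: "i < Suc n - j"
    show "(if Suc i = 0 then W else Xs (j + (Suc i - 1))) \<subset> (if i = 0 then W else Xs (j + (i - 1)))"
    proof (cases i)
      case 0 then show ?thesis using sub i by auto
    next
      case (Suc k) then show ?thesis using Xs(4)[of "j + k"] i by auto
    qed
  qed
  show thesis
  proof (cases "j = 0")
    case True
    show thesis using that[OF _ ring_chain_0[OF W(1) subset_refl, THEN ring_chain_mono, of L W 0] b] W True by auto
  next
    case False
    have "ring_chain K L W (j - 1)"
    proof (rule ring_chainI[of _ Xs])
      fix i assume "i \<le> j - 1"
      then have i: "i < j" "i \<le> n" using False \<open>j \<le> Suc n\<close> by auto
      show "subring (Xs i) K" "W \<subseteq> Xs i" "Xs i \<subseteq> L" using Xs(1,3) i below by auto
    next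
      fix i assume "i < j - 1"
      then show "Xs (Suc i) \<subset> Xs i" using Xs(4)[of i] \<open>j \<le> Suc n\<close> by auto
    qed
    moreover have "n \<le> (j - 1) + (Suc n - j)" using False \<open>j \<le> Suc n\<close> by linarith
    ultimately show thesis using b that by blast
  qed
qed

text \<open>A prime goes to the localization at it, an overring to its maximal ideal.\<close>

lemma prime_chain_iff_ring_chain:
  assumes L: "subfield L K" and V: "val_ring K L V"
  shows "(\<exists>P :: nat \<Rightarrow> 'a set. (\<forall>i\<le>n. primeideal (P i) (K\<lparr>carrier := V\<rparr>)) \<and> (\<forall>i<n. P i \<subset> P (Suc i)))
    \<longleftrightarrow> ring_chain K L V n"
  unfolding prime_in_iff[OF val_ringD(1)[OF V]]
proof
  note V' = val_ringD[OF V]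
  assume "\<exists>P :: nat \<Rightarrow> 'a set. (\<forall>i\<le>n. prime_in K V (P i)) \<and> (\<forall>i<n. P i \<subset> P (Suc i))"
  then obtain P where P: "\<And>i. i \<le> n \<Longrightarrow> prime_in K V (P i)" "\<And>i. i < n \<Longrightarrow> P i \<subset> P (Suc i)" by blast
  show "ring_chain K L V n"
  proof (rule ring_chainI[of _ "\<lambda>i. fracs K V (V - P i)"])
    fix i assume i: "i \<le> n"
    note ms = mult_set_prime[OF V'(1) P(1)[OF i]]
    show "subring (fracs K V (V - P i)) K" by (rule fracs_subring[OF V'(1) ms])
    show "V \<subseteq> fracs K V (V - P i)"
      by (rule fracs_incl[OF subringE(1)[OF V'(1)]]) (use ms in \<open>simp add: mult_set_def\<close>)
    show "fracs K V (V - P i) \<subseteq> L"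
      by (rule fracs_subset[OF L V'(2)]) (use ms V'(2) in \<open>auto simp: mult_set_def\<close>)
  next
    fix i assume i: "i < n"
    then have Pi: "prime_in K V (P i)" "prime_in K V (P (Suc i))" using P(1) by auto
    obtain x where x: "x \<in> P (Suc i)" "x \<notin> P i" using P(2)[OF i] by blast
    then have xV: "x \<in> V" using prime_inD(4)[OF Pi(2)] by blast
    have xc: "x \<in> carrier K" using subring_carrier[OF V'(1) xV] .
    have xnz: "x \<noteq> \<zero>" using x prime_inD(5)[OF Pi(1)] by blast
    have "inv x \<in> fracs K V (V - P i)"
      using fracs_inv[OF V'(1) mult_set_prime[OF V'(1) Pi(1)]] x xV by blast
    moreover have "inv x \<notin> fracs K V (V - P (Suc i))"
    proof
      assume "inv x \<in> fracs K V (V - P (Suc i))"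
      then obtain a s where as: "inv x = a \<otimes> inv s" "a \<in> V" "s \<in> V" "s \<notin> P (Suc i)" unfolding fracs_def by blast
      have c: "a \<in> carrier K" "s \<in> carrier K" "s \<noteq> \<zero>"
        using as subring_carrier[OF V'(1)] prime_inD(5)[OF Pi(2)] by auto
      have "s = (inv x \<otimes> x) \<otimes> s" using xc xnz c by simp
      also have "\<dots> = (a \<otimes> inv s) \<otimes> x \<otimes> s" unfolding as(1) ..
      also have "\<dots> = a \<otimes> (inv s \<otimes> s) \<otimes> x" using c xc inv_closed_nz[OF c(2,3)] by (simp only: m_ac m_closed)
      also have "\<dots> = a \<otimes> x" using c by simp
      finally have "s \<in> P (Suc i)" using ideal_inD(4)[OF prime_inD(1)[OF Pi(2)]] as(2) x(1) by simp
      then show False using as(4) by blast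
    qed
    moreover have "fracs K V (V - P (Suc i)) \<subseteq> fracs K V (V - P i)"
      by (rule fracs_mono) (use P(2)[OF i] in auto)
    ultimately show "fracs K V (V - P (Suc i)) \<subset> fracs K V (V - P i)" by blast
  qed
next
  note V' = val_ringD[OF V]
  assume ch: "ring_chain K L V n"
  obtain Xs where Xs: "\<And>i. i \<le> n \<Longrightarrow> subring (Xs i) K" "\<And>i. i \<le> n \<Longrightarrow> V \<subseteq> Xs i" "\<And>i. i \<le> n \<Longrightarrow> Xs i \<subseteq> L"
    "\<And>i. i < n \<Longrightarrow> Xs (Suc i) \<subset> Xs i" by (rule ring_chainE[OF ch]) blast
  have vr: "val_ring K L (Xs i)" "nonunits K (Xs i) \<subseteq> nonunits K V" if "i \<le> n" for i
    using val_ring_over[OF L V Xs(1-3)[OF that]] .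
  have "prime_in K V (nonunits K (Xs i))" if i: "i \<le> n" for i
  proof -
    have "prime_in K V (nonunits K (Xs i) \<inter> V)"
      by (rule prime_in_contract[OF V'(1) Xs(1)[OF i] Xs(2)[OF i] nonunits_prime[OF L vr(1)[OF i]]])
    moreover have "nonunits K (Xs i) \<subseteq> V" using vr(2)[OF i] unfolding nonunits_def by blast
    ultimately show ?thesis by (simp add: Int_absorb2)
  qed
  moreover have "nonunits K (Xs i) \<subset> nonunits K (Xs (Suc i))" if i: "i < n" for i
  proof -
    have le: "i \<le> n" "Suc i \<le> n" using i by auto
    have "nonunits K (Xs i) \<subseteq> nonunits K (Xs (Suc i))"
      using val_ring_over(2)[OF L vr(1)[OF le(2)] Xs(1)[OF le(1)] _ Xs(3)[OF le(1)]] Xs(4)[OF i] by blast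
    moreover have "\<not> nonunits K (Xs (Suc i)) \<subseteq> nonunits K (Xs i)"
      using val_ring_subset_if_nonunits[OF L vr(1)[OF le(1)] vr(1)[OF le(2)]] Xs(4)[OF i] by blast
    ultimately show ?thesis by blast
  qed
  ultimately show "\<exists>P :: nat \<Rightarrow> 'a set. (\<forall>i\<le>n. prime_in K V (P i)) \<and> (\<forall>i<n. P i \<subset> P (Suc i))"
    by (intro exI[of _ "\<lambda>i. nonunits K (Xs i)"]) simp
qed

lemma enat_le_krull_dim_val_ring:
  assumes L: "subfield L K" and V: "val_ring K L V"
  shows "enat n \<le> krull_dim (K\<lparr>carrier := V\<rparr>) \<longleftrightarrow> ring_chain K L V n"
proof -
  have "krull_dim (K\<lparr>carrier := V\<rparr>) = (SUP n\<in>{n. ring_chain K L V n}. enat n)"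
    unfolding krull_dim_def prime_chain_iff_ring_chain[OF assms] ..
  moreover have ne: "{n. ring_chain K L V n} \<noteq> {}"
    using ring_chain_0[OF subfieldE(1)[OF L] val_ringD(2)[OF V]] by blast
  ultimately have "enat n \<le> krull_dim (K\<lparr>carrier := V\<rparr>) \<longleftrightarrow> (\<exists>i. ring_chain K L V i \<and> n \<le> i)"
    using enat_le_SUP_iff[OF ne, of n enat] by simp
  moreover have "ring_chain K L V n" if "ring_chain K L V i" "n \<le> i" for i
    using ring_chain_mono[OF that(1) subset_refl subset_refl that(2)] .
  ultimately show ?thesis by (metis order_refl)
qed

text \<open>With \<open>I = B\<close> this describes the ring \<open>B + M\<close>, with a smaller \<open>I\<close> an ideal of it.\<close>

lemma subring_plus_ideal:
  assumes V: "subring V K" and B: "subring B K" "B \<subseteq> V" and M: "ideal_in K V M" and I: "ideal_in K B I"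
  shows "ideal_in K {b \<oplus> x | b x. b \<in> B \<and> x \<in> M} {b \<oplus> x | b x. b \<in> I \<and> x \<in> M}"
  unfolding ideal_in_def
proof (intro conjI ballI)
  have sc: "x \<in> V \<Longrightarrow> x \<in> carrier K" for x using subring_carrier[OF V] .
  have IB: "x \<in> I \<Longrightarrow> x \<in> V" for x using ideal_inD(1)[OF I] B(2) by blast
  have MV: "x \<in> M \<Longrightarrow> x \<in> V" for x using ideal_inD(1)[OF M] by blast
  show "{b \<oplus> x | b x. b \<in> I \<and> x \<in> M} \<subseteq> {b \<oplus> x | b x. b \<in> B \<and> x \<in> M}" using ideal_inD(1)[OF I] by blast
  have "\<zero> = \<zero> \<oplus> \<zero>" by simp
  then show "\<zero> \<in> {b \<oplus> x | b x. b \<in> I \<and> x \<in> M}" using ideal_inD(2)[OF I] ideal_inD(2)[OF M] by blast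
  {
    fix u v assume "u \<in> {b \<oplus> x | b x. b \<in> I \<and> x \<in> M}" "v \<in> {b \<oplus> x | b x. b \<in> I \<and> x \<in> M}"
    then obtain a x b y where *: "u = a \<oplus> x" "v = b \<oplus> y" "a \<in> I" "b \<in> I" "x \<in> M" "y \<in> M" by blast
    have "u \<oplus> v = (a \<oplus> b) \<oplus> (x \<oplus> y)" using * IB MV sc by (simp add: a_ac)
    then show "u \<oplus> v \<in> {b \<oplus> x | b x. b \<in> I \<and> x \<in> M}"
      using ideal_inD(3)[OF I *(3) *(4)] ideal_inD(3)[OF M *(5) *(6)] by blast
  next
    fix u v assume "u \<in> {b \<oplus> x | b x. b \<in> B \<and> x \<in> M}" "v \<in> {b \<oplus> x | b x. b \<in> I \<and> x \<in> M}"
    then obtain a x b y where *: "u = a \<oplus> x" "v = b \<oplus> y" "a \<in> B" "b \<in> I" "x \<in> M" "y \<in> M" by blast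
    have m: "a \<in> V" "b \<in> V" "x \<in> V" "y \<in> V" using * IB MV B(2) by auto
    have "u \<otimes> v = a \<otimes> b \<oplus> (a \<otimes> y \<oplus> (b \<otimes> x \<oplus> x \<otimes> y))"
      using *(1,2) m[THEN sc] by (simp add: l_distr r_distr a_ac m_ac)
    moreover have "a \<otimes> y \<oplus> (b \<otimes> x \<oplus> x \<otimes> y) \<in> M"
      using ideal_inD(3)[OF M ideal_inD(4)[OF M m(1) *(6)]
          ideal_inD(3)[OF M ideal_inD(4)[OF M m(2) *(5)] ideal_inD(4)[OF M m(3) *(6)]]] .
    ultimately show "u \<otimes> v \<in> {b \<oplus> x | b x. b \<in> I \<and> x \<in> M}" using ideal_inD(4)[OF I *(3) *(4)] by blast
  }
qed

lemma subring_of_ideal_self: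
  assumes "C \<subseteq> carrier K" "\<one> \<in> C" "\<ominus> \<one> \<in> C" "ideal_in K C C"
  shows "subring C K"
proof (rule subringI)
  note i = ideal_inD[OF assms(4)]
  fix x y assume xy: "x \<in> C" "y \<in> C"
  show "x \<otimes> y \<in> C" "x \<oplus> y \<in> C" using i(3,4) xy by auto
  have "(\<ominus> \<one>) \<otimes> x \<in> C" using i(4) assms(3) xy by blast
  then show "\<ominus> x \<in> C" using xy assms(1) by (auto simp: l_minus)
qed (use assms in auto)

text \<open>A valuation ring of the residue field of \<open>V\<close> with a prescribed behaviour on the image of \<open>B\<close>, composed with
\<open>V\<close>.  The residue field is avoided: the extension theorem is applied to the localization at \<open>S\<close> of the subring
\<open>B + M\<close> of \<open>V\<close>, where \<open>M\<close> is the maximal ideal of \<open>V\<close>.  Since \<open>M\<close> consists of nonunits of the new ring,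
that ring lies inside \<open>V\<close>.\<close>

lemma val_ring_refine:
  assumes L: "subfield L K" and V: "val_ring K L V" and B: "subring B K" "B \<subseteq> V"
    and I: "ideal_in K B I" "nonunits K V \<inter> B \<subseteq> I" and S: "mult_set B S" "I \<inter> S = {}"
  obtains V' where "val_ring K L V'" "V' \<subseteq> V" "B \<subseteq> V'" "I \<subseteq> nonunits K V'" "nonunits K V \<subseteq> nonunits K V'"
    "S \<inter> nonunits K V' = {}"
proof -
  note V' = val_ringD[OF V]
  define M where "M = nonunits K V"
  have M: "ideal_in K V M" unfolding M_def using prime_inD(1)[OF nonunits_prime[OF L V]] .
  \<comment> \<open>the preimages in \<open>V\<close> of the images of \<open>B\<close> and \<open>I\<close> in the residue field\<close>
  define C J where "C = {b \<oplus> x | b x. b \<in> B \<and> x \<in> M}" and "J = {b \<oplus> x | b x. b \<in> I \<and> x \<in> M}"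
  have sc: "x \<in> V \<Longrightarrow> x \<in> carrier K" for x using subring_carrier[OF V'(1)] .
  have MV: "x \<in> M \<Longrightarrow> x \<in> V" for x using ideal_inD(1)[OF M] by blast
  have IB: "x \<in> I \<Longrightarrow> x \<in> B" for x using ideal_inD(1)[OF I(1)] by blast
  have CV: "C \<subseteq> V" unfolding C_def using subringE(7)[OF V'(1)] MV B(2) by blast
  have inc: "b \<oplus> \<zero> = b" if "b \<in> B" for b using that B sc by auto
  have BC: "B \<subseteq> C" unfolding C_def using inc ideal_inD(2)[OF M] by force
  have IJ: "I \<subseteq> J" unfolding J_def using inc IB ideal_inD(2)[OF M] by force
  have MJ: "M \<subseteq> J"
  proof
    fix x assume x: "x \<in> M"
    then have "x = \<zero> \<oplus> x" using MV sc by simp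
    then show "x \<in> J" unfolding J_def using x ideal_inD(2)[OF I(1)] by blast
  qed
  have idJ: "ideal_in K C J" unfolding C_def J_def by (rule subring_plus_ideal[OF V'(1) B M I(1)])
  have idC: "ideal_in K C C" unfolding C_def by (rule subring_plus_ideal[OF V'(1) B M ideal_in_self[OF B(1)]])
  have C: "subring C K"
    using subring_of_ideal_self[OF _ _ _ idC] CV sc BC subringE(3,5)[OF B(1)] by blast
  have SB: "S \<subseteq> B" using S(1) unfolding mult_set_def by blast
  have SC: "mult_set C S" using S(1) BC unfolding mult_set_def by blast
  have "J \<inter> S = {}"
  proof (rule ccontr)
    assume "J \<inter> S \<noteq> {}"
    then obtain b x where *: "b \<oplus> x \<in> S" "b \<in> I" "x \<in> M" unfolding J_def by blast
    have c: "b \<in> carrier K" "x \<in> carrier K" using * IB MV B sc by auto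
    have bB: "b \<in> B" "b \<oplus> x \<in> B" using * IB SB by auto
    have "(b \<oplus> x) \<ominus> b \<in> B" using subring_minus[OF B(1)] bB by blast
    moreover have "(b \<oplus> x) \<ominus> b = x" using c by algebra
    ultimately have "x \<in> I" using *(3) I(2) unfolding M_def by auto
    then have "b \<oplus> x \<in> I" using ideal_inD(3)[OF I(1)] * by blast
    then show False using * S(2) by blast
  qed
  then have no: "\<one> \<notin> fracs K J S" using fracs_proper[OF C SC idJ] by blast
  have SL: "S \<subseteq> L - {\<zero>}" using S(1) B(2) V'(2) unfolding mult_set_def by blast
  have one: "\<one> \<in> S" using S(1) unfolding mult_set_def by blast
  obtain V1 where V1: "val_ring K L V1" "fracs K C S \<subseteq> V1" "fracs K J S \<subseteq> nonunits K V1"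
    using val_ring_exists[OF L fracs_subring[OF C SC] _ fracs_ideal[OF C SC idJ] no] fracs_subset[OF L _ SL, of C]
      CV V'(2) by blast
  have CV1: "C \<subseteq> V1" using fracs_incl[OF _ one, of C] V1(2) CV sc by blast
  have JV1: "J \<subseteq> nonunits K V1"
    using fracs_incl[OF _ one, of J] V1(3) CV sc ideal_inD(1)[OF idJ] by blast
  show thesis
  proof (rule that[OF V1(1)])
    show MM: "nonunits K V \<subseteq> nonunits K V1" using MJ JV1 unfolding M_def by blast
    show "V1 \<subseteq> V" by (rule val_ring_subset_if_nonunits[OF L V1(1) V MM])
    show "B \<subseteq> V1" using BC CV1 by blast
    show "I \<subseteq> nonunits K V1" using IJ JV1 by blast
    show "S \<inter> nonunits K V1 = {}"
      using fracs_inv[OF C SC] V1(2) SL unfolding nonunits_def by blast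
  qed
qed

text \<open>The complement of \<open>P\<close> serves as the multiplicative set, so the new centre on \<open>B\<close> is \<open>P\<close> itself.\<close>

lemma val_ring_refine_prime:
  assumes L: "subfield L K" and V: "val_ring K L V" and B: "subring B K" "B \<subseteq> V"
    and P: "prime_in K B P" "nonunits K V \<inter> B \<subseteq> P"
  obtains V' where "val_ring K L V'" "V' \<subseteq> V" "B \<subseteq> V'" "nonunits K V' \<inter> B = P" "nonunits K V \<subseteq> nonunits K V'"
proof -
  obtain V' where V': "val_ring K L V'" "V' \<subseteq> V" "B \<subseteq> V'" "P \<subseteq> nonunits K V'" "nonunits K V \<subseteq> nonunits K V'"
    "(B - P) \<inter> nonunits K V' = {}"
    by (rule val_ring_refine[OF L V B prime_inD(1)[OF P(1)] P(2) mult_set_prime[OF B(1) P(1)]]) auto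
  have "nonunits K V' \<inter> B = P" using V'(4,6) prime_inD(4)[OF P(1)] by blast
  then show thesis by (rule that[OF V'(1) V'(2) V'(3) _ V'(5)])
qed

lemma val_ring_field: "subfield L K \<Longrightarrow> val_ring K L L"
  unfolding val_ring_def using subfieldE(1) by blast

lemma nonunits_field:
  assumes "subfield L K" shows "nonunits K L = {\<zero>}"
  using subfield_inv[OF assms] subringE(2)[OF subfieldE(1)[OF assms]] unfolding nonunits_def by blast

end

section \<open>Residual algebraic independence\<close>

definition supp :: "('a \<Rightarrow> nat) \<Rightarrow> 'a set" where "supp e = {x. e x \<noteq> 0}"

definition exps :: "'a set \<Rightarrow> ('a \<Rightarrow> nat) set" where
  "exps S = {e. finite (supp e) \<and> supp e \<subseteq> S}"

definition pprod :: "('a, 'b) ring_scheme \<Rightarrow> ('a \<Rightarrow> nat) \<Rightarrow> 'a" where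
  "pprod K e = (\<Otimes>\<^bsub>K\<^esub>x\<in>supp e. x [^]\<^bsub>K\<^esub> e x)"

text \<open>The residues of the elements of \<open>S\<close> in the residue field of \<open>W\<close> are algebraically independent over the
residues of \<open>A\<close>.  Stated without the residue field; when \<open>W\<close> is the whole field, its only nonunit is zero and
this is algebraic independence.\<close>

definition res_indep :: "('a, 'b) ring_scheme \<Rightarrow> 'a set \<Rightarrow> 'a set \<Rightarrow> 'a set \<Rightarrow> bool" where
  "res_indep K W A S \<longleftrightarrow> (\<forall>E c. finite E \<and> E \<subseteq> exps S \<and> c \<in> E \<rightarrow> A \<and>
     (\<Oplus>\<^bsub>K\<^esub>e\<in>E. c e \<otimes>\<^bsub>K\<^esub> pprod K e) \<in> nonunits K W \<longrightarrow> (\<forall>e\<in>E. c e \<in> nonunits K W))"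

lemma res_indepD:
  assumes "res_indep K W A S" "finite E" "E \<subseteq> exps S" "\<And>e. e \<in> E \<Longrightarrow> c e \<in> A"
    "(\<Oplus>\<^bsub>K\<^esub>e\<in>E. c e \<otimes>\<^bsub>K\<^esub> pprod K e) \<in> nonunits K W" "e \<in> E"
  shows "c e \<in> nonunits K W"
proof -
  have "c \<in> E \<rightarrow> A" using assms(4) by blast
  then show ?thesis using assms(1,2,3,5,6) unfolding res_indep_def by blast
qed

lemma exps_mono: "S \<subseteq> S' \<Longrightarrow> exps S \<subseteq> exps S'"
  unfolding exps_def by auto

lemma exps_add: "e \<in> exps S \<Longrightarrow> f \<in> exps S \<Longrightarrow> (\<lambda>x. e x + f x) \<in> exps S"
  by (auto simp: exps_def supp_def Collect_disj_eq)

text \<open>The exponent of the monomial \<open>x\<close>.\<close>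

definition expt1 :: "'a \<Rightarrow> 'a \<Rightarrow> nat" where "expt1 x = (\<lambda>y. if y = x then 1 else 0)"

lemma supp_expt1: "supp (expt1 x) = {x}"
  by (auto simp: supp_def expt1_def)

lemma expt1_exps: "x \<in> S \<Longrightarrow> expt1 x \<in> exps S"
  by (simp add: exps_def supp_expt1)

lemma zero_exps: "(\<lambda>_. 0) \<in> exps S"
  by (simp add: exps_def supp_def)

context ambient_field
begin

lemma alg_independent_iff:
  "alg_independent K F S \<longleftrightarrow> S \<subseteq> carrier K \<and> res_indep K (carrier K) F S"
proof -
  have "nonunits K (carrier K) = {\<zero>}" by (rule nonunits_field[OF carrier_is_subfield])
  moreover have "E \<subseteq> exps S \<longleftrightarrow> (\<forall>e\<in>E. finite {x. e x \<noteq> 0} \<and> {x. e x \<noteq> 0} \<subseteq> S)" for E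
    unfolding exps_def supp_def by blast
  ultimately show ?thesis
    unfolding alg_independent_def res_indep_def pprod_def supp_def by simp
qed

lemma finprod_mem:
  assumes B: "subring B K" and f: "\<And>x. x \<in> F \<Longrightarrow> f x \<in> B"
  shows "finprod K f F \<in> B"
proof (cases "finite F")
  case True
  then show ?thesis using f
  proof (induction F)
    case (insert x F)
    have "f \<in> F \<rightarrow> carrier K" "f x \<in> carrier K" using insert.prems subring_carrier[OF B] by auto
    then have "finprod K f (insert x F) = f x \<otimes> finprod K f F" using insert.hyps by simp
    then show ?case using insert subringE(6)[OF B] by auto
  qed (use subringE(3)[OF B] in simp)
qed (use subringE(3)[OF B] in simp)

lemma pow_mem:
  assumes B: "subring B K" and x: "x \<in> B" shows "x [^] (n::nat) \<in> B"
  by (induction n) (use subringE(3,6)[OF B] x in auto)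

lemma finsum_mem:
  assumes B: "subring B K" and I: "ideal_in K B I" and f: "\<And>x. x \<in> F \<Longrightarrow> f x \<in> I"
  shows "finsum K f F \<in> I"
proof (cases "finite F")
  case True
  then show ?thesis using f
  proof (induction F)
    case (insert x F)
    have "f y \<in> carrier K" if "y \<in> insert x F" for y
      using insert.prems[OF that] ideal_inD(1)[OF I] subring_carrier[OF B] by blast
    then have "finsum K f (insert x F) = f x \<oplus> finsum K f F"
      using insert.hyps by (intro finsum_insert) auto
    then show ?case using insert.IH insert.prems ideal_inD(3)[OF I] by simp
  qed (use ideal_inD(2)[OF I] in simp)
qed (use ideal_inD(2)[OF I] in simp)

lemma pprod_mem:
  assumes B: "subring B K" and e: "supp e \<subseteq> B" shows "pprod K e \<in> B"
  unfolding pprod_def by (rule finprod_mem[OF B]) (use e pow_mem[OF B] in blast)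

lemma pprod_carrier: "supp e \<subseteq> carrier K \<Longrightarrow> pprod K e \<in> carrier K"
  using pprod_mem[OF carrier_is_subring] .

lemma pprod_superset:
  assumes "finite F" "supp e \<subseteq> F" "F \<subseteq> carrier K"
  shows "pprod K e = (\<Otimes>x\<in>F. x [^] e x)"
  unfolding pprod_def
  by (rule finprod_mono_neutral_cong_left) (use assms in \<open>auto simp: supp_def\<close>)

lemma pprod_add:
  assumes "e \<in> exps (carrier K)" "f \<in> exps (carrier K)"
  shows "pprod K (\<lambda>x. e x + f x) = pprod K e \<otimes> pprod K f"
proof -
  define F where "F = supp e \<union> supp f"
  have F: "finite F" "F \<subseteq> carrier K" using assms unfolding F_def exps_def by auto
  have "pprod K (\<lambda>x. e x + f x) = (\<Otimes>x\<in>F. x [^] (e x + f x))"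
    by (rule pprod_superset) (use F in \<open>auto simp: F_def supp_def\<close>)
  also have "\<dots> = (\<Otimes>x\<in>F. x [^] e x \<otimes> x [^] f x)"
    by (rule finprod_cong') (use F in \<open>auto simp: nat_pow_mult\<close>)
  also have "\<dots> = (\<Otimes>x\<in>F. x [^] e x) \<otimes> (\<Otimes>x\<in>F. x [^] f x)"
    using F by (intro finprod_multf) auto
  also have "(\<Otimes>x\<in>F. x [^] e x) = pprod K e"
    by (rule pprod_superset[symmetric]) (use F in \<open>auto simp: F_def\<close>)
  also have "(\<Otimes>x\<in>F. x [^] f x) = pprod K f"
    by (rule pprod_superset[symmetric]) (use F in \<open>auto simp: F_def\<close>)
  finally show ?thesis .
qed

lemma pprod_zero [simp]: "pprod K (\<lambda>_. 0) = \<one>"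
  by (simp add: pprod_def supp_def)

lemma pprod_expt1:
  assumes "x \<in> carrier K" shows "pprod K (expt1 x) = x"
proof -
  have "x [^] expt1 x x = x" using assms by (simp add: expt1_def)
  then show ?thesis unfolding pprod_def supp_expt1 using assms by (simp add: expt1_def)
qed

text \<open>Polynomial expressions with coefficients in \<open>A\<close> and exponents in \<open>Q\<close>, generated term by term with
repetitions, which makes the closure properties inductions.  The set \<open>Q\<close> records either which generators
occur or that a given one divides every monomial.\<close>

inductive_set combos :: "'a set \<Rightarrow> ('a \<Rightarrow> nat) set \<Rightarrow> 'a set" for A Q where
  zero: "\<zero> \<in> combos A Q"
| step: "c \<in> A \<Longrightarrow> e \<in> Q \<Longrightarrow> s \<in> combos A Q \<Longrightarrow> c \<otimes> pprod K e \<oplus> s \<in> combos A Q"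

lemma combos_mono:
  assumes "Q \<subseteq> Q'" shows "combos A Q \<subseteq> combos A Q'"
proof
  fix s assume "s \<in> combos A Q"
  then show "s \<in> combos A Q'" by induction (use assms combos.intros in auto)
qed

lemma combos_subset:
  assumes "subring W K" "A \<subseteq> W" "S \<subseteq> W" "Q \<subseteq> exps S"
  shows "combos A Q \<subseteq> W"
proof
  fix s assume "s \<in> combos A Q"
  then show "s \<in> W"
  proof induction
    case (step c e s)
    have "supp e \<subseteq> W" using step.hyps(2) assms(3,4) unfolding exps_def by blast
    then have "c \<otimes> pprod K e \<in> W" using pprod_mem[OF assms(1)] step.hyps assms(2) subringE(6)[OF assms(1)] by blast
    then show ?case using step.IH subringE(7)[OF assms(1)] by blast
  qed (use subringE(2)[OF assms(1)] in simp)
qed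

context
  fixes A S
  assumes A: "subring A K" and S: "S \<subseteq> carrier K"
begin

lemma combos_carrier: "s \<in> combos A (exps S) \<Longrightarrow> s \<in> carrier K"
  using combos_subset[OF carrier_is_subring subringE(1)[OF A] S subset_refl] by blast

lemma exps_carrier: "e \<in> exps S \<Longrightarrow> e \<in> exps (carrier K)"
  using exps_mono[OF S] by blast

lemma pprod_exps_carrier: "e \<in> exps S \<Longrightarrow> pprod K e \<in> carrier K"
  using S pprod_carrier unfolding exps_def by blast

lemma combos_add:
  assumes "s \<in> combos A (exps S)" "t \<in> combos A (exps S)" shows "s \<oplus> t \<in> combos A (exps S)"
  using assms(1)
proof induction
  case zero then show ?case using assms(2) combos_carrier by simp
next
  case (step c e s)
  have "c \<otimes> pprod K e \<oplus> s \<oplus> t = c \<otimes> pprod K e \<oplus> (s \<oplus> t)"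
    using step.hyps subring_carrier[OF A] pprod_exps_carrier combos_carrier assms(2) by (simp add: a_assoc)
  then show ?case using combos.step[OF step.hyps(1,2) step.IH] by simp
qed

lemma combos_term_mult:
  assumes c: "c \<in> A" and e: "e \<in> exps S" and s: "s \<in> combos A (exps S)"
  shows "(c \<otimes> pprod K e) \<otimes> s \<in> combos A {f \<in> exps S. \<forall>x. e x \<le> f x}"
  using s
proof induction
  case zero then show ?case using c e subring_carrier[OF A] pprod_exps_carrier combos.zero by simp
next
  case (step d f s)
  have cr: "c \<in> carrier K" "d \<in> carrier K" "pprod K e \<in> carrier K" "pprod K f \<in> carrier K" "s \<in> carrier K"
    using c e step.hyps subring_carrier[OF A] pprod_exps_carrier combos_carrier by auto
  have "(c \<otimes> pprod K e) \<otimes> (d \<otimes> pprod K f \<oplus> s) = (c \<otimes> d) \<otimes> pprod K (\<lambda>x. e x + f x) \<oplus> (c \<otimes> pprod K e) \<otimes> s"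
    using cr pprod_add[OF exps_carrier[OF e] exps_carrier[OF step.hyps(2)]] by (simp add: r_distr m_ac)
  moreover have "c \<otimes> d \<in> A" using c step.hyps subringE(6)[OF A] by blast
  moreover have "(\<lambda>x. e x + f x) \<in> {f \<in> exps S. \<forall>x. e x \<le> f x}" using exps_add[OF e step.hyps(2)] by simp
  ultimately show ?case using combos.step[OF _ _ step.IH] by simp
qed

lemma combos_mult:
  assumes "s \<in> combos A (exps S)" "t \<in> combos A (exps S)" shows "s \<otimes> t \<in> combos A (exps S)"
  using assms(1)
proof induction
  case zero then show ?case using assms(2) combos_carrier combos.zero by simp
next
  case (step c e s)
  have "(c \<otimes> pprod K e \<oplus> s) \<otimes> t = (c \<otimes> pprod K e) \<otimes> t \<oplus> s \<otimes> t"
    using step.hyps subring_carrier[OF A] pprod_exps_carrier combos_carrier assms(2) by (simp add: l_distr)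
  moreover have "(c \<otimes> pprod K e) \<otimes> t \<in> combos A (exps S)"
    using combos_term_mult[OF step.hyps(1,2) assms(2)] combos_mono[of "{f \<in> exps S. \<forall>x. e x \<le> f x}" "exps S" A] by blast
  ultimately show ?case using combos_add step.IH by simp
qed

lemma combos_incl: "A \<subseteq> combos A (exps S)"
proof
  fix a assume a: "a \<in> A"
  have "a \<otimes> pprod K (\<lambda>_. 0) \<oplus> \<zero> \<in> combos A (exps S)"
    by (rule combos.step[OF a zero_exps combos.zero])
  then show "a \<in> combos A (exps S)" using subring_carrier[OF A a] by simp
qed

lemma combos_gens: "S \<subseteq> combos A (exps S)"
proof
  fix x assume x: "x \<in> S"
  have xc: "x \<in> carrier K" using x S by blast
  have "\<one> \<otimes> pprod K (expt1 x) \<oplus> \<zero> \<in> combos A (exps S)"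
    by (rule combos.step[OF subringE(3)[OF A] expt1_exps[OF x] combos.zero])
  then show "x \<in> combos A (exps S)" using xc pprod_expt1[OF xc] by simp
qed

lemma combos_subring: "subring (combos A (exps S)) K"
proof (rule subringI)
  show "combos A (exps S) \<subseteq> carrier K" using combos_carrier by blast
  show "\<one> \<in> combos A (exps S)" using combos_incl subringE(3)[OF A] by blast
  fix s t assume s: "s \<in> combos A (exps S)" and t: "t \<in> combos A (exps S)"
  show "s \<oplus> t \<in> combos A (exps S)" "s \<otimes> t \<in> combos A (exps S)"
    using combos_add[OF s t] combos_mult[OF s t] .
  have "\<ominus> \<one> \<in> combos A (exps S)" using combos_incl subringE(5)[OF A subringE(3)[OF A]] by blast
  then have "(\<ominus> \<one>) \<otimes> s \<in> combos A (exps S)" using combos_mult s by blast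
  then show "\<ominus> s \<in> combos A (exps S)" using combos_carrier[OF s] by (simp add: l_minus)
qed

text \<open>Collecting like terms gives a sum over distinct exponents, the form in which independence is stated.\<close>

lemma combos_repr:
  assumes s: "s \<in> combos A Q" and Q: "Q \<subseteq> exps S"
  obtains E c where "finite E" "E \<subseteq> Q" "\<And>e. e \<in> E \<Longrightarrow> c e \<in> A" "s = (\<Oplus>e\<in>E. c e \<otimes> pprod K e)"
proof -
  have "\<exists>E c. finite E \<and> E \<subseteq> Q \<and> (\<forall>e\<in>E. c e \<in> A) \<and> s = (\<Oplus>e\<in>E. c e \<otimes> pprod K e)"
    using s
  proof induction
    case zero
    show ?case by (rule exI[of _ "{}"]) simp
  next
    case (step a f s)
    then obtain E c where Ec: "finite E" "E \<subseteq> Q" "\<And>e. e \<in> E \<Longrightarrow> c e \<in> A" "s = (\<Oplus>e\<in>E. c e \<otimes> pprod K e)"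
      by blast
    \<comment> \<open>the coefficient of the new term is merged with the one already present, if any\<close>
    define c' where "c' = c(f := if f \<in> E then a \<oplus> c f else a)"
    have mc: "pprod K e \<in> carrier K" if "e \<in> Q" for e using pprod_exps_carrier that Q by blast
    have cA: "e \<in> E \<Longrightarrow> c e \<in> carrier K" for e using Ec(3) subring_carrier[OF A] by blast
    have ac: "a \<in> carrier K" using step.hyps subring_carrier[OF A] by blast
    have c'A: "c' e \<in> A" if "e \<in> insert f E" for e
      using that Ec(3) step.hyps(1) subringE(7)[OF A] unfolding c'_def by auto
    have tc: "c e \<otimes> pprod K e \<in> carrier K" if "e \<in> E" for e using that cA mc Ec(2) by blast
    define R where "R = (\<Oplus>e\<in>E - {f}. c e \<otimes> pprod K e)"
    have Rc: "R \<in> carrier K" unfolding R_def by (rule finsum_closed) (use tc in auto)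
    have "(\<Oplus>e\<in>insert f E. c' e \<otimes> pprod K e) = (\<Oplus>e\<in>insert f (E - {f}). c' e \<otimes> pprod K e)" by simp
    also have "\<dots> = c' f \<otimes> pprod K f \<oplus> (\<Oplus>e\<in>E - {f}. c' e \<otimes> pprod K e)"
    proof (rule finsum_insert)
      show "(\<lambda>e. c' e \<otimes> pprod K e) \<in> E - {f} \<rightarrow> carrier K" using tc by (auto simp: c'_def)
      show "c' f \<otimes> pprod K f \<in> carrier K"
        using c'A[of f] subring_carrier[OF A] mc step.hyps(2) by blast
    qed (use Ec in auto)
    also have "(\<Oplus>e\<in>E - {f}. c' e \<otimes> pprod K e) = R" unfolding R_def
      by (rule finsum_cong') (use tc in \<open>auto simp: c'_def\<close>)
    also have "c' f \<otimes> pprod K f \<oplus> R = a \<otimes> pprod K f \<oplus> s"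
    proof (cases "f \<in> E")
      case True
      then have "s = (\<Oplus>e\<in>insert f (E - {f}). c e \<otimes> pprod K e)" using Ec(4) by (simp add: insert_absorb)
      also have "\<dots> = c f \<otimes> pprod K f \<oplus> R"
        unfolding R_def by (rule finsum_insert) (use Ec tc True in auto)
      finally show ?thesis
        using True cA ac mc[OF step.hyps(2)] Rc by (simp add: c'_def l_distr a_assoc)
    next
      case False
      then show ?thesis using Ec(4) unfolding R_def c'_def by simp
    qed
    finally show ?case
      using Ec c'A step.hyps(2) by (intro exI[of _ "insert f E"] exI[of _ c']) auto
  qed
  then show thesis using that by blast
qed

end

text \<open>This makes \<open>x\<close> transcendental over the residues of the generators in \<open>Y\<close>: no monomial of \<open>s\<close> involves
\<open>x\<close> and every monomial of \<open>x \<otimes> a\<close> does, so independence applies to all their coefficients at once.\<close>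

lemma res_indep_transcendental:
  assumes L: "subfield L K" and W: "val_ring K L W" and A: "subring A K" "A \<subseteq> W" and S: "S \<subseteq> W"
    and ind: "res_indep K W A S" and x: "x \<in> S" "x \<notin> Y" and Y: "Y \<subseteq> S"
    and s: "s \<in> combos A (exps Y)" and a: "a \<in> combos A (exps S)" and d: "s \<ominus> x \<otimes> a \<in> nonunits K W"
  shows "s \<in> nonunits K W"
proof -
  note W' = val_ringD[OF W]
  have Sc: "S \<subseteq> carrier K" using S subringE(1)[OF W'(1)] by blast
  have Yc: "Y \<subseteq> carrier K" using Y Sc by blast
  have xc: "x \<in> carrier K" using x Sc by blast
  have ac: "a \<in> carrier K" using combos_carrier[OF A(1) Sc a] .
  obtain E1 c1 where 1: "finite E1" "E1 \<subseteq> exps Y" "\<And>e. e \<in> E1 \<Longrightarrow> c1 e \<in> A" "s = (\<Oplus>e\<in>E1. c1 e \<otimes> pprod K e)"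
    using combos_repr[OF A(1) Yc s subset_refl] by blast
  define Q where "Q = {f \<in> exps S. \<forall>y. expt1 x y \<le> f y}"
  have "(\<ominus> \<one> \<otimes> pprod K (expt1 x)) \<otimes> a \<in> combos A Q"
    unfolding Q_def by (rule combos_term_mult[OF A(1) Sc subringE(5)[OF A(1) subringE(3)[OF A(1)]] expt1_exps[OF x(1)] a])
  moreover have "(\<ominus> \<one> \<otimes> pprod K (expt1 x)) \<otimes> a = \<ominus> (x \<otimes> a)"
    using xc ac pprod_expt1[OF xc] by (simp add: l_minus)
  ultimately have xa: "\<ominus> (x \<otimes> a) \<in> combos A Q" by simp
  have Q: "Q \<subseteq> exps S" unfolding Q_def by blast
  obtain E2 c2 where 2: "finite E2" "E2 \<subseteq> Q" "\<And>e. e \<in> E2 \<Longrightarrow> c2 e \<in> A" "\<ominus> (x \<otimes> a) = (\<Oplus>e\<in>E2. c2 e \<otimes> pprod K e)"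
    using combos_repr[OF A(1) Sc xa Q] by blast
  have dis: "E1 \<inter> E2 = {}"
  proof (rule ccontr)
    assume "E1 \<inter> E2 \<noteq> {}"
    then obtain e where e: "e \<in> exps Y" "e \<in> Q" using 1(2) 2(2) by blast
    have "expt1 x x \<le> e x" using e(2) unfolding Q_def by blast
    then have "x \<in> supp e" by (simp add: expt1_def supp_def)
    then show False using e(1) x(2) unfolding exps_def by blast
  qed
  define c where "c = (\<lambda>e. if e \<in> E1 then c1 e else c2 e)"
  have c1: "c e = c1 e" if "e \<in> E1" for e using that by (simp add: c_def)
  have c2: "c e = c2 e" if "e \<in> E2" for e using that dis by (auto simp: c_def)
  have ES: "E1 \<union> E2 \<subseteq> exps S" using 1(2) 2(2) Q exps_mono[OF Y] by blast
  have cA: "c e \<in> A" if "e \<in> E1 \<union> E2" for e using that 1(3) 2(3) c1 c2 by (cases "e \<in> E1") auto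
  have mW: "pprod K e \<in> W" if "e \<in> exps S" for e
    using that pprod_mem[OF W'(1)] S unfolding exps_def by blast
  have tc: "c e \<otimes> pprod K e \<in> carrier K" if "e \<in> E1 \<union> E2" for e
    using cA[OF that] that ES mW A(2) subring_carrier[OF W'(1)] by blast
  have tc1: "c1 e \<otimes> pprod K e \<in> carrier K" if "e \<in> E1" for e using tc[of e] c1[OF that] that by simp
  have tc2: "c2 e \<otimes> pprod K e \<in> carrier K" if "e \<in> E2" for e using tc[of e] c2[OF that] that by simp
  have "(\<Oplus>e\<in>E1 \<union> E2. c e \<otimes> pprod K e) = (\<Oplus>e\<in>E1. c e \<otimes> pprod K e) \<oplus> (\<Oplus>e\<in>E2. c e \<otimes> pprod K e)"
    by (rule finsum_Un_disjoint) (use 1 2 dis tc in auto)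
  also have "(\<Oplus>e\<in>E1. c e \<otimes> pprod K e) = s" unfolding 1(4)
    by (rule finsum_cong') (use c1 tc1 in auto)
  also have "(\<Oplus>e\<in>E2. c e \<otimes> pprod K e) = \<ominus> (x \<otimes> a)" unfolding 2(4)
    by (rule finsum_cong') (use c2 tc2 in auto)
  finally have sum: "(\<Oplus>e\<in>E1 \<union> E2. c e \<otimes> pprod K e) \<in> nonunits K W" using d by (simp add: minus_eq)
  have c1n: "c1 e \<in> nonunits K W" if "e \<in> E1" for e
  proof -
    have "c e \<in> nonunits K W"
      by (rule res_indepD[OF ind _ ES cA sum]) (use 1(1) 2(1) that in auto)
    then show ?thesis using c1[OF that] by simp
  qed
  have id: "ideal_in K W (nonunits K W)" using prime_inD(1)[OF nonunits_prime[OF L W]] .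
  show ?thesis unfolding 1(4)
  proof (rule finsum_mem[OF W'(1) id])
    fix e assume e: "e \<in> E1"
    show "c1 e \<otimes> pprod K e \<in> nonunits K W"
      using ideal_in_r[OF W'(1) id mW c1n[OF e]] e ES by blast
  qed
qed

end

section \<open>Refining a valuation ring along an independent set\<close>

context ambient_field
begin

lemma ideal_generated_with:
  assumes W: "subring W K" and B: "subring B K" "B \<subseteq> W" and M: "ideal_in K W M" and x: "x \<in> B"
  shows "ideal_in K B {x \<otimes> a \<oplus> m | a m. a \<in> B \<and> m \<in> B \<inter> M}"
  unfolding ideal_in_def
proof (intro conjI ballI)
  have sc: "y \<in> B \<Longrightarrow> y \<in> carrier K" for y using subring_carrier[OF B(1)] .
  let ?I = "{x \<otimes> a \<oplus> m | a m. a \<in> B \<and> m \<in> B \<inter> M}"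
  show "?I \<subseteq> B" using subringE(6,7)[OF B(1)] x by blast
  have "\<zero> = x \<otimes> \<zero> \<oplus> \<zero>" using sc[OF x] by simp
  then show "\<zero> \<in> ?I" using subringE(2)[OF B(1)] ideal_inD(2)[OF M] by blast
  {
    fix u v assume "u \<in> ?I" "v \<in> ?I"
    then obtain a m b n where *: "u = x \<otimes> a \<oplus> m" "v = x \<otimes> b \<oplus> n" "a \<in> B" "b \<in> B" "m \<in> B" "m \<in> M" "n \<in> B" "n \<in> M"
      by blast
    have "u \<oplus> v = x \<otimes> (a \<oplus> b) \<oplus> (m \<oplus> n)" using * sc x by (simp add: r_distr a_ac)
    moreover have "a \<oplus> b \<in> B" "m \<oplus> n \<in> B" "m \<oplus> n \<in> M"
      using subringE(7)[OF B(1) *(3,4)] subringE(7)[OF B(1) *(5,7)] ideal_inD(3)[OF M *(6,8)] .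
    ultimately show "u \<oplus> v \<in> ?I" by blast
  next
    fix u v assume u: "u \<in> B" and "v \<in> ?I"
    then obtain b n where *: "v = x \<otimes> b \<oplus> n" "b \<in> B" "n \<in> B" "n \<in> M" by blast
    have "u \<otimes> v = x \<otimes> (u \<otimes> b) \<oplus> u \<otimes> n" using * u sc x by (simp add: r_distr m_ac)
    moreover have "u \<otimes> b \<in> B" "u \<otimes> n \<in> B" using subringE(6)[OF B(1) u] * by auto
    moreover have "u \<otimes> n \<in> M" using ideal_inD(4)[OF M _ *(4)] u B(2) by blast
    ultimately show "u \<otimes> v \<in> ?I" by blast
  }
qed

text \<open>One element of \<open>S\<close> after the other is made a nonunit, while the ring generated by the remaining ones keeps its
nonunits, so that they stay independent.  Each time the valuation ring becomes strictly smaller, because the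
element was a unit before.\<close>

theorem refine_by_independent_set:
  assumes L: "subfield L K" and W: "val_ring K L W" and A: "subring A K" "A \<subseteq> W"
    and S: "finite S" "S \<subseteq> W" and ind: "res_indep K W A S"
  obtains W' where "val_ring K L W'" "W' \<subseteq> W" "A \<subseteq> W'" "nonunits K W' \<inter> A = nonunits K W \<inter> A"
    "nonunits K W \<subseteq> nonunits K W'" "ring_chain K W W' (card S)"
proof -
  note W' = val_ringD[OF W]
  let ?M = "nonunits K W"
  note pW = nonunits_prime[OF L W]
  note id = prime_inD(1)[OF pW]
  have Sc: "S \<subseteq> carrier K" using S subringE(1)[OF W'(1)] by blast
  have "\<exists>V. val_ring K L V \<and> V \<subseteq> W \<and> combos A (exps (S - T)) \<subseteq> V \<and>
      nonunits K V \<inter> combos A (exps (S - T)) \<subseteq> ?M \<and> ?M \<subseteq> nonunits K V \<and> ring_chain K W V (card T)"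
    if "finite T" "T \<subseteq> S" for T
    using that
  proof (induction T)
    case empty
    have "combos A (exps S) \<subseteq> W" by (rule combos_subset[OF W'(1) A(2) S(2) subset_refl])
    then show ?case using W ring_chain_0[OF W'(1) subset_refl] by (intro exI[of _ W]) auto
  next
    case (insert x T)
    define B B' where "B = combos A (exps (S - T))" and "B' = combos A (exps (S - insert x T))"
    have cS: "S - T \<subseteq> carrier K" "S - insert x T \<subseteq> carrier K" using Sc by auto
    have B: "subring B K" "subring B' K" unfolding B_def B'_def using combos_subring[OF A(1)] cS by auto
    have B'B: "B' \<subseteq> B" unfolding B_def B'_def by (intro combos_mono exps_mono) blast
    have xB: "x \<in> B" using combos_gens[OF A(1) cS(1)] insert.prems insert.hyps unfolding B_def by blast
    have BW: "B \<subseteq> W" unfolding B_def using combos_subset[OF W'(1) A(2) _ subset_refl] S(2) by blast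
    have xc: "x \<in> carrier K" using xB subring_carrier[OF B(1)] by blast
    have BS: "B \<subseteq> combos A (exps S)" unfolding B_def by (intro combos_mono exps_mono) blast
    obtain V where V: "val_ring K L V" "V \<subseteq> W" "B \<subseteq> V" "nonunits K V \<inter> B \<subseteq> ?M" "?M \<subseteq> nonunits K V"
      "ring_chain K W V (card T)"
      using insert.IH insert.prems unfolding B_def by blast
    \<comment> \<open>\<open>x\<close> is to become a nonunit, the expressions without \<open>x\<close> that are units of \<open>W\<close> are to remain units\<close>
    define I where "I = {x \<otimes> a \<oplus> m | a m. a \<in> B \<and> m \<in> B \<inter> ?M}"
    define Q where "Q = B' - ?M"
    have I: "ideal_in K B I" unfolding I_def by (rule ideal_generated_with[OF W'(1) B(1) BW id xB])
    have MI: "nonunits K V \<inter> B \<subseteq> I"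
    proof
      fix m assume m: "m \<in> nonunits K V \<inter> B"
      then have "m = x \<otimes> \<zero> \<oplus> m" using xc subring_carrier[OF B(1)] by simp
      moreover have "m \<in> B \<inter> ?M" using m V(4) by blast
      ultimately show "m \<in> I" unfolding I_def using subringE(2)[OF B(1)] by blast
    qed
    have Q: "mult_set B Q"
      unfolding mult_set_def
    proof (intro conjI ballI)
      show "Q \<subseteq> B - {\<zero>}" unfolding Q_def using B'B ideal_inD(2)[OF id] by blast
      show "\<one> \<in> Q" unfolding Q_def using subringE(3)[OF B(2)] prime_inD(2)[OF pW] by blast
      fix s t assume st: "s \<in> Q" "t \<in> Q"
      then have "s \<otimes> t \<in> B'" using subringE(6)[OF B(2)] unfolding Q_def by blast
      moreover have "s \<in> W" "t \<in> W" using st B'B BW unfolding Q_def by auto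
      ultimately show "s \<otimes> t \<in> Q" using prime_inD(3)[OF pW, of s t] st unfolding Q_def by blast
    qed
    have "I \<inter> Q = {}"
    proof (rule ccontr)
      assume "I \<inter> Q \<noteq> {}"
      then obtain s a m where *: "s \<in> B'" "s \<notin> ?M" "s = x \<otimes> a \<oplus> m" "a \<in> B" "m \<in> B" "m \<in> ?M"
        unfolding I_def Q_def by blast
      have c: "a \<in> carrier K" "m \<in> carrier K" using * subring_carrier[OF B(1)] by auto
      have "s \<ominus> x \<otimes> a = m" unfolding *(3) using xc c by algebra
      then have "s \<in> ?M"
        using res_indep_transcendental[OF L W A S(2) ind, of x "S - insert x T" s a]
          * BS insert.prems unfolding B'_def by auto
      then show False using * by blast
    qed
    then obtain V' where V': "val_ring K L V'" "V' \<subseteq> V" "B \<subseteq> V'" "I \<subseteq> nonunits K V'"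
      "nonunits K V \<subseteq> nonunits K V'" "Q \<inter> nonunits K V' = {}"
      by (rule val_ring_refine[OF L V(1) B(1) V(3) I MI Q]) auto
    have "x = x \<otimes> \<one> \<oplus> \<zero>" using xc by simp
    then have "x \<in> I"
      unfolding I_def using subringE(2,3)[OF B(1)] ideal_inD(2)[OF id] by blast
    have "x \<notin> ?M"
    proof
      assume xM: "x \<in> ?M"
      have xS: "x \<in> S" using insert.prems by blast
      have "(\<Oplus>e\<in>{expt1 x}. \<one> \<otimes> pprod K e) = x" using pprod_expt1[OF xc] xc by simp
      then have "\<one> \<in> ?M"
        using res_indepD[OF ind, of "{expt1 x}" "\<lambda>_. \<one>" "expt1 x"] xM expt1_exps[OF xS] subringE(3)[OF A(1)] by simp
      then show False using prime_inD(2)[OF pW] by blast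
    qed
    then have "x \<notin> nonunits K V" using V(4) xB by blast
    then have "V' \<noteq> V" using \<open>x \<in> I\<close> V'(4) by blast
    then have strict: "V' \<subset> V" using V'(2) by blast
    have ch1: "ring_chain K V V' 1"
      by (rule ring_chainI[of _ "\<lambda>i. if i = 0 then V else V'"])
        (use strict val_ringD(1)[OF V(1)] val_ringD(1)[OF V'(1)] in auto)
    have "ring_chain K W V' (card (insert x T))"
      using ring_chain_append[OF V(6) ch1] insert.hyps by simp
    moreover have "nonunits K V' \<inter> B' \<subseteq> ?M" using V'(6) unfolding Q_def by blast
    ultimately show ?case
      using V' V B'B unfolding B'_def[symmetric] by (intro exI[of _ V']) blast
  qed
  from this[OF S(1) subset_refl] obtain V where V: "val_ring K L V" "V \<subseteq> W" "combos A (exps {}) \<subseteq> V"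
      "nonunits K V \<inter> combos A (exps {}) \<subseteq> ?M" "?M \<subseteq> nonunits K V" "ring_chain K W V (card S)"
    by auto
  have "A \<subseteq> combos A (exps {})" by (rule combos_incl[OF A(1) empty_subsetI])
  then show thesis using that[OF V(1,2) _ _ V(5,6)] V(3-5) by blast
qed

section \<open>The rank inequality\<close>

lemma pprod_unit:
  assumes L: "subfield L K" and V: "val_ring K L V" and e: "supp e \<subseteq> V - nonunits K V"
  shows "pprod K e \<in> V - nonunits K V"
proof -
  note V' = val_ringD[OF V] and p = nonunits_prime[OF L V]
  have mult: "x \<otimes> y \<in> V - nonunits K V" if "x \<in> V - nonunits K V" "y \<in> V - nonunits K V" for x y
    using that prime_inD(3)[OF p, of x y] subringE(6)[OF V'(1), of x y] by blast
  have one: "\<one> \<in> V - nonunits K V" using prime_inD(2)[OF p] subringE(3)[OF V'(1)] by blast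
  have pow: "x [^] (n::nat) \<in> V - nonunits K V" if "x \<in> V - nonunits K V" for x n
    by (induction n) (use one mult[OF _ that] in auto)
  have "finite F \<Longrightarrow> (\<And>x. x \<in> F \<Longrightarrow> f x \<in> V - nonunits K V) \<Longrightarrow> finprod K f F \<in> V - nonunits K V" for F and f :: "'a \<Rightarrow> 'a"
  proof (induction F rule: finite_induct)
    case (insert x F)
    have "f \<in> F \<rightarrow> carrier K" "f x \<in> carrier K" using insert.prems subring_carrier[OF V'(1)] by auto
    then have "finprod K f (insert x F) = f x \<otimes> finprod K f F" using insert.hyps by simp
    then show ?case using mult insert.prems insert.IH by simp
  qed (use one in simp)
  then show ?thesis
    unfolding pprod_def using one pow e
    by (cases "finite (supp e)") (auto simp: subset_iff finprod_infinite)
qed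

lemma pprod_nonunit:
  assumes L: "subfield L K" and V: "val_ring K L V" and e: "e \<in> exps V" and x: "x \<in> nonunits K V" "e x \<noteq> 0"
  shows "pprod K e \<in> nonunits K V"
proof -
  note V' = val_ringD[OF V] and p = nonunits_prime[OF L V]
  define f where "f = (\<lambda>y. if y = x then e x - 1 else e y)"
  have xV: "x \<in> V" using x unfolding nonunits_def by blast
  have ef: "e = (\<lambda>y. expt1 x y + f y)" using x(2) by (auto simp: f_def expt1_def)
  have "supp f \<subseteq> supp e" using x(2) by (auto simp: supp_def f_def)
  then have f: "f \<in> exps V" using e finite_subset[of "supp f" "supp e"] unfolding exps_def by blast
  have cV: "exps V \<subseteq> exps (carrier K)" by (rule exps_mono[OF subringE(1)[OF V'(1)]])
  have "pprod K e = pprod K (expt1 x) \<otimes> pprod K f"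
    using pprod_add[of "expt1 x" f] cV f expt1_exps[OF xV] ef by auto
  also have "\<dots> = x \<otimes> pprod K f" using pprod_expt1 subring_carrier[OF V'(1) xV] by simp
  finally show ?thesis
    using ideal_in_r[OF V'(1) prime_inD(1)[OF p] _ x(1)] pprod_mem[OF V'(1)] f unfolding exps_def by auto
qed

text \<open>Terms of pairwise different value: the sum has the value of one of its terms.\<close>

lemma sum_of_nonassociates:
  assumes L: "subfield L K" and V: "val_ring K L V" and E: "finite E" "E \<noteq> {}"
    and u: "\<And>e. e \<in> E \<Longrightarrow> u e \<in> L" "\<And>e. e \<in> E \<Longrightarrow> u e \<noteq> \<zero>"
    and na: "\<And>e f. e \<in> E \<Longrightarrow> f \<in> E \<Longrightarrow> e \<noteq> f \<Longrightarrow> u e \<otimes> inv (u f) \<in> V \<Longrightarrow> u f \<otimes> inv (u e) \<notin> V"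
  shows "\<exists>e\<in>E. \<exists>v\<in>V - nonunits K V. finsum K u E = u e \<otimes> v"
  using E u na
proof (induction E rule: finite_ne_induct)
  note V' = val_ringD[OF V] and p = nonunits_prime[OF L V]
  note id = prime_inD(1)[OF p]
  have one: "\<one> \<in> V - nonunits K V" using prime_inD(2)[OF p] subringE(3)[OF V'(1)] by blast
  have sL: "y \<in> L \<Longrightarrow> y \<in> carrier K" for y using subring_carrier[OF subfieldE(1)[OF L]] .
  {
    case (singleton e)
    then show ?case using one sL by (intro bexI[of _ e] bexI[of _ \<one>]) auto
  next
    case (insert e F)
    obtain f v where fv: "f \<in> F" "v \<in> V" "v \<notin> nonunits K V" "finsum K u F = u f \<otimes> v"
      using insert.IH insert.prems by blast
    have c: "u e \<in> carrier K" "u f \<in> carrier K" "v \<in> carrier K" "u e \<noteq> \<zero>" "u f \<noteq> \<zero>" "u e \<in> L" "u f \<in> L"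
      using insert.prems fv subring_carrier[OF V'(1)] sL by auto
    have sum: "finsum K u (insert e F) = u e \<oplus> u f \<otimes> v"
      unfolding fv(4)[symmetric] by (rule finsum_insert) (use insert.hyps insert.prems sL in auto)
    have ne: "e \<noteq> f" using insert.hyps fv by blast
    define r where "r = u e \<otimes> inv (u f)"
    have ri: "inv r = u f \<otimes> inv (u e)" unfolding r_def using c by (simp add: inv_mult_nz m_comm)
    have rL: "r \<in> L" unfolding r_def
      using c subfield_inv[OF L] subringE(6)[OF subfieldE(1)[OF L]] by blast
    have rc: "r \<in> carrier K" "r \<noteq> \<zero>" using sL[OF rL] c unfolding r_def by auto
    have shift: "x \<oplus> y \<in> V - nonunits K V" if x: "x \<in> V" "x \<notin> nonunits K V" and y: "y \<in> nonunits K V" for x y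
    proof -
      have yV: "y \<in> V" using y unfolding nonunits_def by blast
      have cc: "x \<in> carrier K" "y \<in> carrier K" using x(1) yV subring_carrier[OF V'(1)] by auto
      have "x = (x \<oplus> y) \<ominus> y" using cc by algebra
      then have "x \<oplus> y \<notin> nonunits K V" using ideal_in_minus[OF V'(1) id _ y, of "x \<oplus> y"] x(2) by auto
      then show ?thesis using subringE(7)[OF V'(1) x(1) yV] by blast
    qed
    show ?case
    proof (cases "r \<in> V")
      case True
      have "inv r \<notin> V" using insert.prems(3)[of e f] fv(1) ne True unfolding ri unfolding r_def by blast
      then have "r \<in> nonunits K V" using True unfolding nonunits_def by blast
      then have "v \<oplus> r \<in> V - nonunits K V" using shift fv by blast
      moreover have "u e \<oplus> u f \<otimes> v = u f \<otimes> (v \<oplus> r)"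
      proof -
        have "u f \<otimes> r = u e" unfolding r_def using c by (metis cancel_inv_right(1) inv_closed_nz m_closed m_comm)
        then show ?thesis using c rc by (simp add: r_distr a_comm)
      qed
      ultimately show ?thesis using sum fv(1) by auto
    next
      case False
      have i: "inv r \<in> nonunits K V" using not_in_val_ring(2)[OF L V rL False] .
      then have iv: "inv r \<otimes> v \<in> nonunits K V" using ideal_in_r[OF V'(1) id fv(2)] by blast
      have "\<one> \<oplus> inv r \<otimes> v \<in> V - nonunits K V" using shift one iv by blast
      moreover have "u e \<oplus> u f \<otimes> v = u e \<otimes> (\<one> \<oplus> inv r \<otimes> v)"
      proof -
        have "u e \<otimes> inv r = u f" unfolding ri using c by (metis cancel_inv_right(1) inv_closed_nz m_closed m_comm)
        then have "u e \<otimes> (inv r \<otimes> v) = u f \<otimes> v" using c rc by (simp add: m_assoc[symmetric])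
        then show ?thesis using c rc by (simp add: r_distr)
      qed
      ultimately show ?thesis using sum by auto
    qed
  }
qed

end

text \<open>Dropping the repetitions from a weakly decreasing sequence.\<close>

lemma ring_chain_of_steps:
  assumes "\<And>i. i \<le> b \<Longrightarrow> subring (Z i) K" "\<And>i. i < b \<Longrightarrow> Z (Suc i) \<subseteq> Z i" "Z 0 \<subseteq> A"
  shows "ring_chain K A (Z b) (card {i. i < b \<and> Z (Suc i) \<noteq> Z i})"
  using assms
proof (induction b)
  case 0
  have "Z 0 \<subseteq> Z 0" by simp
  then show ?case using ring_chain_mono[OF ring_chain_0[OF 0(1)[of 0] subset_refl] 0(3)] by simp
next
  case (Suc b)
  let ?N = "\<lambda>b. {i. i < b \<and> Z (Suc i) \<noteq> Z i}"
  have IH: "ring_chain K A (Z b) (card (?N b))" using Suc by simp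
  have sub: "Z (Suc b) \<subseteq> Z b" using Suc.prems(2)[of b] by simp
  show ?case
  proof (cases "Z (Suc b) = Z b")
    case True
    then have "?N (Suc b) = ?N b" by (auto simp: less_Suc_eq)
    then show ?thesis using IH True by simp
  next
    case False
    then have "?N (Suc b) = insert b (?N b)" by (auto simp: less_Suc_eq)
    then have c: "card (?N (Suc b)) = card (?N b) + 1" by simp
    have "ring_chain K (Z b) (Z (Suc b)) 1"
      by (rule ring_chainI[of _ "\<lambda>i. if i = 0 then Z b else Z (Suc b)"])
        (use Suc.prems(1)[of b] Suc.prems(1)[of "Suc b"] sub False in auto)
    then show ?thesis unfolding c by (rule ring_chain_append[OF IH])
  qed
qed

context ambient_field
begin

text \<open>The residues of the elements of \<open>A\<close> form a field.  A subfield has this property, and so has a ring on which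
the centre of \<open>W\<close> is a maximal ideal.\<close>

definition residue_field :: "'a set \<Rightarrow> 'a set \<Rightarrow> bool" where
  "residue_field W A \<longleftrightarrow> subring A K \<and> A \<subseteq> W \<and>
     (\<forall>a\<in>A. a \<notin> nonunits K W \<longrightarrow> (\<exists>b\<in>A. a \<otimes> b \<ominus> \<one> \<in> nonunits K W))"

lemma residue_fieldD:
  assumes "residue_field W A"
  shows "subring A K" "A \<subseteq> W"
    "\<And>a. a \<in> A \<Longrightarrow> a \<notin> nonunits K W \<Longrightarrow> \<exists>b\<in>A. a \<otimes> b \<ominus> \<one> \<in> nonunits K W"
  using assms unfolding residue_field_def by blast+

lemma units_mult:
  assumes "subfield L K" "val_ring K L V" "x \<in> V - nonunits K V" "y \<in> V - nonunits K V"
  shows "x \<otimes> y \<in> V - nonunits K V"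
  using assms(3,4) prime_inD(3)[OF nonunits_prime[OF assms(1,2)], of x y]
    subringE(6)[OF val_ringD(1)[OF assms(2)], of x y] by blast

lemma unit_over:
  assumes L: "subfield L K" and V: "val_ring K L V" and W: "subring W K" "V \<subseteq> W" "W \<subseteq> L"
    and x: "x \<in> V - nonunits K V"
  shows "x \<in> W - nonunits K W"
  using x W(2) val_ring_over(2)[OF L V W] by blast

lemma unit_plus_nonunit:
  assumes L: "subfield L K" and V: "val_ring K L V" and n: "n \<in> nonunits K V"
  shows "\<one> \<oplus> n \<in> V - nonunits K V"
proof -
  note V' = val_ringD[OF V] and p = nonunits_prime[OF L V]
  have nV: "n \<in> V" using n unfolding nonunits_def by blast
  have nc: "n \<in> carrier K" using nV subring_carrier[OF V'(1)] by blast
  have "(\<one> \<oplus> n) \<ominus> n = \<one>" using nc by algebra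
  then have "\<one> \<oplus> n \<notin> nonunits K V"
    using ideal_in_minus[OF V'(1) prime_inD(1)[OF p] _ n, of "\<one> \<oplus> n"] prime_inD(2)[OF p] by auto
  then show ?thesis using subringE(7)[OF V'(1) subringE(3)[OF V'(1)] nV] by blast
qed

text \<open>In a chain of rings between \<open>W\<close> and \<open>V\<close>, the set \<open>I\<close> holds the steps that collapse on \<open>A\<close>, and the pivot
\<open>x i\<close> of such a step is a unit of the larger ring and a nonunit of the smaller one.\<close>

context
  fixes L W V A b Xs I and x :: "nat \<Rightarrow> 'a"
  assumes L: "subfield L K" and W: "val_ring K L W" and V: "val_ring K L V" "V \<subseteq> W"
    and A: "residue_field W A"
    and Xs: "\<And>i. i \<le> b \<Longrightarrow> subring (Xs i) K" "\<And>i. i \<le> b \<Longrightarrow> V \<subseteq> Xs i" "\<And>i. i \<le> b \<Longrightarrow> Xs i \<subseteq> W"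
      "\<And>i. i < b \<Longrightarrow> Xs (Suc i) \<subset> Xs i"
    and I: "\<And>i. i \<in> I \<Longrightarrow> i < b \<and> A \<inter> Xs (Suc i) = A \<inter> Xs i"
    and x: "\<And>i. i \<in> I \<Longrightarrow> x i \<in> nonunits K (Xs (Suc i))" "\<And>i. i \<in> I \<Longrightarrow> x i \<in> Xs i - nonunits K (Xs i)"
begin

lemma Xs_val: assumes "i \<le> b" shows "val_ring K L (Xs i)" "Xs i \<subseteq> L"
proof -
  show "Xs i \<subseteq> L" using Xs(3)[OF assms] val_ringD(2)[OF W] by blast
  then show "val_ring K L (Xs i)" using val_ring_over(1)[OF L V(1) Xs(1,2)[OF assms]] by blast
qed

lemma Xs_anti: "i \<le> j \<Longrightarrow> j \<le> b \<Longrightarrow> Xs j \<subseteq> Xs i"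
proof (induction j)
  case (Suc j)
  then show ?case using Xs(4)[of j] by (cases "i = Suc j") auto
qed simp

lemma x_unit_above: assumes "j \<in> I" "i \<le> j" shows "x j \<in> Xs i - nonunits K (Xs i)"
proof -
  have j: "j \<le> b" using I[OF assms(1)] by simp
  have i: "i \<le> b" using j assms(2) by simp
  show ?thesis
    by (rule unit_over[OF L Xs_val(1)[OF j] Xs(1)[OF i] Xs_anti[OF assms(2) j] Xs_val(2)[OF i] x(2)[OF assms(1)]])
qed

text \<open>The monomials differ first at the pivot \<open>x i\<close>.  After cancelling the common part \<open>g\<close>, the monomial \<open>h\<close>
contains \<open>x i\<close> and is a nonunit of the ring \<open>Xs (Suc i)\<close>, while \<open>h'\<close> involves only later pivots and is a
unit there; all of them are units of \<open>Xs i\<close>.  If the terms were associate in \<open>V\<close>, the quotient of the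
coefficients would, up to a unit, be the quotient of these monomials: an element of \<open>A\<close> in \<open>Xs i\<close> but not in
\<open>Xs (Suc i)\<close>, although this step collapses on \<open>A\<close>.\<close>

lemma not_associate_aux:
  assumes e: "e \<in> exps (x ` I)" and f: "f \<in> exps (x ` I)" and i: "i \<in> I" and gt: "f (x i) < e (x i)"
    and below: "\<And>j. j \<in> I \<Longrightarrow> j < i \<Longrightarrow> e (x j) = f (x j)"
    and c: "c \<in> A" "c \<notin> nonunits K W" and d: "d \<in> A" "d \<notin> nonunits K W"
    and u: "u = c \<otimes> pprod K e" and w: "w = d \<otimes> pprod K f" and nz: "u \<noteq> \<zero>" "w \<noteq> \<zero>"
    and uw: "u \<otimes> inv w \<in> V" and wu: "w \<otimes> inv u \<in> V"
  shows False
proof -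
  note W' = val_ringD[OF W] and A' = residue_fieldD[OF A]
  have ib: "i \<le> b" "Suc i \<le> b" using I[OF i] by auto
  \<comment> \<open>the common part of the two monomials: they agree at the earlier pivots, and \<open>f\<close> has the smaller exponent at \<open>x i\<close>\<close>
  define g where "g = (\<lambda>y. if y = x i then f y else if y \<in> x ` {j \<in> I. j < i} then e y else 0)"
  define h h' where "h = (\<lambda>y. e y - g y)" and "h' = (\<lambda>y. f y - g y)"
  have eg: "e = (\<lambda>y. g y + h y)" and fg: "f = (\<lambda>y. g y + h' y)"
    unfolding h_def h'_def g_def using gt below by (auto simp: fun_eq_iff)
  have xW: "x ` I \<subseteq> W"
  proof
    fix y assume "y \<in> x ` I"
    then obtain j where "j \<in> I" "y = x j" by blast
    then show "y \<in> W" using x(2)[of j] I[of j] Xs(3)[of j] by auto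
  qed
  have carr: "x ` I \<subseteq> carrier K" using xW subringE(1)[OF W'(1)] by blast
  have sg: "supp g \<subseteq> supp e \<union> supp f" unfolding supp_def g_def by auto
  have sh: "supp h \<subseteq> supp e" "supp h' \<subseteq> supp f" unfolding supp_def h_def h'_def by auto
  have ex: "g \<in> exps (carrier K)" "h \<in> exps (carrier K)" "h' \<in> exps (carrier K)"
  proof -
    have fe: "finite (supp e)" "finite (supp f)" "supp e \<subseteq> carrier K" "supp f \<subseteq> carrier K"
      using e f carr unfolding exps_def by blast+
    then show "g \<in> exps (carrier K)" "h \<in> exps (carrier K)" "h' \<in> exps (carrier K)"
      using sg sh finite_subset[OF sg] finite_subset[OF sh(1)] finite_subset[OF sh(2)]
      unfolding exps_def by blast+
  qed
  have h: "y \<in> x ` {j \<in> I. i \<le> j}" if y: "y \<in> supp h" for y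
  proof -
    have "y \<in> x ` I" using sh(1) y e unfolding exps_def by blast
    then obtain j where j: "j \<in> I" "y = x j" by blast
    show ?thesis
    proof (cases "i \<le> j")
      case False
      then have "x j \<noteq> x i" using below[of j] gt j(1) by auto
      then have "g y = e y" unfolding g_def using j False by auto
      then have "h y = 0" unfolding h_def by simp
      then show ?thesis using y unfolding supp_def by simp
    qed (use j in blast)
  qed
  have h': "y \<in> x ` {j \<in> I. Suc i \<le> j}" if y: "y \<in> supp h'" for y
  proof -
    have "y \<in> x ` I" using sh(2) y f unfolding exps_def by blast
    then obtain j where j: "j \<in> I" "y = x j" by blast
    have yi: "y \<noteq> x i" using y unfolding supp_def h'_def g_def by auto
    show ?thesis
    proof (cases "Suc i \<le> j")
      case False
      then have "j < i" using yi j by (cases "i = j") auto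
      then have "h' y = 0" unfolding h'_def g_def using j yi below[of j] by auto
      then show ?thesis using y unfolding supp_def by simp
    qed (use j in blast)
  qed
  have hi: "h (x i) \<noteq> 0" unfolding h_def g_def using gt by simp
  have m1: "pprod K h' \<in> Xs (Suc i) - nonunits K (Xs (Suc i))"
    by (rule pprod_unit[OF L Xs_val(1)[OF ib(2)]]) (use h' x_unit_above in blast)
  have m2: "pprod K h \<in> Xs i - nonunits K (Xs i)"
    by (rule pprod_unit[OF L Xs_val(1)[OF ib(1)]]) (use h x_unit_above in blast)
  have "supp h \<subseteq> Xs (Suc i)"
  proof
    fix y assume "y \<in> supp h"
    then obtain j where j: "j \<in> I" "i \<le> j" "y = x j" using h by blast
    show "y \<in> Xs (Suc i)"
      using j x(1)[OF i] x_unit_above[of j "Suc i"] unfolding nonunits_def by (cases "j = i") auto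
  qed
  then have he: "h \<in> exps (Xs (Suc i))" using ex(2) unfolding exps_def by blast
  have m3: "pprod K h \<in> nonunits K (Xs (Suc i))"
    by (rule pprod_nonunit[OF L Xs_val(1)[OF ib(2)] he x(1)[OF i]]) (rule hi)
  have pe: "pprod K e = pprod K g \<otimes> pprod K h" "pprod K f = pprod K g \<otimes> pprod K h'"
    using pprod_add[OF ex(1,2)] pprod_add[OF ex(1,3)] eg fg by auto
  have ac: "a \<in> A \<Longrightarrow> a \<in> carrier K" for a using subring_carrier[OF A'(1)] .
  have pc: "pprod K g \<in> carrier K" "pprod K h \<in> carrier K" "pprod K h' \<in> carrier K"
    using ex pprod_carrier unfolding exps_def by auto
  have cd: "c \<in> carrier K" "d \<in> carrier K" using ac c d by auto
  have uwc: "u \<in> carrier K" "w \<in> carrier K" unfolding u w pe using cd pc by auto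
  define q where "q = u \<otimes> inv w"
  have qV: "q \<in> V" using uw q_def by simp
  have qc: "q \<in> carrier K" unfolding q_def using uwc nz by simp
  have qnz: "q \<noteq> \<zero>" unfolding q_def using uwc nz by simp
  have "inv q = w \<otimes> inv u" unfolding q_def using uwc nz by (simp add: inv_mult_nz m_comm)
  then have qu: "q \<in> V - nonunits K V" using qV qnz wu unfolding nonunits_def by auto
  have "pprod K g \<otimes> (q \<otimes> (d \<otimes> pprod K h')) = q \<otimes> w" unfolding w pe using qc cd pc by (simp add: m_ac)
  also have "\<dots> = u" unfolding q_def using uwc nz by simp
  also have "\<dots> = pprod K g \<otimes> (c \<otimes> pprod K h)" unfolding u pe using cd pc by (simp add: m_ac)
  finally have geq: "pprod K g \<otimes> (q \<otimes> (d \<otimes> pprod K h')) = pprod K g \<otimes> (c \<otimes> pprod K h)" .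
  have "pprod K g \<noteq> \<zero>" using nz(1) cd pc unfolding u pe by auto
  then have eq: "q \<otimes> (d \<otimes> pprod K h') = c \<otimes> pprod K h"
    using geq m_lcancel[of "pprod K g" "q \<otimes> (d \<otimes> pprod K h')" "c \<otimes> pprod K h"] qc cd pc by auto
  \<comment> \<open>the quotient \<open>c / d\<close> of the coefficients is represented in \<open>A\<close> by \<open>c \<otimes> d'\<close>\<close>
  obtain d' where d': "d' \<in> A" "d \<otimes> d' \<ominus> \<one> \<in> nonunits K W" using A'(3)[OF d] by blast
  define n where "n = d \<otimes> d' \<ominus> \<one>"
  have d'c: "d' \<in> carrier K" using ac d' by blast
  have dd: "d \<otimes> d' = \<one> \<oplus> n" unfolding n_def using cd d'c by algebra
  have nY: "n \<in> nonunits K (Xs (Suc i))"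
    using val_ring_over(2)[OF L Xs_val(1)[OF ib(2)] W'(1) Xs(3)[OF ib(2)] W'(2)] d'(2) unfolding n_def by blast
  define t where "t = (q \<otimes> (\<one> \<oplus> n)) \<otimes> pprod K h'"
  have tu: "t \<in> Xs (Suc i) - nonunits K (Xs (Suc i))"
    unfolding t_def
    by (intro units_mult[OF L Xs_val(1)[OF ib(2)]] m1 unit_plus_nonunit[OF L Xs_val(1)[OF ib(2)] nY]
        unit_over[OF L V(1) Xs(1)[OF ib(2)] Xs(2)[OF ib(2)] Xs_val(2)[OF ib(2)] qu])
  define a where "a = c \<otimes> d'"
  have aA: "a \<in> A" unfolding a_def using subringE(6)[OF A'(1) c(1) d'(1)] .
  have a_c: "a \<in> carrier K" using ac aA by blast
  have "a \<otimes> pprod K h = (c \<otimes> pprod K h) \<otimes> d'" unfolding a_def using cd d'c pc by (simp add: m_ac)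
  also have "\<dots> = (q \<otimes> (d \<otimes> d')) \<otimes> pprod K h'" unfolding eq[symmetric] using cd d'c pc qc by (simp add: m_ac)
  also have "\<dots> = t" unfolding t_def dd ..
  finally have at: "a \<otimes> pprod K h = t" .
  have nzh: "pprod K h \<noteq> \<zero>" "inv (pprod K h) \<in> Xs i"
    using val_ring_unitD[OF Xs_val(1)[OF ib(1)], of "pprod K h"] m2 by auto
  have "a = t \<otimes> inv (pprod K h)" unfolding at[symmetric] using a_c pc nzh by simp
  moreover have "t \<in> Xs i" using tu Xs_anti[of i "Suc i"] ib by auto
  ultimately have "a \<in> Xs i" using subringE(6)[OF Xs(1)[OF ib(1)]] nzh by simp
  then have "a \<in> Xs (Suc i)" using aA I[OF i] by blast
  then have "a \<otimes> pprod K h \<in> nonunits K (Xs (Suc i))"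
    using ideal_inD(4)[OF prime_inD(1)[OF nonunits_prime[OF L Xs_val(1)[OF ib(2)]]] _ m3] by blast
  then show False using tu at by blast
qed

text \<open>The terms with unit coefficients have pairwise different values, so their sum is associate to one of them
and is a unit of \<open>W\<close>; the other terms cannot cancel it modulo the nonunits of \<open>W\<close>.\<close>

lemma pivots_independent: "res_indep K W A (x ` I)"
  unfolding res_indep_def
proof (intro allI impI ballI)
  note W' = val_ringD[OF W] and A' = residue_fieldD[OF A] and V' = val_ringD[OF V(1)]
  note pW = nonunits_prime[OF L W]
  note idW = prime_inD(1)[OF pW]
  fix E c e0
  assume as: "finite E \<and> E \<subseteq> exps (x ` I) \<and> c \<in> E \<rightarrow> A \<and>
      (\<Oplus>e\<in>E. c e \<otimes> pprod K e) \<in> nonunits K W" and e0: "e0 \<in> E"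
  show "c e0 \<in> nonunits K W"
  proof (rule ccontr)
    assume no: "c e0 \<notin> nonunits K W"
    define E' where "E' = {e \<in> E. c e \<notin> nonunits K W}"
    define u where "u = (\<lambda>e. c e \<otimes> pprod K e)"
    have E: "finite E" "E \<subseteq> exps (x ` I)" "\<And>e. e \<in> E \<Longrightarrow> c e \<in> A" using as by auto
    have mu: "pprod K e \<in> W - nonunits K W" if eE: "e \<in> E" for e
    proof (rule pprod_unit[OF L W])
      show "supp e \<subseteq> W - nonunits K W"
      proof
        fix y assume "y \<in> supp e"
        then obtain j where j: "j \<in> I" "y = x j" using E(2) eE unfolding exps_def by blast
        have jb: "j \<le> b" using I[OF j(1)] by simp
        show "y \<in> W - nonunits K W"
          unfolding j(2) by (rule unit_over[OF L Xs_val(1)[OF jb] W'(1) Xs(3)[OF jb] W'(2) x(2)[OF j(1)]])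
      qed
    qed
    have uW: "u e \<in> W" if "e \<in> E" for e
      unfolding u_def using mu[OF that] E(3)[OF that] A'(2) subringE(6)[OF W'(1)] by blast
    have uc: "u e \<in> carrier K" if "e \<in> E" for e using uW[OF that] subring_carrier[OF W'(1)] by blast
    have uu: "u e \<in> W - nonunits K W" if "e \<in> E'" for e
      unfolding u_def using units_mult[OF L W _ mu] that E(3) A'(2) unfolding E'_def by blast
    have un: "u e \<in> nonunits K W" if "e \<in> E - E'" for e
      unfolding u_def using ideal_in_r[OF W'(1) idW] mu[of e] that unfolding E'_def by blast
    have unz: "u e \<noteq> \<zero>" if "e \<in> E'" for e using uu[OF that] ideal_inD(2)[OF idW] by auto
    have "\<exists>e\<in>E'. \<exists>v\<in>V - nonunits K V. finsum K u E' = u e \<otimes> v"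
    proof (rule sum_of_nonassociates[OF L V(1)])
      show "finite E'" "E' \<noteq> {}" using E(1) e0 no unfolding E'_def by auto
      show "u e \<in> L" "u e \<noteq> \<zero>" if "e \<in> E'" for e using unz[OF that] uW W'(2) that unfolding E'_def by auto
      fix e f assume ef: "e \<in> E'" "f \<in> E'" "e \<noteq> f" "u e \<otimes> inv (u f) \<in> V"
      have eE: "e \<in> exps (x ` I)" "f \<in> exps (x ` I)" using ef E(2) unfolding E'_def by auto
      have cs: "c e \<in> A" "c e \<notin> nonunits K W" "c f \<in> A" "c f \<notin> nonunits K W"
        using ef E(3) unfolding E'_def by auto
      show "u f \<otimes> inv (u e) \<notin> V"
      proof
        assume fe: "u f \<otimes> inv (u e) \<in> V"
        have "\<exists>i. i \<in> I \<and> e (x i) \<noteq> f (x i)"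
        proof (rule ccontr)
          assume c: "\<not> (\<exists>i. i \<in> I \<and> e (x i) \<noteq> f (x i))"
          have "e y = f y" for y
          proof (cases "y \<in> x ` I")
            case False
            then have "y \<notin> supp e" "y \<notin> supp f" using eE unfolding exps_def by auto
            then show ?thesis unfolding supp_def by simp
          qed (use c in blast)
          then show False using ef(3) by blast
        qed
        then obtain i where i: "i \<in> I" "e (x i) \<noteq> f (x i)" and
          m: "\<And>j. j < i \<Longrightarrow> \<not> (j \<in> I \<and> e (x j) \<noteq> f (x j))"
          using exists_least_iff[of "\<lambda>i. i \<in> I \<and> e (x i) \<noteq> f (x i)"] by blast
        have me: "\<And>j. j \<in> I \<Longrightarrow> j < i \<Longrightarrow> e (x j) = f (x j)" using m by blast
        show False
        proof (cases "f (x i) < e (x i)")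
          case True
          show False
            by (rule not_associate_aux[OF eE(1) eE(2) i(1) True me cs(1) cs(2) cs(3) cs(4), of "u e" "u f"])
              (use ef fe unz in \<open>auto simp: u_def\<close>)
        next
          case False
          then have lt: "e (x i) < f (x i)" using i(2) by simp
          show False
            by (rule not_associate_aux[OF eE(2) eE(1) i(1) lt me[symmetric] cs(3) cs(4) cs(1) cs(2), of "u f" "u e"])
              (use ef fe unz in \<open>auto simp: u_def\<close>)
        qed
      qed
    qed
    then obtain e v where ev: "e \<in> E'" "v \<in> V - nonunits K V" "finsum K u E' = u e \<otimes> v" by blast
    have "v \<in> W - nonunits K W" using unit_over[OF L V(1) W'(1) V(2) W'(2) ev(2)] .
    then have s1: "finsum K u E' \<notin> nonunits K W" using units_mult[OF L W uu[OF ev(1)]] ev(3) by simp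
    have E'E: "E' \<subseteq> E" unfolding E'_def by blast
    have cl: "finsum K u E' \<in> carrier K" by (rule finsum_closed) (use uc E'E in blast)
    have r: "finsum K u (E - E') \<in> nonunits K W" by (rule finsum_mem[OF W'(1) idW un])
    have rc: "finsum K u (E - E') \<in> carrier K" by (rule finsum_closed) (use uc in blast)
    have "finsum K u (E' \<union> (E - E')) = finsum K u E' \<oplus> finsum K u (E - E')"
      by (rule finsum_Un_disjoint) (use E(1) uc E'E finite_subset[OF E'E] in auto)
    moreover have "E' \<union> (E - E') = E" using E'E by blast
    ultimately have "finsum K u E = finsum K u E' \<oplus> finsum K u (E - E')" by simp
    then have "finsum K u E' = finsum K u E \<ominus> finsum K u (E - E')" using cl rc by algebra
    moreover have "finsum K u E \<in> nonunits K W" using as unfolding u_def by blast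
    ultimately show False using s1 ideal_in_minus[OF W'(1) idW _ r] by simp
  qed
qed

end

text \<open>Each step of the chain either remains strict after intersection with \<open>A\<close>, or yields a pivot; the pivots are
independent over \<open>A\<close>.  This is the inequality between the rank of a valuation ring, the rank of its restriction to a
subfield and the transcendence degree over that subfield, relative to the residue field of \<open>W\<close>.\<close>

theorem rank_inequality:
  assumes L: "subfield L K" and W: "val_ring K L W" and V: "val_ring K L V" "V \<subseteq> W"
    and A: "residue_field W A" and ch: "ring_chain K W V b"
  obtains S s where "finite S" "S \<subseteq> W" "res_indep K W A S" "b = card S + s" "ring_chain K A (A \<inter> V) s"
proof -
  note A' = residue_fieldD[OF A]
  obtain Xs where Xs: "\<And>i. i \<le> b \<Longrightarrow> subring (Xs i) K" "\<And>i. i \<le> b \<Longrightarrow> V \<subseteq> Xs i" "\<And>i. i \<le> b \<Longrightarrow> Xs i \<subseteq> W"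
      "\<And>i. i < b \<Longrightarrow> Xs (Suc i) \<subset> Xs i" by (rule ring_chainE[OF ch]) blast
  define I where "I = {i. i < b \<and> A \<inter> Xs (Suc i) = A \<inter> Xs i}"
  have I: "i \<in> I \<Longrightarrow> i < b \<and> A \<inter> Xs (Suc i) = A \<inter> Xs i" for i unfolding I_def by blast
  have XL: "Xs i \<subseteq> L" "val_ring K L (Xs i)" if "i \<le> b" for i
  proof -
    show "Xs i \<subseteq> L" using Xs(3)[OF that] val_ringD(2)[OF W] by blast
    then show "val_ring K L (Xs i)" using val_ring_over(1)[OF L V(1) Xs(1,2)[OF that]] by blast
  qed
  have "\<exists>x. x \<in> nonunits K (Xs (Suc i)) \<and> x \<in> Xs i - nonunits K (Xs i)" if i: "i < b" for i
  proof -
    obtain y where y: "y \<in> Xs i" "y \<notin> Xs (Suc i)" using Xs(4)[OF i] by blast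
    have le: "i \<le> b" "Suc i \<le> b" using i by auto
    have yL: "y \<in> L" using y XL(1)[OF le(1)] by blast
    have n: "y \<noteq> \<zero>" "inv y \<in> nonunits K (Xs (Suc i))" using not_in_val_ring[OF L XL(2)[OF le(2)] yL y(2)] .
    have yc: "y \<in> carrier K" using subring_carrier[OF subfieldE(1)[OF L] yL] .
    have "inv y \<in> Xs i" using n(2) Xs(4)[OF i] unfolding nonunits_def by blast
    moreover have "inv y \<notin> nonunits K (Xs i)" using y(1) yc n(1) unfolding nonunits_def by auto
    ultimately show ?thesis using n(2) by blast
  qed
  then obtain x where x: "\<And>i. i < b \<Longrightarrow> x i \<in> nonunits K (Xs (Suc i)) \<and> x i \<in> Xs i - nonunits K (Xs i)"
    by metis
  have x1: "i \<in> I \<Longrightarrow> x i \<in> nonunits K (Xs (Suc i))" and x2: "i \<in> I \<Longrightarrow> x i \<in> Xs i - nonunits K (Xs i)" for i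
    using x I by blast+
  have ind: "res_indep K W A (x ` I)"
    by (rule pivots_independent[OF L W V A Xs I x1 x2])
  have inj: "inj_on x I"
  proof (rule inj_onI)
    have *: False if ij: "i \<in> I" "j \<in> I" "x i = x j" "i < j" for i j
    proof -
      have jb: "j \<le> b" "Suc i \<le> b" using I[OF ij(2)] ij(4) by auto
      have "x j \<in> Xs (Suc i) - nonunits K (Xs (Suc i))"
        using x_unit_above[OF L W V A Xs I x1 x2 ij(2), of "Suc i"] ij(4) by simp
      then show False using x1[OF ij(1)] ij(3) by simp
    qed
    fix i j assume "i \<in> I" "j \<in> I" "x i = x j"
    then show "i = j" using *[of i j] *[of j i] by (cases i j rule: linorder_cases) auto
  qed
  define N where "N = {i. i < b \<and> A \<inter> Xs (Suc i) \<noteq> A \<inter> Xs i}"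
  have c: "ring_chain K A (A \<inter> Xs b) (card N)"
    unfolding N_def
  proof (rule ring_chain_of_steps[of b "\<lambda>i. A \<inter> Xs i"])
    fix i assume "i \<le> b"
    then have Xi: "subring (Xs i) K" using Xs(1) by blast
    show "subring (A \<inter> Xs i) K"
      using subringE[OF A'(1)] subringE[OF Xi] by (intro subringI) auto
  qed (use Xs(4) in auto)
  have fin: "finite I" "finite N" unfolding I_def N_def by auto
  have "I \<union> N = {..<b}" "I \<inter> N = {}" unfolding I_def N_def by auto
  then have "card I + card N = b" using card_Un_disjoint[OF fin] by simp
  then have card: "b = card (x ` I) + card N" using card_image[OF inj] by simp
  have "x ` I \<subseteq> W"
  proof
    fix y assume "y \<in> x ` I"
    then obtain j where "j \<in> I" "y = x j" by blast
    then show "y \<in> W" using x2[of j] I[of j] Xs(3)[of j] by auto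
  qed
  moreover have "ring_chain K A (A \<inter> V) (card N)"
    using ring_chain_mono[OF c subset_refl _ le_refl] Xs(2)[of b] by blast
  ultimately show thesis using that[OF finite_imageI[OF fin(1)] _ ind card] by blast
qed

section \<open>Composite valuation rings\<close>

definition set_prod :: "'a set \<Rightarrow> 'a set \<Rightarrow> 'a set" where
  "set_prod V Z = {v \<otimes> z | v z. v \<in> V \<and> z \<in> Z}"

text \<open>Sums of products are again products, since one of the quotients of the two factors from \<open>Z\<close> lies in \<open>V\<close>.\<close>

lemma set_prod_subring:
  assumes L: "subfield L K" and V: "val_ring K L V" and Z: "subring Z K" "Z \<subseteq> L"
  shows "subring (set_prod V Z) K" "V \<subseteq> set_prod V Z" "Z \<subseteq> set_prod V Z"
proof -
  note V' = val_ringD[OF V]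
  have sc: "v \<in> V \<Longrightarrow> v \<in> carrier K" "z \<in> Z \<Longrightarrow> z \<in> carrier K" for v z
    using subring_carrier[OF V'(1)] subring_carrier[OF Z(1)] by auto
  have one: "\<one> \<in> V" "\<one> \<in> Z" using subringE(3)[OF V'(1)] subringE(3)[OF Z(1)] .
  show VV: "V \<subseteq> set_prod V Z"
  proof
    fix v assume "v \<in> V"
    moreover have "v = v \<otimes> \<one>" using sc \<open>v \<in> V\<close> by simp
    ultimately show "v \<in> set_prod V Z" unfolding set_prod_def using one by blast
  qed
  show "Z \<subseteq> set_prod V Z"
  proof
    fix z assume "z \<in> Z"
    moreover have "z = \<one> \<otimes> z" using sc \<open>z \<in> Z\<close> by simp
    ultimately show "z \<in> set_prod V Z" unfolding set_prod_def using one by blast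
  qed
  have mult: "p \<otimes> q \<in> set_prod V Z" if pq: "p \<in> set_prod V Z" "q \<in> set_prod V Z" for p q
  proof -
    obtain v y w z where *: "p = v \<otimes> y" "q = w \<otimes> z" "v \<in> V" "y \<in> Z" "w \<in> V" "z \<in> Z"
      using pq unfolding set_prod_def by blast
    have "p \<otimes> q = (v \<otimes> w) \<otimes> (y \<otimes> z)" using * sc by (simp add: m_ac)
    moreover have "v \<otimes> w \<in> V" "y \<otimes> z \<in> Z" using * subringE(6)[OF V'(1)] subringE(6)[OF Z(1)] by auto
    ultimately show ?thesis unfolding set_prod_def by blast
  qed
  have add: "v \<otimes> y \<oplus> w \<otimes> z \<in> set_prod V Z"
    if *: "v \<in> V" "y \<in> Z" "w \<in> V" "z \<in> Z" "z \<noteq> \<zero>" "y \<otimes> inv z \<in> V" for v y w z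
  proof -
    have c: "v \<in> carrier K" "y \<in> carrier K" "w \<in> carrier K" "z \<in> carrier K" "inv z \<in> carrier K" using * sc by auto
    have "(v \<otimes> (y \<otimes> inv z) \<oplus> w) \<otimes> z = v \<otimes> (y \<otimes> inv z \<otimes> z) \<oplus> w \<otimes> z"
      using c by (simp only: l_distr m_assoc m_closed)
    then have "v \<otimes> y \<oplus> w \<otimes> z = (v \<otimes> (y \<otimes> inv z) \<oplus> w) \<otimes> z" using c *(5) by simp
    moreover have "v \<otimes> (y \<otimes> inv z) \<oplus> w \<in> V" using * subringE(6,7)[OF V'(1)] by simp
    ultimately show ?thesis unfolding set_prod_def using *(4) by blast
  qed
  show "subring (set_prod V Z) K"
  proof (rule subringI)
    show carr: "set_prod V Z \<subseteq> carrier K" unfolding set_prod_def using sc by auto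
    show "\<one> \<in> set_prod V Z" using VV one by blast
    fix p q assume p: "p \<in> set_prod V Z" and q: "q \<in> set_prod V Z"
    show "p \<otimes> q \<in> set_prod V Z" using mult[OF p q] .
    have "\<ominus> \<one> \<in> set_prod V Z" using VV subringE(5)[OF V'(1) one(1)] by blast
    then have "(\<ominus> \<one>) \<otimes> p \<in> set_prod V Z" using mult p by blast
    then show "\<ominus> p \<in> set_prod V Z" using carr p by (auto simp: l_minus)
    obtain v y w z where *: "p = v \<otimes> y" "q = w \<otimes> z" "v \<in> V" "y \<in> Z" "w \<in> V" "z \<in> Z"
      using p q unfolding set_prod_def by blast
    have c: "v \<in> carrier K" "y \<in> carrier K" "w \<in> carrier K" "z \<in> carrier K" using * sc by auto
    consider "z = \<zero>" | "y = \<zero>" | "y \<noteq> \<zero>" "z \<noteq> \<zero>" by blast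
    then show "p \<oplus> q \<in> set_prod V Z"
    proof cases
      case 1
      then have "p \<oplus> q = p" using * c by simp
      then show ?thesis using p by simp
    next
      case 2
      then have "p \<oplus> q = q" using * c by simp
      then show ?thesis using q by simp
    next
      case 3
      have "y \<otimes> inv z \<in> L"
        using 3 * Z(2) subfield_inv[OF L] subringE(6)[OF subfieldE(1)[OF L]] by blast
      then have "y \<otimes> inv z \<in> V \<or> inv (y \<otimes> inv z) \<in> V" using V'(3)[of "y \<otimes> inv z"] 3 c by simp
      moreover have "inv (y \<otimes> inv z) = z \<otimes> inv y" using 3 c by (simp add: inv_mult_nz m_comm)
      ultimately consider "y \<otimes> inv z \<in> V" | "z \<otimes> inv y \<in> V" by auto
      then show ?thesis
      proof cases
        case 1 then show ?thesis using add[of v y w z] * 3 by simp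
      next
        case 2 then show ?thesis using add[of w z v y] * 3 c by (simp add: a_comm)
      qed
    qed
  qed
qed

lemma set_prod_subset:
  assumes "subring W K" "V \<subseteq> W" "Z \<subseteq> W" shows "set_prod V Z \<subseteq> W"
  unfolding set_prod_def using assms(2,3) subringE(6)[OF assms(1)] by blast

text \<open>A ring \<open>Z\<close> between \<open>A \<inter> V\<close> and \<open>A\<close> is recovered from the ring \<open>V Z\<close> by intersecting with \<open>A\<close>.  Indeed,
if \<open>a = v z\<close> and \<open>z\<close> is a unit of \<open>W\<close>, then multiplying by an inverse of \<open>z\<close> modulo the nonunits of \<open>W\<close>
moves \<open>a\<close> into \<open>V\<close>, because \<open>V\<close> contains these nonunits.\<close>

theorem lift_ring_chain:
  assumes L: "subfield L K" and W: "val_ring K L W" and V: "val_ring K L V" "V \<subseteq> W"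
    and A: "residue_field W A" and ch: "ring_chain K A (A \<inter> V) n"
  shows "ring_chain K W V n"
proof -
  note W' = val_ringD[OF W] and A' = residue_fieldD[OF A] and V' = val_ringD[OF V(1)]
  have idW: "ideal_in K W (nonunits K W)" using prime_inD(1)[OF nonunits_prime[OF L W]] .
  have nWV: "nonunits K W \<subseteq> V" using val_ring_over(2)[OF L V(1) W'(1) V(2) W'(2)] unfolding nonunits_def by blast
  obtain Zs where Zs: "\<And>i. i \<le> n \<Longrightarrow> subring (Zs i) K" "\<And>i. i \<le> n \<Longrightarrow> A \<inter> V \<subseteq> Zs i" "\<And>i. i \<le> n \<Longrightarrow> Zs i \<subseteq> A"
      "\<And>i. i < n \<Longrightarrow> Zs (Suc i) \<subset> Zs i" by (rule ring_chainE[OF ch]) blast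
  have ZL: "Zs i \<subseteq> L" if "i \<le> n" for i using Zs(3)[OF that] A'(2) W'(2) by blast
  have contr: "set_prod V (Zs i) \<inter> A = Zs i" if i: "i \<le> n" for i
  proof
    show "Zs i \<subseteq> set_prod V (Zs i) \<inter> A" using set_prod_subring(3)[OF L V(1) Zs(1)[OF i] ZL[OF i]] Zs(3)[OF i] by blast
    show "set_prod V (Zs i) \<inter> A \<subseteq> Zs i"
    proof
      fix a assume a: "a \<in> set_prod V (Zs i) \<inter> A"
      then obtain v z where vz: "a = v \<otimes> z" "v \<in> V" "z \<in> Zs i" unfolding set_prod_def by blast
      have zA: "z \<in> A" "z \<in> W" "a \<in> W" using vz(3) Zs(3)[OF i] a A'(2) by auto
      show "a \<in> Zs i"
      proof (cases "z \<in> nonunits K W")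
        case True
        then have "a \<in> nonunits K W" using ideal_inD(4)[OF idW] vz V(2) by blast
        then show ?thesis using nWV a Zs(2)[OF i] by blast
      next
        case False
        obtain y where y: "y \<in> A" "z \<otimes> y \<ominus> \<one> \<in> nonunits K W" using A'(3)[OF zA(1) False] by blast
        define m where "m = z \<otimes> y \<ominus> \<one>"
        have c: "a \<in> carrier K" "z \<in> carrier K" "y \<in> carrier K" "v \<in> carrier K"
          using a zA y vz subring_carrier[OF A'(1)] subring_carrier[OF V'(1)] by auto
        have mc: "m \<in> carrier K" unfolding m_def using c by simp
        have zy: "z \<otimes> y = \<one> \<oplus> m" unfolding m_def using c by algebra
        have mV: "m \<in> V" "m \<in> nonunits K W" using y nWV unfolding m_def by auto
        have "a \<otimes> y = v \<otimes> (z \<otimes> y)" unfolding vz(1) using c by (simp add: m_assoc)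
        also have "\<dots> = v \<otimes> (\<one> \<oplus> m)" unfolding zy ..
        also have "\<dots> \<in> V" using vz(2) mV subringE(3,6,7)[OF V'(1)] by simp
        finally have "a \<otimes> y \<in> A \<inter> V" using subringE(6)[OF A'(1)] a y by blast
        then have ay: "a \<otimes> y \<in> Zs i" using Zs(2)[OF i] by blast
        have mA: "m \<in> A" unfolding m_def
          using subring_minus[OF A'(1) subringE(6)[OF A'(1) zA(1) y(1)] subringE(3)[OF A'(1)]] .
        have "a \<otimes> m \<in> nonunits K W" using ideal_inD(4)[OF idW zA(3) mV(2)] .
        then have "a \<otimes> m \<in> A \<inter> V" using nWV subringE(6)[OF A'(1)] a mA by blast
        then have am: "a \<otimes> m \<in> Zs i" using Zs(2)[OF i] by blast
        have "a = a \<otimes> (z \<otimes> y) \<ominus> a \<otimes> m" unfolding zy using c mc by algebra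
        also have "a \<otimes> (z \<otimes> y) = a \<otimes> y \<otimes> z" using c by (simp add: m_ac)
        finally show ?thesis
          using subring_minus[OF Zs(1)[OF i] subringE(6)[OF Zs(1)[OF i] ay vz(3)] am] by simp
      qed
    qed
  qed
  show ?thesis
  proof (rule ring_chainI[of _ "\<lambda>i. set_prod V (Zs i)"])
    fix i assume i: "i \<le> n"
    show "subring (set_prod V (Zs i)) K" "V \<subseteq> set_prod V (Zs i)"
      using set_prod_subring(1,2)[OF L V(1) Zs(1)[OF i] ZL[OF i]] .
    show "set_prod V (Zs i) \<subseteq> W" using set_prod_subset[OF W'(1) V(2)] Zs(3)[OF i] A'(2) by blast
  next
    fix i assume i: "i < n"
    have "set_prod V (Zs (Suc i)) \<subseteq> set_prod V (Zs i)" unfolding set_prod_def using Zs(4)[OF i] by blast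
    moreover have "set_prod V (Zs (Suc i)) \<noteq> set_prod V (Zs i)"
      using contr[of i] contr[of "Suc i"] Zs(4)[OF i] i by auto
    ultimately show "set_prod V (Zs (Suc i)) \<subset> set_prod V (Zs i)" by blast
  qed
qed

end

section \<open>Quotient fields and Glaz-Vasconcelos ideals\<close>

lemma enat_le_SUP_downset:
  assumes "0 \<in> S" "\<And>m n. m \<in> S \<Longrightarrow> n \<le> m \<Longrightarrow> n \<in> S"
  shows "enat n \<le> (SUP n\<in>S. enat n) \<longleftrightarrow> n \<in> S"
proof -
  have "S \<noteq> {}" using assms(1) by blast
  then have "enat n \<le> (SUP n\<in>S. enat n) \<longleftrightarrow> (\<exists>m\<in>S. n \<le> m)" using enat_le_SUP_iff[of S n enat] by simp
  then show ?thesis using assms(2) by blast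
qed

context ambient_field
begin

lemma qf_subfield:
  assumes B: "subring B K" shows "subfield (qf K B) K"
proof (rule subfieldI')
  show "subring (qf K B) K" unfolding qf_eq_fracs by (rule fracs_subring[OF B mult_set_nonzero[OF B]])
  fix x assume x: "x \<in> qf K B - {\<zero>}"
  then obtain a b where ab: "x = a \<otimes> inv b" "a \<in> B" "b \<in> B" "b \<noteq> \<zero>" unfolding qf_def by blast
  have c: "a \<in> carrier K" "b \<in> carrier K" using ab subring_carrier[OF B] by auto
  have a: "a \<noteq> \<zero>" using x ab c by auto
  have "inv x = b \<otimes> inv a" unfolding ab(1) using c a ab(4) by (simp add: inv_mult_nz m_comm)
  then show "inv x \<in> qf K B" unfolding qf_def using ab a by blast
qed

lemma qf_incl: "subring B K \<Longrightarrow> B \<subseteq> qf K B"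
  unfolding qf_eq_fracs
  by (rule fracs_incl[OF subringE(1)]) (auto dest: subringE(3))

lemma qf_least: "subfield L K \<Longrightarrow> B \<subseteq> L \<Longrightarrow> qf K B \<subseteq> L"
  unfolding qf_eq_fracs by (rule fracs_subset) auto

lemma qf_mono: "A \<subseteq> B \<Longrightarrow> qf K A \<subseteq> qf K B"
  unfolding qf_def by blast

lemma qf_between: "subring B K \<Longrightarrow> B \<subseteq> V \<Longrightarrow> V \<subseteq> qf K B \<Longrightarrow> qf K V = qf K B"
  using qf_least[OF qf_subfield] qf_mono by blast

text \<open>Generators of a Glaz-Vasconcelos ideal \<open>J\<close> of \<open>B\<close>: the last condition says that \<open>J\<^sup>-\<^sup>1\<close> is contained in \<open>B\<close>,
which is equivalent to \<open>J\<^sup>v = B\<close>.\<close>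

definition gv_list :: "'a set \<Rightarrow> 'a list \<Rightarrow> bool" where
  "gv_list B us \<longleftrightarrow> set us \<subseteq> B \<and> (\<exists>u\<in>set us. u \<noteq> \<zero>) \<and>
     (\<forall>x\<in>qf K B. (\<forall>u\<in>set us. x \<otimes> u \<in> B) \<longrightarrow> x \<in> B)"

lemma gv_listD:
  assumes "gv_list B us"
  shows "set us \<subseteq> B" "\<exists>u\<in>set us. u \<noteq> \<zero>"
    "\<And>x. x \<in> qf K B \<Longrightarrow> (\<And>u. u \<in> set us \<Longrightarrow> x \<otimes> u \<in> B) \<Longrightarrow> x \<in> B"
  using assms unfolding gv_list_def by auto

lemma Span_Cons_iff: "x \<in> Span B (u # us) \<longleftrightarrow> (\<exists>b\<in>B. \<exists>v\<in>Span B us. x = b \<otimes> u \<oplus> v)"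
  by (simp add: line_extension_mem_iff)

lemma Span_Nil: "Span B [] = {\<zero>}"
  by simp

declare Span.simps [simp del]

lemma Span_least:
  assumes N: "\<zero> \<in> N" "\<And>x y. x \<in> N \<Longrightarrow> y \<in> N \<Longrightarrow> x \<oplus> y \<in> N" "\<And>b x. b \<in> B \<Longrightarrow> x \<in> N \<Longrightarrow> b \<otimes> x \<in> N"
    and us: "set us \<subseteq> N"
  shows "Span B us \<subseteq> N"
  using us
proof (induction us)
  case (Cons u us)
  show ?case
  proof
    fix x assume "x \<in> Span B (u # us)"
    then obtain b v where "b \<in> B" "v \<in> Span B us" "x = b \<otimes> u \<oplus> v" unfolding Span_Cons_iff by blast
    then show "x \<in> N" using Cons N(2,3) by auto
  qed
qed (use N(1) in \<open>simp add: Span_Nil\<close>)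

lemma Span_ideal:
  assumes B: "subring B K" and us: "set us \<subseteq> B"
  shows "ideal_in K B (Span B us)" "set us \<subseteq> Span B us"
proof -
  have "ideal_in K B (Span B us) \<and> set us \<subseteq> Span B us"
    using us
  proof (induction us)
    case Nil
    have "\<And>b. b \<in> B \<Longrightarrow> b \<otimes> \<zero> = \<zero>" using subring_carrier[OF B] by simp
    then show ?case using subringE(2)[OF B] by (simp add: Span_Nil ideal_in_def)
  next
    case (Cons u us)
    then have IH: "ideal_in K B (Span B us)" "set us \<subseteq> Span B us" and u: "u \<in> B" by auto
    have sc: "x \<in> B \<Longrightarrow> x \<in> carrier K" for x using subring_carrier[OF B] .
    have vB: "v \<in> Span B us \<Longrightarrow> v \<in> B" for v using ideal_inD(1)[OF IH(1)] by blast
    have inc: "v \<in> Span B (u # us)" if v: "v \<in> Span B us" for v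
    proof -
      have "v = \<zero> \<otimes> u \<oplus> v" using sc[OF u] sc[OF vB[OF v]] by simp
      then show ?thesis unfolding Span_Cons_iff using subringE(2)[OF B] v by blast
    qed
    have "u = \<one> \<otimes> u \<oplus> \<zero>" using sc[OF u] by simp
    then have uin: "u \<in> Span B (u # us)"
      unfolding Span_Cons_iff using subringE(3)[OF B] ideal_inD(2)[OF IH(1)] by blast
    have "ideal_in K B (Span B (u # us))"
      unfolding ideal_in_def
    proof (intro conjI ballI)
      show "Span B (u # us) \<subseteq> B"
      proof
        fix x assume "x \<in> Span B (u # us)"
        then obtain b v where "b \<in> B" "v \<in> Span B us" "x = b \<otimes> u \<oplus> v" unfolding Span_Cons_iff by blast
        then show "x \<in> B" using vB u subringE(6,7)[OF B] by simp
      qed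
      show "\<zero> \<in> Span B (u # us)" using inc[OF ideal_inD(2)[OF IH(1)]] .
    next
      fix x y assume "x \<in> Span B (u # us)" "y \<in> Span B (u # us)"
      then obtain b v c w where *: "b \<in> B" "v \<in> Span B us" "x = b \<otimes> u \<oplus> v" "c \<in> B" "w \<in> Span B us" "y = c \<otimes> u \<oplus> w"
        unfolding Span_Cons_iff by blast
      have "x \<oplus> y = (b \<oplus> c) \<otimes> u \<oplus> (v \<oplus> w)"
        using * sc u vB by (simp add: l_distr a_ac)
      then show "x \<oplus> y \<in> Span B (u # us)"
        unfolding Span_Cons_iff using subringE(7)[OF B *(1,4)] ideal_inD(3)[OF IH(1) *(2,5)] by blast
    next
      fix d x assume d: "d \<in> B" and "x \<in> Span B (u # us)"
      then obtain b v where *: "b \<in> B" "v \<in> Span B us" "x = b \<otimes> u \<oplus> v" unfolding Span_Cons_iff by blast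
      have "d \<otimes> x = (d \<otimes> b) \<otimes> u \<oplus> d \<otimes> v"
        using * d sc u vB by (simp add: r_distr m_assoc)
      then show "d \<otimes> x \<in> Span B (u # us)"
        unfolding Span_Cons_iff using subringE(6)[OF B d *(1)] ideal_inD(4)[OF IH(1) d *(2)] by blast
    qed
    then show ?case using uin inc IH(2) by auto
  qed
  then show "ideal_in K B (Span B us)" "set us \<subseteq> Span B us" by auto
qed

lemma Span_subset_ideal:
  assumes "ideal_in K B I" "B' \<subseteq> B" "set us \<subseteq> I" shows "Span B' us \<subseteq> I"
  by (rule Span_least) (use ideal_inD[OF assms(1)] assms(2,3) in auto)

lemma mult_Span:
  assumes B: "subring B K" and us: "set us \<subseteq> carrier K" and x: "x \<in> carrier K"
    and m: "\<And>u. u \<in> set us \<Longrightarrow> x \<otimes> u \<in> B" and v: "v \<in> Span B us"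
  shows "x \<otimes> v \<in> B"
proof -
  have "Span B us \<subseteq> {y \<in> carrier K. x \<otimes> y \<in> B}"
  proof (rule Span_least)
    fix b y assume b: "b \<in> B" and y: "y \<in> {y \<in> carrier K. x \<otimes> y \<in> B}"
    have bc: "b \<in> carrier K" using subring_carrier[OF B b] .
    have "x \<otimes> (b \<otimes> y) = b \<otimes> (x \<otimes> y)" using bc y x by (simp add: m_ac)
    then show "b \<otimes> y \<in> {y \<in> carrier K. x \<otimes> y \<in> B}" using y bc subringE(6)[OF B b] by simp
  qed (use x us m subringE(2,7)[OF B] in \<open>auto simp: r_distr\<close>)
  then show ?thesis using v by blast
qed

lemma gv_list_Span:
  assumes B: "subring B K" and us: "gv_list B us"
  shows "Span B us \<in> fg_frac_ideals K B" "Span B us \<subseteq> B" "v_closure K B (Span B us) = B"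
proof -
  note g = gv_listD[OF us]
  note id = Span_ideal[OF B g(1)]
  have sc: "x \<in> B \<Longrightarrow> x \<in> carrier K" for x using subring_carrier[OF B] .
  note q = qf_subfield[OF B] qf_incl[OF B]
  have qc: "x \<in> qf K B \<Longrightarrow> x \<in> carrier K" for x using subring_carrier[OF subfieldE(1)[OF q(1)]] .
  show sub: "Span B us \<subseteq> B" using ideal_inD(1)[OF id(1)] .
  have ag: "additive_subgroup (Span B us) K"
  proof (rule additive_subgroupI, rule add.subgroupI)
    show "Span B us \<subseteq> carrier K" using sub subringE(1)[OF B] by blast
    show "Span B us \<noteq> {}" using ideal_inD(2)[OF id(1)] by blast
    show "\<ominus> a \<in> Span B us" if "a \<in> Span B us" for a using ideal_in_neg[OF B id(1) that] .
    show "a \<oplus> b \<in> Span B us" if "a \<in> Span B us" "b \<in> Span B us" for a b using ideal_inD(3)[OF id(1) that] .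
  qed
  have one: "\<one> \<in> B - {\<zero>}" using subringE(3)[OF B] by simp
  have "\<exists>c\<in>B - {\<zero>}. \<forall>x\<in>Span B us. c \<otimes> x \<in> B" by (rule bexI[OF _ one]) (use sub sc in auto)
  moreover have "Span B us \<noteq> {\<zero>}" using g(2) id(2) by auto
  ultimately have "Span B us \<in> frac_ideals K B"
    unfolding frac_ideals_def using sub q(2) ag ideal_inD(4)[OF id(1)] by simp
  then show "Span B us \<in> fg_frac_ideals K B"
    unfolding fg_frac_ideals_def using g(1) q(2) by blast
  have 1: "frac_inv K B (Span B us) = B"
  proof
    show "frac_inv K B (Span B us) \<subseteq> B"
      unfolding frac_inv_def using g(3) id(2) by blast
    show "B \<subseteq> frac_inv K B (Span B us)"
      unfolding frac_inv_def using q(2) sub subringE(6)[OF B] by blast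
  qed
  have "frac_inv K B B = B"
  proof
    show "frac_inv K B B \<subseteq> B"
    proof
      fix x assume x: "x \<in> frac_inv K B B"
      then have "x \<otimes> \<one> \<in> B" "x \<in> carrier K" using subringE(3)[OF B] qc unfolding frac_inv_def by auto
      then show "x \<in> B" by simp
    qed
    show "B \<subseteq> frac_inv K B B" unfolding frac_inv_def using q(2) subringE(6)[OF B] by blast
  qed
  then show "v_closure K B (Span B us) = B" unfolding v_closure_def 1 .
qed

lemma Span_incl:
  assumes B: "subring B K" and us: "set us \<subseteq> carrier K"
  shows "set us \<subseteq> Span B us"
proof -
  have "\<zero> \<in> Span B us \<and> Span B us \<subseteq> carrier K \<and> set us \<subseteq> Span B us"
    using us
  proof (induction us)
    case (Cons u us)
    then have IH: "\<zero> \<in> Span B us" "Span B us \<subseteq> carrier K" "set us \<subseteq> Span B us" and u: "u \<in> carrier K" by auto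
    have inc: "v \<in> Span B (u # us)" if v: "v \<in> Span B us" for v
    proof -
      have "v = \<zero> \<otimes> u \<oplus> v" using u IH(2) v by auto
      then show ?thesis unfolding Span_Cons_iff using subringE(2)[OF B] v by blast
    qed
    have "u = \<one> \<otimes> u \<oplus> \<zero>" using u by simp
    then have "u \<in> Span B (u # us)"
      unfolding Span_Cons_iff using subringE(3)[OF B] IH(1) by blast
    moreover have "Span B (u # us) \<subseteq> carrier K"
      by (rule Span_least) (use Cons.prems subring_carrier[OF B] in auto)
    ultimately show ?case using inc IH by auto
  qed (simp add: Span_Nil)
  then show ?thesis by blast
qed

lemma gv_list_of_ideal:
  assumes B: "subring B K" and J: "J \<in> fg_frac_ideals K B" "J \<subseteq> B" "v_closure K B J = B"
  obtains us where "gv_list B us" "J = Span B us" "set us \<subseteq> J"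
proof -
  note q = qf_subfield[OF B] qf_incl[OF B]
  have qc: "x \<in> qf K B \<Longrightarrow> x \<in> carrier K" for x using subring_carrier[OF subfieldE(1)[OF q(1)]] .
  obtain us where us: "set us \<subseteq> qf K B" "J = Span B us" and f: "J \<in> frac_ideals K B"
    using J(1) unfolding fg_frac_ideals_def by blast
  have usc: "set us \<subseteq> carrier K" using us(1) qc by blast
  have usJ: "set us \<subseteq> J" unfolding us(2) by (rule Span_incl[OF B usc])
  have nz: "\<exists>u\<in>set us. u \<noteq> \<zero>"
  proof (rule ccontr)
    assume "\<not> (\<exists>u\<in>set us. u \<noteq> \<zero>)"
    then have "J \<subseteq> {\<zero>}" unfolding us(2)
      by (intro Span_least) (use subring_carrier[OF B] in auto)
    moreover have "\<zero> \<in> J"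
      using f additive_subgroup.zero_closed unfolding frac_ideals_def by blast
    ultimately show False using f unfolding frac_ideals_def by blast
  qed
  have "x \<in> B" if x: "x \<in> qf K B" "\<forall>u\<in>set us. x \<otimes> u \<in> B" for x
  proof -
    have "x \<otimes> v \<in> B" if "v \<in> J" for v
      using mult_Span[OF B usc qc[OF x(1)] _ that[unfolded us(2)]] x(2) by blast
    then have xJ: "x \<in> frac_inv K B J" unfolding frac_inv_def using x(1) by blast
    have "\<one> \<in> frac_inv K B (frac_inv K B J)"
      using J(3) subringE(3)[OF B] unfolding v_closure_def by simp
    then have "\<one> \<otimes> x \<in> B" using xJ unfolding frac_inv_def by blast
    then show ?thesis using qc[OF x(1)] by simp
  qed
  then have "gv_list B us" unfolding gv_list_def using usJ J(2) nz by blast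
  then show thesis using that us(2) usJ by blast
qed

lemma w_closureI:
  assumes B: "subring B K" and us: "gv_list B us" and x: "x \<in> qf K B" and m: "\<And>j. j \<in> Span B us \<Longrightarrow> x \<otimes> j \<in> I"
  shows "x \<in> w_closure K B I"
  unfolding w_closure_def using gv_list_Span[OF B us] x m by blast

lemma w_closureE:
  assumes B: "subring B K" and x: "x \<in> w_closure K B I"
  obtains us where "gv_list B us" "x \<in> qf K B" "\<And>u. u \<in> set us \<Longrightarrow> x \<otimes> u \<in> I"
proof -
  obtain J where J: "J \<in> fg_frac_ideals K B" "J \<subseteq> B" "v_closure K B J = B" "\<forall>j\<in>J. x \<otimes> j \<in> I" "x \<in> qf K B"
    using x unfolding w_closure_def by blast
  obtain us where "gv_list B us" "J = Span B us" "set us \<subseteq> J" by (rule gv_list_of_ideal[OF B J(1-3)])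
  then show thesis using that J(4,5) by blast
qed

lemma gv_list_one: "subring B K \<Longrightarrow> gv_list B [\<one>]"
  unfolding gv_list_def
  using subringE(3)[of B K] subring_carrier[OF subfieldE(1)[OF qf_subfield[of B]]] by auto

text \<open>If the prime contains some such ideal, then its closure contains one.  If not, an element \<open>x\<close> of the closure
with witness \<open>us\<close> lies in \<open>B\<close>, and it lies in the prime because some entry of \<open>us\<close> does not.\<close>

lemma w_prime_iff:
  assumes B: "subring B K"
  shows "w_prime K B P \<longleftrightarrow> prime_in K B P \<and> P \<noteq> {\<zero>} \<and> \<not> (\<exists>us. gv_list B us \<and> set us \<subseteq> P)"
proof
  assume w: "w_prime K B P"
  then have p: "prime_in K B P" and nz: "P \<noteq> {\<zero>}" and cl: "w_closure K B P = P"
    unfolding w_prime_def w_ideal_def prime_in_iff[OF B] by auto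
  have "\<not> set us \<subseteq> P" if us: "gv_list B us" for us
  proof
    assume usP: "set us \<subseteq> P"
    have sub: "Span B us \<subseteq> P" by (rule Span_subset_ideal[OF prime_inD(1)[OF p] subset_refl usP])
    have "\<one> \<in> w_closure K B P"
    proof (rule w_closureI[OF B us])
      show "\<one> \<in> qf K B" using qf_incl[OF B] subringE(3)[OF B] by blast
      fix j assume "j \<in> Span B us"
      then have "j \<in> P" "j \<in> carrier K" using sub prime_inD(4)[OF p] subring_carrier[OF B] by auto
      then show "\<one> \<otimes> j \<in> P" by simp
    qed
    then show False using cl prime_inD(2)[OF p] by blast
  qed
  then show "prime_in K B P \<and> P \<noteq> {\<zero>} \<and> \<not> (\<exists>us. gv_list B us \<and> set us \<subseteq> P)" using p nz by blast
next
  assume a: "prime_in K B P \<and> P \<noteq> {\<zero>} \<and> \<not> (\<exists>us. gv_list B us \<and> set us \<subseteq> P)"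
  then have p: "prime_in K B P" by blast
  note id = prime_inD(1)[OF p]
  have "w_closure K B P = P"
  proof
    show "P \<subseteq> w_closure K B P"
    proof
      fix x assume x: "x \<in> P"
      then have xB: "x \<in> B" using prime_inD(4)[OF p] by blast
      show "x \<in> w_closure K B P"
      proof (rule w_closureI[OF B gv_list_one[OF B]])
        show "x \<in> qf K B" using qf_incl[OF B] xB by blast
        fix j assume "j \<in> Span B [\<one>]"
        then have "j \<in> B" using gv_list_Span(2)[OF B gv_list_one[OF B]] by blast
        then show "x \<otimes> j \<in> P" using ideal_in_r[OF B id _ x] by blast
      qed
    qed
    show "w_closure K B P \<subseteq> P"
    proof
      fix x assume "x \<in> w_closure K B P"
      then obtain us where us: "gv_list B us" "x \<in> qf K B" "\<And>u. u \<in> set us \<Longrightarrow> x \<otimes> u \<in> P"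
        by (rule w_closureE[OF B]) blast
      obtain u where u: "u \<in> set us" "u \<notin> P" using a us(1) by blast
      have uB: "u \<in> B" using gv_listD(1)[OF us(1)] u by blast
      have xB: "x \<in> B" by (rule gv_listD(3)[OF us(1,2)]) (use us(3) prime_inD(4)[OF p] in blast)
      then show "x \<in> P" using prime_inD(3)[OF p xB uB us(3)[OF u(1)]] u(2) by blast
    qed
  qed
  then show "w_prime K B P"
    unfolding w_prime_def w_ideal_def prime_in_iff[OF B] ideal_in_iff[OF B] using a id by blast
qed

lemma valuation_overring_iff:
  assumes B: "subring B K"
  shows "valuation_overring K B V \<longleftrightarrow> val_ring K (qf K B) V \<and> B \<subseteq> V"
  unfolding valuation_overring_def overring_def val_ring_def
  using qf_between[OF B, of V] by auto

text \<open>If \<open>us\<close> has an entry that is a unit of \<open>V\<close>, then an element multiplied by \<open>us\<close> into \<open>F\<close> lies in \<open>F V\<close>.  If all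
entries are nonunits, then the closure of the ideal they generate contains one but its product with \<open>V\<close> does not.\<close>

lemma w_valuation_overring_iff:
  assumes B: "subring B K"
  shows "w_valuation_overring K B V \<longleftrightarrow>
    val_ring K (qf K B) V \<and> B \<subseteq> V \<and> \<not> (\<exists>us. gv_list B us \<and> set us \<subseteq> nonunits K V)"
proof
  note L = qf_subfield[OF B]
  assume w: "w_valuation_overring K B V"
  then have V: "val_ring K (qf K B) V" "B \<subseteq> V" and cl: "\<forall>F\<in>fg_frac_ideals K B. w_closure K B F \<subseteq> F \<cdot> V"
    unfolding w_valuation_overring_def valuation_overring_iff[OF B] by auto
  note p = nonunits_prime[OF L V(1)]
  note id = prime_inD(1)[OF p]
  note V' = val_ringD[OF V(1)]
  have "\<not> set us \<subseteq> nonunits K V" if us: "gv_list B us" for us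
  proof
    assume usP: "set us \<subseteq> nonunits K V"
    have sub: "Span B us \<subseteq> nonunits K V" by (rule Span_subset_ideal[OF id V(2) usP])
    have "\<one> \<in> w_closure K B (Span B us)"
    proof (rule w_closureI[OF B us])
      show "\<one> \<in> qf K B" using qf_incl[OF B] subringE(3)[OF B] by blast
      fix j assume j: "j \<in> Span B us"
      then have "j \<in> carrier K" using gv_list_Span(2)[OF B us] subring_carrier[OF B] by blast
      then show "\<one> \<otimes> j \<in> Span B us" using j by simp
    qed
    then have "\<one> \<in> Span B us \<cdot> V" using cl gv_list_Span(1)[OF B us] by blast
    moreover have "x \<in> nonunits K V" if "x \<in> Span B us \<cdot> V" for x
      using that
    proof induction
      case (prod i j)
      then show ?case using ideal_in_r[OF V'(1) id] sub by blast
    next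
      case (sum s t)
      then show ?case using ideal_inD(3)[OF id] by blast
    qed
    ultimately show False using prime_inD(2)[OF p] by blast
  qed
  then show "val_ring K (qf K B) V \<and> B \<subseteq> V \<and> \<not> (\<exists>us. gv_list B us \<and> set us \<subseteq> nonunits K V)" using V by blast
next
  assume a: "val_ring K (qf K B) V \<and> B \<subseteq> V \<and> \<not> (\<exists>us. gv_list B us \<and> set us \<subseteq> nonunits K V)"
  then have V: "val_ring K (qf K B) V" "B \<subseteq> V" by auto
  have "w_closure K B F \<subseteq> F \<cdot> V" for F
  proof
    fix x assume "x \<in> w_closure K B F"
    then obtain us where us: "gv_list B us" "x \<in> qf K B" "\<And>u. u \<in> set us \<Longrightarrow> x \<otimes> u \<in> F"
      by (rule w_closureE[OF B]) blast
    obtain u where u: "u \<in> set us" "u \<notin> nonunits K V" using a us(1) by blast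
    have uV: "u \<in> V" using gv_listD(1)[OF us(1)] u V(2) by blast
    have ui: "u \<noteq> \<zero>" "inv u \<in> V" using val_ring_unitD[OF V(1) uV u(2)] .
    have "(x \<otimes> u) \<otimes> inv u \<in> F \<cdot> V" using us(3)[OF u(1)] ui(2) by (rule ideal_prod.prod)
    moreover have "x \<in> carrier K" using us(2) subring_carrier[OF subfieldE(1)[OF qf_subfield[OF B]]] by blast
    moreover have "u \<in> carrier K" using uV subring_carrier[OF val_ringD(1)[OF V(1)]] by blast
    ultimately show "x \<in> F \<cdot> V" using ui by simp
  qed
  then show "w_valuation_overring K B V"
    unfolding w_valuation_overring_def valuation_overring_iff[OF B] using V by blast
qed

section \<open>The dimensions as existence of chains\<close>

lemma enat_le_w_dim_iff:
  "enat n \<le> w_dim K B \<longleftrightarrow>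
    (\<exists>P :: nat \<Rightarrow> 'a set. (\<forall>i<n. w_prime K B (P i)) \<and> (\<forall>i. Suc i < n \<longrightarrow> P i \<subset> P (Suc i)))"
proof -
  let ?S = "{n. \<exists>P :: nat \<Rightarrow> 'a set. (\<forall>i<n. w_prime K B (P i)) \<and> (\<forall>i. Suc i < n \<longrightarrow> P i \<subset> P (Suc i))}"
  have zero: "0 \<in> ?S" by simp
  have down: "n \<in> ?S" if m: "m \<in> ?S" "n \<le> m" for m n
  proof -
    obtain P where P: "\<forall>i<m. w_prime K B (P i)" "\<forall>i. Suc i < m \<longrightarrow> P i \<subset> P (Suc i)" using m(1) by auto
    have "\<forall>i<n. w_prime K B (P i)" "\<forall>i. Suc i < n \<longrightarrow> P i \<subset> P (Suc i)" using P m(2) by auto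
    then show ?thesis by blast
  qed
  have "enat n \<le> w_dim K B \<longleftrightarrow> n \<in> ?S"
    unfolding w_dim_def by (rule enat_le_SUP_downset[OF zero down])
  then show ?thesis by simp
qed

lemma enat_le_val_dim_iff:
  assumes B: "subring B K"
  shows "enat n \<le> val_dim K B \<longleftrightarrow>
    (\<exists>V. val_ring K (qf K B) V \<and> B \<subseteq> V \<and> ring_chain K (qf K B) V n)"
proof -
  note L = qf_subfield[OF B]
  have "{V. valuation_overring K B V} \<noteq> {}"
    using valuation_overring_iff[OF B, of "qf K B"] val_ring_field[OF L] qf_incl[OF B] by auto
  then have "enat n \<le> val_dim K B \<longleftrightarrow>
      (\<exists>V. valuation_overring K B V \<and> enat n \<le> krull_dim (K\<lparr>carrier := V\<rparr>))"
    unfolding val_dim_def by (subst enat_le_SUP_iff) auto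
  then show ?thesis
    unfolding valuation_overring_iff[OF B] using enat_le_krull_dim_val_ring[OF L] by blast
qed

lemma enat_le_w_val_dim_iff:
  assumes B: "subring B K"
  shows "enat n \<le> w_val_dim K B \<longleftrightarrow>
    (\<exists>V. val_ring K (qf K B) V \<and> B \<subseteq> V \<and> \<not> (\<exists>us. gv_list B us \<and> set us \<subseteq> nonunits K V) \<and>
      ring_chain K (qf K B) V n)"
proof -
  note L = qf_subfield[OF B]
  have "\<not> (\<exists>us. gv_list B us \<and> set us \<subseteq> nonunits K (qf K B))"
    unfolding nonunits_field[OF L] using gv_listD(2) by blast
  then have "{V. w_valuation_overring K B V} \<noteq> {}"
    using w_valuation_overring_iff[OF B, of "qf K B"] val_ring_field[OF L] qf_incl[OF B] by auto
  then have "enat n \<le> w_val_dim K B \<longleftrightarrow>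
      (\<exists>V. w_valuation_overring K B V \<and> enat n \<le> krull_dim (K\<lparr>carrier := V\<rparr>))"
    unfolding w_val_dim_def by (subst enat_le_SUP_iff) auto
  then show ?thesis
    unfolding w_valuation_overring_iff[OF B] using enat_le_krull_dim_val_ring[OF L] by blast
qed

lemma alg_independent_empty:
  assumes F: "F \<subseteq> carrier K" shows "alg_independent K F {}"
  unfolding alg_independent_iff res_indep_def
proof (intro conjI allI impI ballI)
  fix E c e
  assume a: "finite E \<and> E \<subseteq> exps {} \<and> c \<in> E \<rightarrow> F \<and> (\<Oplus>e\<in>E. c e \<otimes> pprod K e) \<in> nonunits K (carrier K)"
    and e: "e \<in> E"
  have z: "f = (\<lambda>_. 0)" if "f \<in> E" for f using a that unfolding exps_def supp_def by auto
  then have E: "E = {\<lambda>_. 0}" "e = (\<lambda>_. 0)" using e by auto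
  have "c (\<lambda>_. 0) \<in> carrier K" using a F E by auto
  then have "(\<Oplus>e\<in>E. c e \<otimes> pprod K e) = c (\<lambda>_. 0)" unfolding E by simp
  then show "c e \<in> nonunits K (carrier K)" using a E by simp
qed simp

lemma alg_independent_subset: "alg_independent K F S \<Longrightarrow> S' \<subseteq> S \<Longrightarrow> alg_independent K F S'"
proof -
  assume S: "alg_independent K F S" and sub: "S' \<subseteq> S"
  then have Sc: "S \<subseteq> carrier K" and ind: "res_indep K (carrier K) F S" unfolding alg_independent_iff by auto
  have "res_indep K (carrier K) F S'"
    unfolding res_indep_def
  proof (intro allI impI ballI)
    fix E c e
    assume a: "finite E \<and> E \<subseteq> exps S' \<and> c \<in> E \<rightarrow> F \<and> (\<Oplus>e\<in>E. c e \<otimes> pprod K e) \<in> nonunits K (carrier K)"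
      and e: "e \<in> E"
    have ES: "E \<subseteq> exps S" using a exps_mono[OF sub] by blast
    show "c e \<in> nonunits K (carrier K)" by (rule res_indepD[OF ind _ ES _ _ e]) (use a in auto)
  qed
  then show ?thesis unfolding alg_independent_iff using Sc sub by blast
qed

lemma enat_le_trdegE:
  assumes F: "F \<subseteq> carrier K" and n: "enat n \<le> trdeg K F"
  obtains S where "alg_independent K F S" "finite S" "card S = n"
proof -
  have ne: "{S. alg_independent K F S} \<noteq> {}" using alg_independent_empty[OF F] by blast
  obtain S where S: "alg_independent K F S" "enat n \<le> (if finite S then enat (card S) else \<infinity>)"
    using n unfolding trdeg_def enat_le_SUP_iff[OF ne] by blast
  have "\<exists>S'\<subseteq>S. finite S' \<and> card S' = n"
  proof (cases "finite S")
    case True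
    then have "n \<le> card S" using S(2) by simp
    then show ?thesis using obtain_subset_with_card_n[of n S] True finite_subset by metis
  next
    case False
    then show ?thesis using infinite_arbitrarily_large[of S n] by blast
  qed
  then show thesis using that alg_independent_subset[OF S(1)] by blast
qed

lemma card_le_trdeg:
  assumes "alg_independent K F S" "finite S" shows "enat (card S) \<le> trdeg K F"
proof -
  have "(if finite S then enat (card S) else \<infinity>) \<le> trdeg K F"
    unfolding trdeg_def by (rule SUP_upper) (use assms in simp)
  then show ?thesis using assms by simp
qed

lemma localize_subring:
  assumes T: "subring T K" and P: "prime_in K T P"
  shows "subring (localize K T P) K" "T \<subseteq> localize K T P" "localize K T P \<subseteq> qf K T"
    "qf K (localize K T P) = qf K T"
proof -
  note m = mult_set_prime[OF T P]
  show a: "subring (localize K T P) K" unfolding localize_eq_fracs by (rule fracs_subring[OF T m])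
  show b: "T \<subseteq> localize K T P" unfolding localize_eq_fracs
    by (rule fracs_incl[OF subringE(1)[OF T]]) (use m in \<open>simp add: mult_set_def\<close>)
  show c: "localize K T P \<subseteq> qf K T" unfolding localize_eq_fracs qf_eq_fracs
    by (rule fracs_mono) (use prime_inD(5)[OF P] in auto)
  show "qf K (localize K T P) = qf K T" by (rule qf_between[OF T b c])
qed

lemma localize_subset_iff:
  assumes T: "subring T K" and P: "prime_in K T P" and L: "subfield L K" and V: "val_ring K L V"
    and TV: "T \<subseteq> V"
  shows "localize K T P \<subseteq> V \<longleftrightarrow> nonunits K V \<inter> T \<subseteq> P"
proof
  assume a: "localize K T P \<subseteq> V"
  show "nonunits K V \<inter> T \<subseteq> P"
  proof
    fix x assume x: "x \<in> nonunits K V \<inter> T"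
    show "x \<in> P"
    proof (rule ccontr)
      assume "x \<notin> P"
      then have "inv x \<in> V" "x \<noteq> \<zero>"
        using a x fracs_inv[OF T mult_set_prime[OF T P], of x] prime_inD(5)[OF P] unfolding localize_eq_fracs by auto
      then show False using x unfolding nonunits_def by blast
    qed
  qed
next
  assume a: "nonunits K V \<inter> T \<subseteq> P"
  show "localize K T P \<subseteq> V"
  proof
    fix y assume "y \<in> localize K T P"
    then obtain b s where y: "y = b \<otimes> inv s" "b \<in> T" "s \<in> T" "s \<notin> P" unfolding localize_def by blast
    then have "inv s \<in> V" using a TV unfolding nonunits_def by blast
    then show "y \<in> V" using y TV subringE(6)[OF val_ringD(1)[OF V]] by blast
  qed
qed

lemma enat_le_krull_dim_localize_iff:
  assumes T: "subring T K" and M: "prime_in K T M"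
  shows "enat n \<le> krull_dim (K\<lparr>carrier := localize K T M\<rparr>) \<longleftrightarrow>
    (\<exists>Q :: nat \<Rightarrow> 'a set. (\<forall>i\<le>n. prime_in K T (Q i) \<and> Q i \<subseteq> M) \<and> (\<forall>i<n. Q i \<subset> Q (Suc i)))"
proof -
  let ?TM = "localize K T M"
  note ms = mult_set_prime[OF T M]
  note TM = localize_subring[OF T M]
  have eq: "(\<exists>P :: nat \<Rightarrow> 'a set. (\<forall>i\<le>n. primeideal (P i) (K\<lparr>carrier := ?TM\<rparr>)) \<and> (\<forall>i<n. P i \<subset> P (Suc i)))
    \<longleftrightarrow> (\<exists>Q :: nat \<Rightarrow> 'a set. (\<forall>i\<le>n. prime_in K T (Q i) \<and> Q i \<subseteq> M) \<and> (\<forall>i<n. Q i \<subset> Q (Suc i)))" for n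
    unfolding prime_in_iff[OF TM(1)]
  proof
    assume "\<exists>P :: nat \<Rightarrow> 'a set. (\<forall>i\<le>n. prime_in K ?TM (P i)) \<and> (\<forall>i<n. P i \<subset> P (Suc i))"
    then obtain P where P: "\<And>i. i \<le> n \<Longrightarrow> prime_in K ?TM (P i)" "\<And>i. i < n \<Longrightarrow> P i \<subset> P (Suc i)" by blast
    have 1: "prime_in K T (P i \<inter> T)" if "i \<le> n" for i by (rule prime_in_contract[OF T TM(1,2) P(1)[OF that]])
    have 2: "P i \<inter> T \<subseteq> M" if i: "i \<le> n" for i
    proof
      fix t assume t: "t \<in> P i \<inter> T"
      show "t \<in> M"
      proof (rule ccontr)
        assume "t \<notin> M"
        then have it: "inv t \<in> ?TM" "t \<noteq> \<zero>"
          using t fracs_inv[OF T ms, of t] prime_inD(5)[OF M] unfolding localize_eq_fracs by auto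
        then have "inv t \<otimes> t \<in> P i" using ideal_inD(4)[OF prime_inD(1)[OF P(1)[OF i]] it(1), of t] t by blast
        then show False using it t subring_carrier[OF T, of t] prime_inD(2)[OF P(1)[OF i]] by simp
      qed
    qed
    have 3: "P i \<inter> T \<subset> P (Suc i) \<inter> T" if i: "i < n" for i
    proof -
      have le: "i \<le> n" "Suc i \<le> n" using i by auto
      obtain y where y: "y \<in> P (Suc i)" "y \<notin> P i" using P(2)[OF i] by blast
      then have "y \<in> ?TM" using prime_inD(4)[OF P(1)[OF le(2)]] by blast
      then obtain a s where as: "y = a \<otimes> inv s" "a \<in> T" "s \<in> T" "s \<notin> M" unfolding localize_def by blast
      have c: "a \<in> carrier K" "s \<in> carrier K" "s \<noteq> \<zero>" using as subring_carrier[OF T] prime_inD(5)[OF M] by auto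
      have is': "inv s \<in> ?TM" using fracs_inv[OF T ms, of s] as unfolding localize_eq_fracs by blast
      have "y \<otimes> s = a" unfolding as(1) using c by simp
      moreover have "y \<otimes> s \<in> P (Suc i)"
        using ideal_in_r[OF TM(1) prime_inD(1)[OF P(1)[OF le(2)]] _ y(1)] TM(2) as(3) by blast
      ultimately have "a \<in> P (Suc i)" by simp
      moreover have "a \<notin> P i"
        using ideal_in_r[OF TM(1) prime_inD(1)[OF P(1)[OF le(1)]] is', of a] y(2) as(1) by blast
      ultimately show ?thesis using P(2)[OF i] as(2) by blast
    qed
    show "\<exists>Q :: nat \<Rightarrow> 'a set. (\<forall>i\<le>n. prime_in K T (Q i) \<and> Q i \<subseteq> M) \<and> (\<forall>i<n. Q i \<subset> Q (Suc i))"
      by (rule exI[of _ "\<lambda>i. P i \<inter> T"]) (use 1 2 3 in simp)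
  next
    assume "\<exists>Q :: nat \<Rightarrow> 'a set. (\<forall>i\<le>n. prime_in K T (Q i) \<and> Q i \<subseteq> M) \<and> (\<forall>i<n. Q i \<subset> Q (Suc i))"
    then obtain Q where Q: "\<And>i. i \<le> n \<Longrightarrow> prime_in K T (Q i)" "\<And>i. i \<le> n \<Longrightarrow> Q i \<subseteq> M" "\<And>i. i < n \<Longrightarrow> Q i \<subset> Q (Suc i)"
      by blast
    have mem: "x \<in> Q i" if x: "i \<le> n" "x \<in> T" "x \<in> fracs K (Q i) (T - M)" for x i
    proof -
      obtain s where s: "s \<in> T - M" "x \<otimes> s \<in> Q i"
        using fracs_mem_ideal[OF T ms prime_inD(1)[OF Q(1)[OF x(1)]] x(2) x(3)] by blast
      then show ?thesis using prime_inD(3)[OF Q(1)[OF x(1)] x(2), of s] Q(2)[OF x(1)] by blast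
    qed
    have 1: "prime_in K ?TM (fracs K (Q i) (T - M))" if i: "i \<le> n" for i
      unfolding prime_in_def
    proof (intro conjI ballI impI)
      note id = prime_inD(1)[OF Q(1)[OF i]]
      show idf: "ideal_in K ?TM (fracs K (Q i) (T - M))" unfolding localize_eq_fracs by (rule fracs_ideal[OF T ms id])
      show "\<one> \<notin> fracs K (Q i) (T - M)" by (rule fracs_proper[OF T ms id]) (use Q(2)[OF i] in blast)
      fix y z assume y: "y \<in> ?TM" and z: "z \<in> ?TM" and yz: "y \<otimes> z \<in> fracs K (Q i) (T - M)"
      obtain a s where as: "y = a \<otimes> inv s" "a \<in> T" "s \<in> T" "s \<notin> M" using y unfolding localize_def by blast
      obtain b t where bt: "z = b \<otimes> inv t" "b \<in> T" "t \<in> T" "t \<notin> M" using z unfolding localize_def by blast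
      have c: "a \<in> carrier K" "s \<in> carrier K" "s \<noteq> \<zero>" "b \<in> carrier K" "t \<in> carrier K" "t \<noteq> \<zero>"
        using as bt subring_carrier[OF T] prime_inD(5)[OF M] by auto
      have "a \<otimes> b = (y \<otimes> z) \<otimes> (s \<otimes> t)"
        unfolding as(1) bt(1) using c by (simp add: frac_mult)
      moreover have "s \<otimes> t \<in> ?TM" using TM(2) subringE(6)[OF T as(3) bt(3)] by blast
      ultimately have "a \<otimes> b \<in> fracs K (Q i) (T - M)"
        using ideal_in_r[OF TM(1) idf _ yz] by simp
      then have "a \<otimes> b \<in> Q i" using mem[OF i subringE(6)[OF T as(2) bt(2)]] by blast
      then have "a \<in> Q i \<or> b \<in> Q i" using prime_inD(3)[OF Q(1)[OF i] as(2) bt(2)] by blast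
      then show "y \<in> fracs K (Q i) (T - M) \<or> z \<in> fracs K (Q i) (T - M)"
        using fracsI as bt by blast
    qed
    have 3: "fracs K (Q i) (T - M) \<subset> fracs K (Q (Suc i)) (T - M)" if i: "i < n" for i
    proof -
      have le: "i \<le> n" "Suc i \<le> n" using i by auto
      obtain x where x: "x \<in> Q (Suc i)" "x \<notin> Q i" using Q(3)[OF i] by blast
      have xT: "x \<in> T" using x prime_inD(4)[OF Q(1)[OF le(2)]] by blast
      have "Q (Suc i) \<subseteq> fracs K (Q (Suc i)) (T - M)"
        by (rule fracs_incl) (use prime_inD(4)[OF Q(1)[OF le(2)]] subringE(1,3)[OF T] prime_inD(2)[OF M] in auto)
      moreover have "x \<notin> fracs K (Q i) (T - M)" using mem[OF le(1) xT] x by blast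
      moreover have "fracs K (Q i) (T - M) \<subseteq> fracs K (Q (Suc i)) (T - M)"
        by (rule fracs_mono) (use Q(3)[OF i] in auto)
      ultimately show ?thesis using x by blast
    qed
    show "\<exists>P :: nat \<Rightarrow> 'a set. (\<forall>i\<le>n. prime_in K ?TM (P i)) \<and> (\<forall>i<n. P i \<subset> P (Suc i))"
      by (rule exI[of _ "\<lambda>i. fracs K (Q i) (T - M)"]) (use 1 3 in simp)
  qed
  let ?S = "{n. \<exists>Q :: nat \<Rightarrow> 'a set. (\<forall>i\<le>n. prime_in K T (Q i) \<and> Q i \<subseteq> M) \<and> (\<forall>i<n. Q i \<subset> Q (Suc i))}"
  have zero: "0 \<in> ?S" using M by auto
  have down: "n \<in> ?S" if m: "m \<in> ?S" "n \<le> m" for m n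
  proof -
    obtain Q where Q: "\<forall>i\<le>m. prime_in K T (Q i) \<and> Q i \<subseteq> M" "\<forall>i<m. Q i \<subset> Q (Suc i)" using m(1) by auto
    have "\<forall>i\<le>n. prime_in K T (Q i) \<and> Q i \<subseteq> M" "\<forall>i<n. Q i \<subset> Q (Suc i)" using Q m(2) by auto
    then show ?thesis by blast
  qed
  have "enat n \<le> krull_dim (K\<lparr>carrier := ?TM\<rparr>) \<longleftrightarrow> n \<in> ?S"
    unfolding krull_dim_def eq by (rule enat_le_SUP_downset[OF zero down])
  then show ?thesis by simp
qed

end

section \<open>The pullback square\<close>

text \<open>The residue map of \<open>T\<close> modulo \<open>M\<close> appears as a surjection onto a field with kernel \<open>M\<close>, which hides the
cosets.\<close>

locale pullback = K: ambient_field K + k: ambient_field k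
  for K :: "('a, 'b) ring_scheme" (structure) and k :: "('c, 'd) ring_scheme" +
  fixes T M :: "'a set" and \<phi> :: "'a \<Rightarrow> 'c" and D :: "'c set"
  assumes T: "subring T K"
    and phi_add: "\<And>x y. x \<in> T \<Longrightarrow> y \<in> T \<Longrightarrow> \<phi> (x \<oplus> y) = \<phi> x \<oplus>\<^bsub>k\<^esub> \<phi> y"
    and phi_mult: "\<And>x y. x \<in> T \<Longrightarrow> y \<in> T \<Longrightarrow> \<phi> (x \<otimes> y) = \<phi> x \<otimes>\<^bsub>k\<^esub> \<phi> y"
    and phi_one: "\<phi> \<one> = \<one>\<^bsub>k\<^esub>"
    and phi_surj: "\<phi> ` T = carrier k"
    and phi_zero_iff: "\<And>x. x \<in> T \<Longrightarrow> \<phi> x = \<zero>\<^bsub>k\<^esub> \<longleftrightarrow> x \<in> M"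
    and M_sub: "M \<subseteq> T" and M_nonzero: "M \<noteq> {\<zero>}"
    and D: "subring D k" and D_proper: "D \<noteq> carrier k"
begin

definition R :: "'a set" where "R = {x \<in> T. \<phi> x \<in> D}"

definition pre :: "'c set \<Rightarrow> 'a set" where "pre E = {x \<in> T. \<phi> x \<in> E}"

lemma Tc: "x \<in> T \<Longrightarrow> x \<in> carrier K"
  using K.subring_carrier[OF T] .

lemma phi_carrier: "x \<in> T \<Longrightarrow> \<phi> x \<in> carrier k"
  using phi_surj by blast

lemmas T_closed = subringE(2,3,5,6,7)[OF T] K.subring_minus[OF T]

lemma phi_neg: assumes x: "x \<in> T" shows "\<phi> (\<ominus> x) = \<ominus>\<^bsub>k\<^esub> \<phi> x"
proof -
  have z: "\<phi> \<zero> = \<zero>\<^bsub>k\<^esub>"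
  proof -
    have "\<phi> \<zero> \<oplus>\<^bsub>k\<^esub> \<phi> \<zero> = \<phi> \<zero>" using phi_add[of \<zero> \<zero>] T_closed(1) by simp
    then show ?thesis using k.add.l_cancel_one' phi_carrier[OF T_closed(1)] by auto
  qed
  have "\<phi> (\<ominus> x) \<oplus>\<^bsub>k\<^esub> \<phi> x = \<phi> (\<ominus> x \<oplus> x)" using phi_add x T_closed(3) by simp
  also have "\<dots> = \<zero>\<^bsub>k\<^esub>" using z Tc[OF x] by (simp add: K.l_neg)
  finally show ?thesis
    using k.minus_equality[of "\<phi> (\<ominus> x)" "\<phi> x"] phi_carrier x T_closed(3) by auto
qed

lemma phi_diff: "x \<in> T \<Longrightarrow> y \<in> T \<Longrightarrow> \<phi> (x \<ominus> y) = \<phi> x \<ominus>\<^bsub>k\<^esub> \<phi> y"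
  using phi_add[of x "\<ominus> y"] phi_neg[of y] T_closed(3) by (simp add: a_minus_def)

lemma zero_M: "\<zero> \<in> M"
proof -
  have "\<zero> = \<zero> \<ominus> \<zero>" by (simp add: K.minus_eq)
  then have "\<phi> \<zero> = \<zero>\<^bsub>k\<^esub>"
    using phi_diff[of \<zero> \<zero>] T_closed(1) phi_carrier[of \<zero>] by (simp add: k.r_neg a_minus_def)
  then show ?thesis using phi_zero_iff T_closed(1) by blast
qed

lemma phi_zero: "\<phi> \<zero> = \<zero>\<^bsub>k\<^esub>"
  using zero_M phi_zero_iff T_closed(1) by blast

lemma phi_eq_iff:
  assumes "x \<in> T" "y \<in> T" shows "\<phi> x = \<phi> y \<longleftrightarrow> x \<ominus> y \<in> M"
proof -
  have "x \<ominus> y \<in> M \<longleftrightarrow> \<phi> x \<ominus>\<^bsub>k\<^esub> \<phi> y = \<zero>\<^bsub>k\<^esub>"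
    using phi_zero_iff[of "x \<ominus> y"] phi_diff assms T_closed(6) by simp
  also have "\<dots> \<longleftrightarrow> \<phi> x = \<phi> y" using k.r_right_minus_eq phi_carrier assms by simp
  finally show ?thesis by blast
qed

lemma M_prime: "prime_in K T M"
  unfolding prime_in_def ideal_in_def
proof (intro conjI ballI impI)
  show "M \<subseteq> T" by (rule M_sub)
  show "\<zero> \<in> M" by (rule zero_M)
  show "\<one> \<notin> M" using phi_zero_iff[OF T_closed(2)] phi_one k.zero_not_one by auto
  fix x y assume x: "x \<in> M" and y: "y \<in> M"
  then have xy: "x \<in> T" "y \<in> T" using M_sub by auto
  then have "\<phi> x = \<zero>\<^bsub>k\<^esub>" "\<phi> y = \<zero>\<^bsub>k\<^esub>" using phi_zero_iff x y by auto
  then have "\<phi> (x \<oplus> y) = \<zero>\<^bsub>k\<^esub>" using phi_add[OF xy] by simp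
  then show "x \<oplus> y \<in> M" using phi_zero_iff[of "x \<oplus> y"] xy T_closed(5) by blast
next
  fix b x assume b: "b \<in> T" and x: "x \<in> M"
  then have "x \<in> T" using M_sub by auto
  then have "\<phi> (b \<otimes> x) = \<zero>\<^bsub>k\<^esub>" using phi_mult[OF b] phi_zero_iff[of x] x phi_carrier[OF b] by simp
  then show "b \<otimes> x \<in> M" using phi_zero_iff[of "b \<otimes> x"] b \<open>x \<in> T\<close> T_closed(4) by blast
next
  fix a b assume ab: "a \<in> T" "b \<in> T" "a \<otimes> b \<in> M"
  then have "\<phi> a \<otimes>\<^bsub>k\<^esub> \<phi> b = \<zero>\<^bsub>k\<^esub>" using phi_zero_iff[of "a \<otimes> b"] phi_mult T_closed(4) by simp
  then show "a \<in> M \<or> b \<in> M" using k.integral phi_carrier phi_zero_iff ab by blast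
qed

lemmas M_ideal = K.prime_inD(1)[OF M_prime]
lemmas MD = K.ideal_inD[OF M_ideal]

lemma M_mult_r: "x \<in> M \<Longrightarrow> b \<in> T \<Longrightarrow> x \<otimes> b \<in> M"
  using K.ideal_in_r[OF T M_ideal] by blast

lemma inverse_mod_M:
  assumes t: "t \<in> T" "t \<notin> M"
  obtains u where "u \<in> T" "u \<notin> M" "\<phi> u = inv\<^bsub>k\<^esub> \<phi> t" "t \<otimes> u \<ominus> \<one> \<in> M"
proof -
  have nz: "\<phi> t \<in> carrier k" "\<phi> t \<noteq> \<zero>\<^bsub>k\<^esub>" using t phi_zero_iff phi_carrier by auto
  then have "inv\<^bsub>k\<^esub> \<phi> t \<in> \<phi> ` T" using phi_surj by simp
  then obtain u where u: "u \<in> T" "\<phi> u = inv\<^bsub>k\<^esub> \<phi> t" by force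
  have "\<phi> (t \<otimes> u) = \<phi> \<one>" using phi_mult[OF t(1) u(1)] u(2) nz phi_one by simp
  then have "t \<otimes> u \<ominus> \<one> \<in> M" using phi_eq_iff T_closed(2,4) t u by blast
  moreover have "u \<notin> M" using u nz phi_zero_iff[OF u(1)] k.inv_nonzero by auto
  ultimately show thesis using that u by blast
qed

text \<open>Multiply an element of \<open>Q\<close> outside \<open>M\<close> by an inverse modulo \<open>M\<close>.\<close>

lemma ideal_not_in_M:
  assumes Q: "ideal_in K T Q" and n: "\<not> Q \<subseteq> M"
  obtains q where "q \<in> Q" "q \<in> T" "\<phi> q = \<one>\<^bsub>k\<^esub>" "\<one> \<ominus> q \<in> M"
proof -
  obtain t where t: "t \<in> Q" "t \<notin> M" using n by blast
  have tT: "t \<in> T" using t K.ideal_inD(1)[OF Q] by blast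
  obtain u where u: "u \<in> T" "u \<notin> M" "\<phi> u = inv\<^bsub>k\<^esub> \<phi> t" using inverse_mod_M[OF tT t(2)] by blast
  have q: "t \<otimes> u \<in> Q" "t \<otimes> u \<in> T" using K.ideal_in_r[OF T Q u(1) t(1)] T_closed(4) tT u by auto
  have p: "\<phi> (t \<otimes> u) = \<one>\<^bsub>k\<^esub>" using phi_mult tT u phi_carrier[OF tT] t(2) phi_zero_iff by simp
  then have "\<one> \<ominus> t \<otimes> u \<in> M" using phi_eq_iff[OF T_closed(2) q(2)] phi_one by simp
  then show thesis using that q p by blast
qed

lemma image_subring:
  assumes A: "subring A K" "A \<subseteq> T" shows "subring (\<phi> ` A) k"
proof (rule k.subringI)
  show "\<phi> ` A \<subseteq> carrier k" using A(2) phi_carrier by blast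
  have "\<phi> \<one> \<in> \<phi> ` A" using subringE(3)[OF A(1)] by blast
  then show "\<one>\<^bsub>k\<^esub> \<in> \<phi> ` A" using phi_one by simp
  fix y assume "y \<in> \<phi> ` A"
  then obtain a where a: "a \<in> A" "y = \<phi> a" by blast
  have "\<phi> (\<ominus> a) \<in> \<phi> ` A" using subringE(5)[OF A(1) a(1)] by blast
  then show "\<ominus>\<^bsub>k\<^esub> y \<in> \<phi> ` A" using phi_neg a A(2) by auto
  fix z assume "z \<in> \<phi> ` A"
  then obtain b where b: "b \<in> A" "z = \<phi> b" by blast
  have "\<phi> (a \<otimes> b) \<in> \<phi> ` A" "\<phi> (a \<oplus> b) \<in> \<phi> ` A"
    using subringE(6)[OF A(1) a(1) b(1)] subringE(7)[OF A(1) a(1) b(1)] by (simp_all only: imageI)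
  moreover have "\<phi> (a \<otimes> b) = y \<otimes>\<^bsub>k\<^esub> z" "\<phi> (a \<oplus> b) = y \<oplus>\<^bsub>k\<^esub> z"
    using phi_mult[of a b] phi_add[of a b] a b A(2) by auto
  ultimately show "y \<otimes>\<^bsub>k\<^esub> z \<in> \<phi> ` A" "y \<oplus>\<^bsub>k\<^esub> z \<in> \<phi> ` A" by simp_all
qed

lemma pre_subring:
  assumes E: "subring E k" shows "subring (pre E) K" "M \<subseteq> pre E" "pre E \<subseteq> T"
proof -
  show "subring (pre E) K"
  proof (rule K.subringI)
    show "pre E \<subseteq> carrier K" unfolding pre_def using Tc by blast
    show "\<one> \<in> pre E" unfolding pre_def using T_closed(2) phi_one subringE(3)[OF E] by simp
    fix x y assume xy: "x \<in> pre E" "y \<in> pre E"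
    then show "\<ominus> x \<in> pre E" "x \<otimes> y \<in> pre E" "x \<oplus> y \<in> pre E"
      unfolding pre_def using T_closed phi_neg phi_mult phi_add subringE(5,6,7)[OF E] by auto
  qed
  show "M \<subseteq> pre E"
  proof
    fix x assume x: "x \<in> M"
    then have "x \<in> T" using M_sub by blast
    then have "\<phi> x = \<zero>\<^bsub>k\<^esub>" using x phi_zero_iff by blast
    then show "x \<in> pre E" unfolding pre_def using \<open>x \<in> T\<close> subringE(2)[OF E] by simp
  qed
  show "pre E \<subseteq> T" unfolding pre_def by blast
qed

lemma pre_prime:
  assumes E: "subring E k" and p: "prime_in k E p"
  shows "prime_in K (pre E) (pre p)"
proof -
  note id = k.ideal_inD[OF k.prime_inD(1)[OF p]]
  have pT: "pre E \<subseteq> T" unfolding pre_def by blast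
  show ?thesis
    unfolding prime_in_def ideal_in_def
  proof (intro conjI ballI impI)
    show "pre p \<subseteq> pre E" using id(1) unfolding pre_def by blast
    show "\<zero> \<in> pre p" unfolding pre_def using T_closed(1) phi_zero id(2) by simp
    show "\<one> \<notin> pre p" unfolding pre_def using phi_one k.prime_inD(2)[OF p] by simp
  next
    fix x y assume "x \<in> pre p" "y \<in> pre p"
    then show "x \<oplus> y \<in> pre p" unfolding pre_def using T_closed(5) phi_add id(3) by simp
  next
    fix x y assume "x \<in> pre E" "y \<in> pre p"
    then show "x \<otimes> y \<in> pre p" unfolding pre_def using T_closed(4) phi_mult id(4) by simp
  next
    fix x y assume a: "x \<in> pre E" "y \<in> pre E" "x \<otimes> y \<in> pre p"
    then have "\<phi> x \<otimes>\<^bsub>k\<^esub> \<phi> y \<in> p" using phi_mult[of x y] unfolding pre_def by simp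
    then have "\<phi> x \<in> p \<or> \<phi> y \<in> p" using k.prime_inD(3)[OF p] a unfolding pre_def by blast
    then show "x \<in> pre p \<or> y \<in> pre p" using a unfolding pre_def by blast
  qed
qed

lemma R_eq: "R = pre D"
  unfolding R_def pre_def ..

lemma R_subring: "subring R K" and M_R: "M \<subseteq> R" and R_T: "R \<subseteq> T"
  using pre_subring[OF D] unfolding R_eq by auto

lemma phi_R: "\<phi> ` R = D"
proof
  show "D \<subseteq> \<phi> ` R"
  proof
    fix d assume d: "d \<in> D"
    then have "d \<in> \<phi> ` T" using phi_surj k.subring_carrier[OF D] by simp
    then show "d \<in> \<phi> ` R" using d unfolding R_def by auto
  qed
qed (auto simp: R_def)

text \<open>Every fraction can be expanded by a nonzero element of \<open>M\<close>, and \<open>M\<close> is an ideal of \<open>T\<close> inside \<open>R\<close>.\<close>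

lemma qf_R: "qf K R = qf K T"
proof
  show "qf K R \<subseteq> qf K T" by (rule K.qf_mono[OF R_T])
  obtain m where m: "m \<in> M" "m \<noteq> \<zero>" using M_nonzero zero_M by blast
  have mc: "m \<in> T" "m \<in> carrier K" using m M_sub Tc by auto
  show "qf K T \<subseteq> qf K R"
  proof
    fix x assume "x \<in> qf K T"
    then obtain a b where ab: "x = a \<otimes> inv b" "a \<in> T" "b \<in> T" "b \<noteq> \<zero>" unfolding qf_def by blast
    have c: "a \<in> carrier K" "b \<in> carrier K" using ab Tc by auto
    have "x = (a \<otimes> m) \<otimes> inv (b \<otimes> m)"
      unfolding ab(1) using c m mc ab(4) by (simp add: K.frac_mult[symmetric])
    moreover have "a \<otimes> m \<in> R" "b \<otimes> m \<in> R" using MD(4) m M_R ab by auto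
    moreover have "b \<otimes> m \<noteq> \<zero>" using c m mc ab(4) by simp
    ultimately show "x \<in> qf K R" unfolding qf_def by blast
  qed
qed

abbreviation L where "L \<equiv> qf K T"

lemma L: "subfield L K"
  by (rule K.qf_subfield[OF T])

lemma Lc: "x \<in> L \<Longrightarrow> x \<in> carrier K"
  using K.subring_carrier[OF subfieldE(1)[OF L]] .

lemma T_L: "T \<subseteq> L"
  by (rule K.qf_incl[OF T])

section \<open>Transfer of Glaz-Vasconcelos ideals\<close>

text \<open>An element that multiplies the image into \<open>D\<close> lifts to \<open>T\<close>, and the lift multiplies the given ideal into
\<open>R\<close>.\<close>

lemma gv_R_D:
  assumes us: "K.gv_list R us" and uM: "\<not> set us \<subseteq> M"
  shows "k.gv_list D (map \<phi> us)"
  unfolding k.gv_list_def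
proof (intro conjI ballI impI)
  note g = K.gv_listD[OF us]
  have uT: "u \<in> T" if "u \<in> set us" for u using that g(1) R_T by blast
  show "set (map \<phi> us) \<subseteq> D" using g(1) phi_R by auto
  obtain u where "u \<in> set us" "u \<notin> M" using uM by blast
  then show "\<exists>u\<in>set (map \<phi> us). u \<noteq> \<zero>\<^bsub>k\<^esub>" using phi_zero_iff[OF uT] by auto
  fix y assume y: "y \<in> qf k D" and m: "\<forall>u\<in>set (map \<phi> us). y \<otimes>\<^bsub>k\<^esub> u \<in> D"
  have "y \<in> carrier k" using k.subring_carrier[OF subfieldE(1)[OF k.qf_subfield[OF D]] y] .
  then have "y \<in> \<phi> ` T" using phi_surj by simp
  then obtain t where t: "t \<in> T" "y = \<phi> t" by blast
  have "t \<in> R"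
  proof (rule g(3))
    show "t \<in> qf K R" unfolding qf_R using t T_L by blast
    fix u assume u: "u \<in> set us"
    have "\<phi> (t \<otimes> u) \<in> D" using m u t phi_mult[OF t(1) uT[OF u]] by simp
    then show "t \<otimes> u \<in> R" unfolding R_def using T_closed(4) t uT[OF u] by simp
  qed
  then show "y \<in> D" using t unfolding R_def by blast
qed

text \<open>Every element of \<open>T\<close> multiplies \<open>M\<close> into \<open>R\<close>, and \<open>T\<close> is larger than \<open>R\<close>.\<close>

lemma gv_R_not_M:
  assumes us: "K.gv_list R us" shows "\<not> set us \<subseteq> M"
proof
  assume uM: "set us \<subseteq> M"
  note g = K.gv_listD[OF us]
  have "D \<subseteq> carrier k" using subringE(1)[OF D] .
  then obtain y where y: "y \<in> carrier k" "y \<notin> D" using D_proper by blast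
  then have "y \<in> \<phi> ` T" using phi_surj by simp
  then obtain t where t: "t \<in> T" "\<phi> t = y" by blast
  have "t \<in> R"
  proof (rule g(3))
    show "t \<in> qf K R" unfolding qf_R using t T_L by blast
    show "t \<otimes> u \<in> R" if "u \<in> set us" for u using MD(4)[OF t(1)] uM that M_R by blast
  qed
  then show False using t y unfolding R_def by blast
qed

text \<open>Let \<open>x\<close> multiply the generators into \<open>T\<close>.  Some generator \<open>u\<close> is invertible modulo \<open>M\<close>, say
\<open>u y = 1 + n\<close>.  Then \<open>x n\<close> multiplies the generators into \<open>M\<close>, so it lies in \<open>R\<close>, and
\<open>x = x u y - x n\<close> lies in \<open>T\<close>.\<close>

lemma gv_R_T:
  assumes us: "K.gv_list R us" shows "K.gv_list T us"
  unfolding K.gv_list_def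
proof (intro conjI ballI impI)
  note g = K.gv_listD[OF us]
  show "set us \<subseteq> T" using g(1) R_T by blast
  show "\<exists>u\<in>set us. u \<noteq> \<zero>" by (rule g(2))
  fix x assume x: "x \<in> qf K T" and m: "\<forall>u\<in>set us. x \<otimes> u \<in> T"
  obtain u where u: "u \<in> set us" "u \<notin> M" using gv_R_not_M[OF us] by blast
  have uT: "u \<in> T" using g(1) R_T u by blast
  obtain y where y: "y \<in> T" "u \<otimes> y \<ominus> \<one> \<in> M" using inverse_mod_M[OF uT u(2)] by blast
  define n where "n = u \<otimes> y \<ominus> \<one>"
  have n: "n \<in> M" "n \<in> T" using y M_sub unfolding n_def by auto
  have c: "x \<in> carrier K" "u \<in> carrier K" "y \<in> carrier K" "n \<in> carrier K" using x Lc uT y n Tc by auto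
  have "x \<otimes> n \<in> R"
  proof (rule g(3))
    show "x \<otimes> n \<in> qf K R" unfolding qf_R using subringE(6)[OF subfieldE(1)[OF L] x] n T_L by blast
    fix v assume v: "v \<in> set us"
    have vc: "v \<in> carrier K" using v g(1) R_T Tc by blast
    have "(x \<otimes> n) \<otimes> v = (x \<otimes> v) \<otimes> n" using c vc by (simp add: K.m_ac)
    moreover have "(x \<otimes> v) \<otimes> n \<in> M" using MD(4)[of "x \<otimes> v" n] m v n by blast
    ultimately show "(x \<otimes> n) \<otimes> v \<in> R" using M_R by auto
  qed
  then have "x \<otimes> n \<in> T" using R_T by blast
  moreover have "(x \<otimes> u) \<otimes> y \<in> T" using m u y T_closed(4) by blast
  moreover have "x = (x \<otimes> u) \<otimes> y \<ominus> x \<otimes> n"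
  proof -
    have "(x \<otimes> u) \<otimes> y \<ominus> x \<otimes> (u \<otimes> y \<ominus> \<one>) = x" using c by algebra
    then show ?thesis unfolding n_def by simp
  qed
  ultimately show "x \<in> T" using T_closed(6) by metis
qed

text \<open>The lifts of the given generators need not suffice; an element of \<open>M\<close> is added so that together they generate the
unit ideal of \<open>T\<close>.  Then an element that multiplies them all into \<open>R\<close> lies in \<open>T\<close>, and its residue can be
tested in \<open>D\<close>.\<close>

lemma gv_D_R:
  assumes ds: "k.gv_list D ds"
  obtains us where "K.gv_list R us" "\<phi> ` set us \<subseteq> set ds \<union> {\<zero>\<^bsub>k\<^esub>}"
proof -
  note g = k.gv_listD[OF ds]
  define \<psi> where "\<psi> = inv_into R \<phi>"
  have \<psi>: "\<psi> d \<in> R \<and> \<phi> (\<psi> d) = d" if "d \<in> D" for d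
    unfolding \<psi>_def using inv_into_into[of d \<phi> R] f_inv_into_f[of d \<phi> R] that phi_R by simp
  obtain e where e: "e \<in> set ds" "e \<noteq> \<zero>\<^bsub>k\<^esub>" using g(2) by blast
  have eD: "e \<in> D" using e g(1) by blast
  define r where "r = \<psi> e"
  have r: "r \<in> R" "r \<in> T" "\<phi> r = e" using \<psi>[OF eD] R_T unfolding r_def by auto
  have rM: "r \<notin> M" using phi_zero_iff[OF r(2)] r(3) e(2) by simp
  obtain y where y: "y \<in> T" "r \<otimes> y \<ominus> \<one> \<in> M" using inverse_mod_M[OF r(2) rM] by blast
  define n where "n = r \<otimes> y \<ominus> \<one>"
  have n: "n \<in> M" "n \<in> T" using y M_sub unfolding n_def by auto
  let ?us = "n # map \<psi> ds"
  have "K.gv_list R ?us"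
    unfolding K.gv_list_def
  proof (intro conjI ballI impI)
    show "set ?us \<subseteq> R" using n M_R \<psi> g(1) by auto
    have "r \<in> set ?us" unfolding r_def using e by simp
    moreover have "r \<noteq> \<zero>" using rM zero_M by blast
    ultimately show "\<exists>u\<in>set ?us. u \<noteq> \<zero>" by blast
    fix x assume x: "x \<in> qf K R" and m: "\<forall>u\<in>set ?us. x \<otimes> u \<in> R"
    have xr: "x \<otimes> r \<in> R" "x \<otimes> n \<in> R" using m e unfolding r_def by auto
    have c: "x \<in> carrier K" "r \<in> carrier K" "y \<in> carrier K" "n \<in> carrier K"
      using x Lc r y n Tc unfolding qf_R by auto
    have "(x \<otimes> r) \<otimes> y \<ominus> x \<otimes> (r \<otimes> y \<ominus> \<one>) = x" using c by algebra
    then have "(x \<otimes> r) \<otimes> y \<ominus> x \<otimes> n = x" unfolding n_def .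
    moreover have "(x \<otimes> r) \<otimes> y \<ominus> x \<otimes> n \<in> T" using xr R_T y T_closed(4,6) by blast
    ultimately have xT: "x \<in> T" by simp
    have pm: "\<phi> x \<otimes>\<^bsub>k\<^esub> d \<in> D" if d: "d \<in> set ds" for d
    proof -
      have dD: "d \<in> D" using d g(1) by blast
      have "x \<otimes> \<psi> d \<in> R" using m d by simp
      then have "\<phi> (x \<otimes> \<psi> d) \<in> D" unfolding R_def by blast
      then show ?thesis using phi_mult[OF xT, of "\<psi> d"] \<psi>[OF dD] R_T by auto
    qed
    have ec: "e \<in> carrier k" using k.subring_carrier[OF D eD] .
    have "\<phi> x = (\<phi> x \<otimes>\<^bsub>k\<^esub> e) \<otimes>\<^bsub>k\<^esub> inv\<^bsub>k\<^esub> e" using phi_carrier[OF xT] ec e(2) by simp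
    then have "\<phi> x \<in> qf k D" unfolding qf_def using pm[OF e(1)] eD e(2) by blast
    then have "\<phi> x \<in> D" using g(3) pm by blast
    then show "x \<in> R" unfolding R_def using xT by blast
  qed
  moreover have "\<phi> ` set ?us \<subseteq> set ds \<union> {\<zero>\<^bsub>k\<^esub>}"
    using \<psi> g(1) phi_zero_iff[OF n(2)] n(1) by auto
  ultimately show thesis using that by blast
qed

text \<open>Choose \<open>q\<close> in \<open>Q\<close> with residue one.  The elements \<open>q\<close> and \<open>j (1 - q)\<close>, for the given generators \<open>j\<close>,
belong to \<open>R\<close> and to \<open>Q\<close>, and over \<open>T\<close> they generate an ideal that contains every \<open>j\<close>.\<close>

lemma gv_T_R:
  assumes us: "K.gv_list T us" and Q: "ideal_in K T Q" "\<not> Q \<subseteq> M" and uQ: "set us \<subseteq> Q"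
  obtains vs where "K.gv_list R vs" "set vs \<subseteq> Q"
proof -
  note g = K.gv_listD[OF us]
  obtain q where q: "q \<in> Q" "q \<in> T" "\<phi> q = \<one>\<^bsub>k\<^esub>" "\<one> \<ominus> q \<in> M" using ideal_not_in_M[OF Q] .
  have qR: "q \<in> R" unfolding R_def using q subringE(3)[OF D] by simp
  have qc: "q \<in> carrier K" using q Tc by blast
  let ?vs = "q # map (\<lambda>j. j \<otimes> (\<one> \<ominus> q)) us"
  have jM: "j \<otimes> (\<one> \<ominus> q) \<in> M" if "j \<in> T" for j using MD(4) that q(4) by blast
  have "K.gv_list R ?vs"
    unfolding K.gv_list_def
  proof (intro conjI ballI impI)
    show "set ?vs \<subseteq> R" using qR jM g(1) M_R by auto
    have "q \<noteq> \<zero>" using q(3) phi_zero k.zero_not_one by auto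
    then show "\<exists>u\<in>set ?vs. u \<noteq> \<zero>" by simp
    fix x assume x: "x \<in> qf K R" and m: "\<forall>u\<in>set ?vs. x \<otimes> u \<in> R"
    have xL: "x \<in> L" "x \<in> carrier K" using x Lc unfolding qf_R by auto
    have xq: "x \<otimes> q \<in> R" using m by simp
    have xT: "x \<in> T"
    proof (rule g(3)[OF xL(1)])
      fix j assume j: "j \<in> set us"
      have jT: "j \<in> T" "j \<in> carrier K" using j g(1) Tc by auto
      have "x \<otimes> (j \<otimes> (\<one> \<ominus> q)) \<in> T" using m j R_T by auto
      moreover have "(x \<otimes> q) \<otimes> j \<in> T" using xq R_T jT T_closed(4) by blast
      moreover have "x \<otimes> j = x \<otimes> (j \<otimes> (\<one> \<ominus> q)) \<oplus> (x \<otimes> q) \<otimes> j" using xL(2) jT(2) qc by algebra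
      ultimately show "x \<otimes> j \<in> T" using T_closed(5) by simp
    qed
    have "\<phi> (x \<otimes> q) = \<phi> x" using phi_mult[OF xT q(2)] q(3) phi_carrier[OF xT] by simp
    then have "\<phi> x \<in> D" using xq unfolding R_def by auto
    then show "x \<in> R" unfolding R_def using xT by blast
  qed
  moreover have "set ?vs \<subseteq> Q"
    using q(1) uQ K.ideal_in_r[OF T Q(1), of "\<one> \<ominus> q"] q(4) M_sub by auto
  ultimately show thesis using that by blast
qed

end

section \<open>The w-dimension of the pullback\<close>

context pullback
begin

lemma ideal_of_M_prime:
  assumes Q: "prime_in K T Q" "Q \<subseteq> M"
  shows "prime_in K R Q"
  unfolding prime_in_def ideal_in_def
proof (intro conjI ballI impI)
  note id = K.ideal_inD[OF K.prime_inD(1)[OF Q(1)]]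
  show "Q \<subseteq> R" using Q(2) M_R by blast
  show "\<zero> \<in> Q" by (rule id(2))
  show "\<one> \<notin> Q" using K.prime_inD(2)[OF Q(1)] .
  show "x \<oplus> y \<in> Q" if "x \<in> Q" "y \<in> Q" for x y using id(3) that .
  show "b \<otimes> x \<in> Q" if "b \<in> R" "x \<in> Q" for b x using id(4)[of b x] that R_T by blast
  show "a \<in> Q \<or> b \<in> Q" if "a \<in> R" "b \<in> R" "a \<otimes> b \<in> Q" for a b
    using K.prime_inD(3)[OF Q(1), of a b] that R_T by blast
qed

text \<open>Such a prime need not be a \<open>w\<close>-prime of \<open>T\<close>; it contains no Glaz-Vasconcelos ideal of \<open>R\<close> because \<open>M\<close>
contains none.\<close>

lemma w_prime_R_if_sub_M:
  assumes Q: "prime_in K T Q" "Q \<subseteq> M" "Q \<noteq> {\<zero>}" shows "w_prime K R Q"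
  unfolding K.w_prime_iff[OF R_subring]
  using ideal_of_M_prime[OF Q(1,2)] Q(2,3) gv_R_not_M by blast

lemma w_prime_pre:
  assumes p: "w_prime k D p" shows "w_prime K R (pre p)" "M \<subset> pre p"
proof -
  have p': "prime_in k D p" "p \<noteq> {\<zero>\<^bsub>k\<^esub>}" and n: "\<And>us. k.gv_list D us \<Longrightarrow> \<not> set us \<subseteq> p"
    using p unfolding k.w_prime_iff[OF D] by auto
  have Mp: "M \<subseteq> pre p"
  proof
    fix x assume x: "x \<in> M"
    then have "x \<in> T" using M_sub by blast
    moreover have "\<phi> x = \<zero>\<^bsub>k\<^esub>" using x phi_zero_iff[OF \<open>x \<in> T\<close>] by blast
    ultimately show "x \<in> pre p" unfolding pre_def using k.prime_inD(5)[OF p'(1)] by simp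
  qed
  obtain y where y: "y \<in> p" "y \<noteq> \<zero>\<^bsub>k\<^esub>" using p'(2) k.prime_inD(5)[OF p'(1)] by blast
  have "y \<in> \<phi> ` R" using y(1) k.prime_inD(4)[OF p'(1)] phi_R by blast
  then obtain x where x: "x \<in> T" "\<phi> x = y" using R_T by blast
  then have "x \<in> pre p" "x \<notin> M" using y phi_zero_iff[OF x(1)] unfolding pre_def by auto
  then show strict: "M \<subset> pre p" using Mp by blast
  have "\<not> set us \<subseteq> pre p" if us: "K.gv_list R us" for us
  proof
    assume "set us \<subseteq> pre p"
    then have "set (map \<phi> us) \<subseteq> p" unfolding pre_def by auto
    then show False using n[OF gv_R_D[OF us gv_R_not_M[OF us]]] by blast
  qed
  moreover have "pre p \<noteq> {\<zero>}" using strict zero_M by auto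
  ultimately show "w_prime K R (pre p)"
    unfolding K.w_prime_iff[OF R_subring] using pre_prime[OF D p'(1)] unfolding R_eq by blast
qed

lemma image_prime_mem:
  assumes P: "prime_in K R P" "M \<subseteq> P" and x: "x \<in> T" "\<phi> x \<in> \<phi> ` P" shows "x \<in> P"
proof -
  obtain y where y: "y \<in> P" "\<phi> x = \<phi> y" using x(2) by blast
  have yT: "y \<in> T" using y(1) K.prime_inD(4)[OF P(1)] R_T by blast
  have "x \<ominus> y \<in> P" using phi_eq_iff[OF x(1) yT] y(2) P(2) by blast
  then have "(x \<ominus> y) \<oplus> y \<in> P" using K.ideal_inD(3)[OF K.prime_inD(1)[OF P(1)]] y(1) by blast
  moreover have "(x \<ominus> y) \<oplus> y = x" using Tc[OF x(1)] Tc[OF yT] by algebra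
  ultimately show ?thesis by simp
qed

lemma image_prime:
  assumes P: "prime_in K R P" "M \<subseteq> P" shows "prime_in k D (\<phi> ` P)"
  unfolding prime_in_def ideal_in_def
proof (intro conjI ballI impI)
  note id = K.ideal_inD[OF K.prime_inD(1)[OF P(1)]]
  have PT: "x \<in> P \<Longrightarrow> x \<in> T" for x using id(1) R_T by blast
  show "\<phi> ` P \<subseteq> D" using id(1) phi_R by blast
  have "\<phi> \<zero> \<in> \<phi> ` P" using id(2) by (rule imageI)
  then show "\<zero>\<^bsub>k\<^esub> \<in> \<phi> ` P" using phi_zero by simp
  show "\<one>\<^bsub>k\<^esub> \<notin> \<phi> ` P"
    using image_prime_mem[OF P T_closed(2)] phi_one K.prime_inD(2)[OF P(1)] by auto
  show "x \<oplus>\<^bsub>k\<^esub> y \<in> \<phi> ` P" if xy: "x \<in> \<phi> ` P" "y \<in> \<phi> ` P" for x y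
  proof -
    obtain a b where ab: "x = \<phi> a" "y = \<phi> b" "a \<in> P" "b \<in> P" using xy by blast
    have "\<phi> (a \<oplus> b) \<in> \<phi> ` P" using id(3)[OF ab(3,4)] by (rule imageI)
    then show ?thesis using phi_add[OF PT[OF ab(3)] PT[OF ab(4)]] ab by simp
  qed
  show "x \<otimes>\<^bsub>k\<^esub> y \<in> \<phi> ` P" if xy: "x \<in> D" "y \<in> \<phi> ` P" for x y
  proof -
    have "x \<in> \<phi> ` R" using xy(1) phi_R by simp
    then obtain a b where ab: "x = \<phi> a" "y = \<phi> b" "a \<in> R" "b \<in> P" using xy(2) by blast
    have "\<phi> (a \<otimes> b) \<in> \<phi> ` P" using id(4)[OF ab(3,4)] by (rule imageI)
    moreover have "\<phi> (a \<otimes> b) = x \<otimes>\<^bsub>k\<^esub> y" using phi_mult[of a b] PT[OF ab(4)] R_T ab(1-3) by blast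
    ultimately show ?thesis by simp
  qed
  show "x \<in> \<phi> ` P \<or> y \<in> \<phi> ` P" if xy: "x \<in> D" "y \<in> D" "x \<otimes>\<^bsub>k\<^esub> y \<in> \<phi> ` P" for x y
  proof -
    have "x \<in> \<phi> ` R" "y \<in> \<phi> ` R" using xy phi_R by auto
    then obtain a b where ab: "x = \<phi> a" "y = \<phi> b" "a \<in> R" "b \<in> R" by blast
    have "\<phi> (a \<otimes> b) = x \<otimes>\<^bsub>k\<^esub> y" using phi_mult[of a b] R_T ab by blast
    then have "\<phi> (a \<otimes> b) \<in> \<phi> ` P" using xy(3) by simp
    then have "a \<otimes> b \<in> P" using image_prime_mem[OF P, of "a \<otimes> b"] T_closed(4) R_T ab by blast
    then show ?thesis using K.prime_inD(3)[OF P(1) ab(3,4)] ab by blast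
  qed
qed

lemma w_prime_image:
  assumes P: "w_prime K R P" "M \<subset> P" shows "w_prime k D (\<phi> ` P)"
proof -
  have p: "prime_in K R P" and n: "\<And>us. K.gv_list R us \<Longrightarrow> \<not> set us \<subseteq> P"
    using P(1) unfolding K.w_prime_iff[OF R_subring] by auto
  have MP: "M \<subseteq> P" using P(2) by blast
  obtain x where x: "x \<in> P" "x \<notin> M" using P(2) by blast
  have xT: "x \<in> T" using x(1) K.prime_inD(4)[OF p] R_T by blast
  have "\<phi> x \<in> \<phi> ` P" "\<phi> x \<noteq> \<zero>\<^bsub>k\<^esub>" using x phi_zero_iff[OF xT] by auto
  then have nz: "\<phi> ` P \<noteq> {\<zero>\<^bsub>k\<^esub>}" by blast
  have "\<not> set ds \<subseteq> \<phi> ` P" if ds: "k.gv_list D ds" for ds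
  proof
    assume sub: "set ds \<subseteq> \<phi> ` P"
    obtain us where us: "K.gv_list R us" "\<phi> ` set us \<subseteq> set ds \<union> {\<zero>\<^bsub>k\<^esub>}" by (rule gv_D_R[OF ds])
    have z: "\<zero>\<^bsub>k\<^esub> \<in> \<phi> ` P" using k.prime_inD(5)[OF image_prime[OF p MP]] .
    have "u \<in> P" if u: "u \<in> set us" for u
    proof (rule image_prime_mem[OF p MP])
      show "u \<in> T" using K.gv_listD(1)[OF us(1)] R_T u by blast
      have "\<phi> u \<in> set ds \<union> {\<zero>\<^bsub>k\<^esub>}" using subsetD[OF us(2) imageI[OF u]] .
      moreover have "set ds \<union> {\<zero>\<^bsub>k\<^esub>} \<subseteq> \<phi> ` P" using sub z by simp
      ultimately show "\<phi> u \<in> \<phi> ` P" by (rule rev_subsetD)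
    qed
    then show False using n[OF us(1)] by blast
  qed
  then show ?thesis unfolding k.w_prime_iff[OF D] using image_prime[OF p MP] nz by blast
qed

text \<open>The prime of \<open>T\<close> lying over a prime of \<open>R\<close> that does not contain \<open>M\<close>.\<close>

definition up :: "'a set \<Rightarrow> 'a set" where "up P = {t \<in> T. \<forall>m\<in>M. t \<otimes> m \<in> P}"

context
  fixes P
  assumes P: "prime_in K R P" and nM: "\<not> M \<subseteq> P"
begin

lemma up_prime: "prime_in K T (up P)"
  unfolding prime_in_def ideal_in_def
proof (intro conjI ballI impI)
  note id = K.ideal_inD[OF K.prime_inD(1)[OF P]]
  have Mc: "m \<in> M \<Longrightarrow> m \<in> carrier K" for m using M_sub Tc by blast
  show "up P \<subseteq> T" unfolding up_def by blast
  show "\<zero> \<in> up P" unfolding up_def using T_closed(1) id(2) Mc by simp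
  show "\<one> \<notin> up P" unfolding up_def using nM Mc by auto
  show "s \<oplus> t \<in> up P" if "s \<in> up P" "t \<in> up P" for s t
  proof -
    have st: "s \<in> T" "t \<in> T" "\<And>m. m \<in> M \<Longrightarrow> s \<otimes> m \<in> P \<and> t \<otimes> m \<in> P" using that unfolding up_def by auto
    have "(s \<oplus> t) \<otimes> m \<in> P" if m: "m \<in> M" for m
      using id(3)[of "s \<otimes> m" "t \<otimes> m"] st(3)[OF m] K.l_distr[OF Tc[OF st(1)] Tc[OF st(2)] Mc[OF m]] by simp
    then show ?thesis unfolding up_def using T_closed(5) st by blast
  qed
  show "b \<otimes> t \<in> up P" if "b \<in> T" "t \<in> up P" for b t
  proof -
    have bt: "b \<in> T" "t \<in> T" "\<And>m. m \<in> M \<Longrightarrow> t \<otimes> m \<in> P" using that unfolding up_def by auto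
    have "(b \<otimes> t) \<otimes> m \<in> P" if m: "m \<in> M" for m
    proof -
      have "(b \<otimes> t) \<otimes> m = t \<otimes> (b \<otimes> m)" using bt m Tc Mc by (simp add: K.m_ac)
      then show ?thesis using bt(3)[OF MD(4)[OF bt(1) m]] by simp
    qed
    then show ?thesis unfolding up_def using T_closed(4) bt by blast
  qed
  show "a \<in> up P \<or> b \<in> up P" if ab: "a \<in> T" "b \<in> T" "a \<otimes> b \<in> up P" for a b
  proof (rule ccontr)
    assume "\<not> (a \<in> up P \<or> b \<in> up P)"
    then obtain m n where mn: "m \<in> M" "n \<in> M" "a \<otimes> m \<notin> P" "b \<otimes> n \<notin> P" using ab unfolding up_def by blast
    have R: "a \<otimes> m \<in> R" "b \<otimes> n \<in> R" using MD(4) ab mn M_R by auto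
    have "m \<otimes> n \<in> M" using M_mult_r mn M_sub by blast
    then have "(a \<otimes> b) \<otimes> (m \<otimes> n) \<in> P" using ab(3) unfolding up_def by blast
    moreover have "(a \<otimes> b) \<otimes> (m \<otimes> n) = (a \<otimes> m) \<otimes> (b \<otimes> n)" using Tc ab Mc mn by (simp add: K.m_ac)
    ultimately show False using K.prime_inD(3)[OF P R] mn by simp
  qed
qed

lemma up_Int_R: "up P \<inter> R = P"
proof
  show "P \<subseteq> up P \<inter> R"
  proof
    fix x assume x: "x \<in> P"
    then have "x \<in> R" using K.prime_inD(4)[OF P] by blast
    then show "x \<in> up P \<inter> R" unfolding up_def
      using R_T M_R K.ideal_in_r[OF R_subring K.prime_inD(1)[OF P] _ x] by blast
  qed
  show "up P \<inter> R \<subseteq> P"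
  proof
    fix x assume x: "x \<in> up P \<inter> R"
    obtain m where m: "m \<in> M" "m \<notin> P" using nM by blast
    have "x \<otimes> m \<in> P" using x m unfolding up_def by blast
    then show "x \<in> P" using K.prime_inD(3)[OF P, of x m] x m M_R by blast
  qed
qed

end

lemma up_mono: "P \<subseteq> P' \<Longrightarrow> up P \<subseteq> up P'"
  unfolding up_def by blast

lemma up_strict_mono:
  assumes "prime_in K R P" "\<not> M \<subseteq> P" "prime_in K R P'" "\<not> M \<subseteq> P'" "P \<subset> P'"
  shows "up P \<subset> up P'"
  using up_mono[of P P'] up_Int_R[OF assms(1,2)] up_Int_R[OF assms(3,4)] assms(5) by blast

text \<open>Otherwise the prime of \<open>T\<close> contains an element \<open>q\<close> with residue one, which belongs to \<open>R\<close>, and \<open>P'\<close> contains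
both \<open>q\<close> and \<open>1 - q\<close>.\<close>

lemma up_sub_M:
  assumes P: "prime_in K R P" "\<not> M \<subseteq> P" and P': "prime_in K R P'" "M \<subseteq> P'" "P \<subseteq> P'"
  shows "up P \<subseteq> M"
proof (rule ccontr)
  assume n: "\<not> up P \<subseteq> M"
  obtain q where q: "q \<in> up P" "q \<in> T" "\<phi> q = \<one>\<^bsub>k\<^esub>" "\<one> \<ominus> q \<in> M"
    using ideal_not_in_M[OF K.prime_inD(1)[OF up_prime[OF P]] n] .
  have "q \<in> R" unfolding R_def using q subringE(3)[OF D] by simp
  then have "q \<in> P'" using q(1) up_Int_R[OF P] P'(3) by blast
  then show False using K.prime_in_no_complement[OF P'(1) _ Tc[OF q(2)]] q(4) P'(2) by blast
qed

text \<open>In a chain the prime \<open>P'\<close> is the top.  The primes of \<open>T\<close> over smaller members may lie inside \<open>M\<close>, but a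
Glaz-Vasconcelos ideal in one of them also lies in the prime over the top, which then contains one of \<open>R\<close>.\<close>

lemma up_w_prime:
  assumes P: "prime_in K R P" "\<not> M \<subseteq> P" "P \<noteq> {\<zero>}" and P': "w_prime K R P'" "\<not> M \<subseteq> P'" "P \<subseteq> P'" "\<not> up P' \<subseteq> M"
  shows "w_prime K T (up P)"
proof -
  have p': "prime_in K R P'" and n: "\<And>us. K.gv_list R us \<Longrightarrow> \<not> set us \<subseteq> P'"
    using P'(1) unfolding K.w_prime_iff[OF R_subring] by auto
  have "\<not> set us \<subseteq> up P" if us: "K.gv_list T us" for us
  proof
    assume "set us \<subseteq> up P"
    then have "set us \<subseteq> up P'" using up_mono[OF P'(3)] by blast
    then obtain vs where vs: "K.gv_list R vs" "set vs \<subseteq> up P'"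
      using gv_T_R[OF us K.prime_inD(1)[OF up_prime[OF p' P'(2)]] P'(4)] by blast
    then have "set vs \<subseteq> P'" using up_Int_R[OF p' P'(2)] K.gv_listD(1)[OF vs(1)] by blast
    then show False using n[OF vs(1)] by blast
  qed
  moreover have "up P \<noteq> {\<zero>}" using up_Int_R[OF P(1,2)] P(3) K.prime_inD(5)[OF P(1)] by blast
  ultimately show ?thesis unfolding K.w_prime_iff[OF T] using up_prime[OF P(1,2)] by blast
qed

lemma contract_w_prime:
  assumes Q: "w_prime K T Q" shows "w_prime K R (Q \<inter> R)"
proof -
  have q: "prime_in K T Q" "Q \<noteq> {\<zero>}" and n: "\<And>us. K.gv_list T us \<Longrightarrow> \<not> set us \<subseteq> Q"
    using Q unfolding K.w_prime_iff[OF T] by auto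
  have "prime_in K R (Q \<inter> R)" by (rule K.prime_in_contract[OF R_subring T R_T q(1)])
  moreover have "Q \<inter> R \<noteq> {\<zero>}"
  proof -
    obtain t where t: "t \<in> Q" "t \<noteq> \<zero>" using q K.prime_inD(5)[OF q(1)] by blast
    obtain m where m: "m \<in> M" "m \<noteq> \<zero>" using M_nonzero zero_M by blast
    have tT: "t \<in> T" using t(1) K.prime_inD(4)[OF q(1)] by blast
    have "t \<otimes> m \<in> Q" using K.ideal_in_r[OF T K.prime_inD(1)[OF q(1)] _ t(1)] m M_sub by blast
    moreover have "t \<otimes> m \<in> R" using MD(4)[OF tT m(1)] M_R by blast
    moreover have "t \<otimes> m \<noteq> \<zero>" using t m tT M_sub Tc by (intro K.mult_nonzero) auto
    ultimately show ?thesis by blast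
  qed
  moreover have "\<not> set us \<subseteq> Q \<inter> R" if "K.gv_list R us" for us using n[OF gv_R_T[OF that]] by blast
  ultimately show ?thesis unfolding K.w_prime_iff[OF R_subring] by blast
qed

text \<open>Multiplication by an element of \<open>M\<close> outside \<open>Q\<close> moves \<open>T\<close> into \<open>R\<close>.\<close>

lemma contract_inj:
  assumes Q: "prime_in K T Q" "\<not> M \<subseteq> Q" and Q': "prime_in K T Q'" and sub: "Q' \<inter> R \<subseteq> Q \<inter> R"
  shows "Q' \<subseteq> Q"
proof
  fix t assume t: "t \<in> Q'"
  obtain m where m: "m \<in> M" "m \<notin> Q" using Q(2) by blast
  have tT: "t \<in> T" using t K.prime_inD(4)[OF Q'] by blast
  have "t \<otimes> m \<in> Q'" using K.ideal_in_r[OF T K.prime_inD(1)[OF Q'] _ t] m M_sub by blast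
  then have "t \<otimes> m \<in> Q" using MD(4)[OF tT m(1)] M_R sub by blast
  then show "t \<in> Q" using K.prime_inD(3)[OF Q(1) tT] m M_sub by blast
qed

abbreviation dimTM where "dimTM \<equiv> krull_dim (K\<lparr>carrier := localize K T M\<rparr>)"

lemmas dimTM_iff = K.enat_le_krull_dim_localize_iff[OF T M_prime]

lemma chain_mono:
  fixes P :: "nat \<Rightarrow> 'e set"
  assumes "\<And>i. Suc i < n \<Longrightarrow> P i \<subset> P (Suc i)" "i \<le> j" "j < n"
  shows "P i \<subseteq> P j"
  using assms(2,3)
proof (induction j)
  case (Suc j)
  then show ?case using assms(1)[of j] by (cases "i = Suc j") auto
qed simp

lemma w_dim_upper: "w_dim K R \<le> max (w_dim K T) (w_dim k D + dimTM)"
proof (rule enat_leI)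
  fix n assume "enat n \<le> w_dim K R"
  then obtain P where P: "\<And>i. i < n \<Longrightarrow> w_prime K R (P i)" "\<And>i. Suc i < n \<Longrightarrow> P i \<subset> P (Suc i)"
    unfolding K.enat_le_w_dim_iff by blast
  have Pp: "prime_in K R (P i)" "P i \<noteq> {\<zero>}" if "i < n" for i
    using P(1)[OF that] unfolding K.w_prime_iff[OF R_subring] by auto
  have mono: "P i \<subseteq> P j" if "i \<le> j" "j < n" for i j
    by (rule chain_mono[of n P]) (use P(2) that in auto)
  show "enat n \<le> max (w_dim K T) (w_dim k D + dimTM)"
  proof (cases "n = 0")
    case True then show ?thesis by (simp add: zero_enat_def[symmetric])
  next
    case False
    then have last: "n - 1 < n" by simp
    have below: "P i \<subseteq> P (n - 1)" if "i < n" for i using mono[of i "n - 1"] that last by simp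
    show ?thesis
    proof (cases "\<not> M \<subseteq> P (n - 1) \<and> \<not> up (P (n - 1)) \<subseteq> M")
      case True
      have nM: "\<not> M \<subseteq> P i" if "i < n" for i using True below[OF that] by blast
      have "w_prime K T (up (P i))" if i: "i < n" for i
        by (rule up_w_prime[OF Pp(1)[OF i] nM[OF i] Pp(2)[OF i] P(1)[OF last] _ below[OF i]]) (use True in auto)
      moreover have "up (P i) \<subset> up (P (Suc i))" if i: "Suc i < n" for i
        using up_strict_mono[OF Pp(1) nM Pp(1) nM P(2)[OF i]] i by simp
      ultimately have "enat n \<le> w_dim K T"
        unfolding K.enat_le_w_dim_iff by (intro exI[of _ "\<lambda>i. up (P i)"]) simp
      then show ?thesis by (simp add: le_max_iff_disj)
    next
      case False
      have sub: "up (P i) \<subseteq> M" if i: "i < n" "\<not> M \<subseteq> P i" for i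
      proof (cases "M \<subseteq> P (n - 1)")
        case True
        then show ?thesis using up_sub_M[OF Pp(1)[OF i(1)] i(2) Pp(1)[OF last] True below[OF i(1)]] by blast
      next
        case f: False
        then show ?thesis using False up_mono[OF below[OF i(1)]] by blast
      qed
      \<comment> \<open>below \<open>j\<close> the chain consists of primes of \<open>T\<close> inside \<open>M\<close>, from \<open>j\<close> on of primes containing \<open>M\<close>\<close>
      define j where "j = (LEAST i. n \<le> i \<or> M \<subseteq> P i)"
      have j: "n \<le> j \<or> M \<subseteq> P j" unfolding j_def by (rule LeastI[of _ n]) simp
      have jn: "j \<le> n" unfolding j_def by (rule Least_le) simp
      have lt: "\<not> M \<subseteq> P i" if "i < j" for i
        using not_less_Least[of i "\<lambda>i. n \<le> i \<or> M \<subseteq> P i"] that unfolding j_def by auto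
      \<comment> \<open>zero and \<open>M\<close> are added at the two ends, since the Krull dimension counts inclusions\<close>
      define Q where "Q = (\<lambda>i. if i = 0 then {\<zero>} else if i \<le> j then up (P (i - 1)) else M)"
      have Qp: "prime_in K T (Q i) \<and> Q i \<subseteq> M" for i
      proof -
        consider "i = 0" | "i \<noteq> 0" "i \<le> j" | "j < i" by linarith
        then show ?thesis
        proof cases
          case 1
          then show ?thesis using K.prime_in_zero[OF T] zero_M unfolding Q_def by simp
        next
          case 2
          then have i: "i - 1 < n" "i - 1 < j" using jn by auto
          have "prime_in K T (up (P (i - 1)))" using up_prime[OF Pp(1)[OF i(1)] lt[OF i(2)]] .
          moreover have "up (P (i - 1)) \<subseteq> M" using sub[OF i(1) lt[OF i(2)]] .
          ultimately show ?thesis using 2 unfolding Q_def by simp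
        next
          case 3
          then show ?thesis using M_prime unfolding Q_def by simp
        qed
      qed
      have up_ne: "up (P i) \<noteq> M" if "i < j" for i
      proof
        assume e: "up (P i) = M"
        have "i < n" using that jn by simp
        then have "M \<inter> R = P i" using up_Int_R[OF Pp(1) lt[OF that]] e by simp
        then show False using lt[OF that] M_R by blast
      qed
      have Qs: "Q i \<subset> Q (Suc i)" if i: "i \<le> j" for i
      proof -
        consider "i = 0" "j = 0" | "i = 0" "0 < j" | "i \<noteq> 0" "i < j" | "i \<noteq> 0" "i = j" using i by linarith
        then show ?thesis
        proof cases
          case 1 then show ?thesis unfolding Q_def using zero_M M_nonzero by auto
        next
          case 2
          then have "0 < n" using jn by simp
          have "up (P 0) \<inter> R = P 0" using up_Int_R[OF Pp(1)[OF \<open>0 < n\<close>] lt[OF 2(2)]] .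
          then have "{\<zero>} \<subset> up (P 0)" using Pp(2)[OF \<open>0 < n\<close>] K.prime_inD(5)[OF Pp(1)[OF \<open>0 < n\<close>]] by blast
          then show ?thesis unfolding Q_def using 2 by simp
        next
          case 3
          then have i: "i - 1 < n" "i < n" "i - 1 < j" using jn by auto
          have "P (i - 1) \<subset> P i" using P(2)[of "i - 1"] 3 i by simp
          then have "up (P (i - 1)) \<subset> up (P i)"
            using up_strict_mono[OF Pp(1)[OF i(1)] lt[OF i(3)] Pp(1)[OF i(2)] lt[OF 3(2)]] by blast
          then show ?thesis unfolding Q_def using 3 by simp
        next
          case 4
          then have i: "i - 1 < n" "i - 1 < j" using jn by auto
          have "up (P (i - 1)) \<subset> M" using sub[OF i(1) lt[OF i(2)]] up_ne[OF i(2)] by blast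
          then show ?thesis unfolding Q_def using 4 by simp
        qed
      qed
      show ?thesis
      proof (cases "j = n")
        case True
        have "enat n \<le> dimTM"
          unfolding dimTM_iff by (rule exI[of _ Q]) (use Qp Qs True in auto)
        then have "enat n \<le> w_dim k D + dimTM" using add_increasing[OF zero_le] by blast
        then show ?thesis by (simp add: le_max_iff_disj)
      next
        case f: False
        then have jn': "j < n" "M \<subseteq> P j" using j jn by auto
        have 1: "enat (Suc j) \<le> dimTM"
          unfolding dimTM_iff by (rule exI[of _ Q]) (use Qp Qs in auto)
        have above: "M \<subset> P (Suc j + i)" if i: "Suc j + i < n" for i
          using P(2)[of j] mono[of "Suc j" "Suc j + i"] i jn'(2) by auto
        have 2: "enat (n - Suc j) \<le> w_dim k D"
          unfolding k.enat_le_w_dim_iff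
        proof (intro exI[of _ "\<lambda>i. \<phi> ` P (Suc j + i)"] conjI allI impI)
          fix i assume i: "i < n - Suc j"
          show "w_prime k D (\<phi> ` P (Suc j + i))"
            using w_prime_image[OF P(1) above] i by simp
        next
          fix i assume i: "Suc i < n - Suc j"
          then have ii: "Suc j + i < n" "Suc j + Suc i < n" by auto
          have s: "P (Suc j + i) \<subset> P (Suc j + Suc i)" using P(2)[of "Suc j + i"] ii by simp
          then obtain x where x: "x \<in> P (Suc j + Suc i)" "x \<notin> P (Suc j + i)" by blast
          have xT: "x \<in> T" using x(1) K.prime_inD(4)[OF Pp(1)[OF ii(2)]] R_T by blast
          have MP: "M \<subseteq> P (Suc j + i)" using above[OF ii(1)] by blast
          have "\<phi> x \<notin> \<phi> ` P (Suc j + i)"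
            using image_prime_mem[OF Pp(1)[OF ii(1)] MP xT] x(2) by blast
          then show "\<phi> ` P (Suc j + i) \<subset> \<phi> ` P (Suc j + Suc i)" using s x(1) by blast
        qed
        have "enat n = enat (n - Suc j) + enat (Suc j)" using jn' by simp
        also have "\<dots> \<le> w_dim k D + dimTM" by (rule add_mono[OF 2 1])
        finally show ?thesis by (simp add: le_max_iff_disj)
      qed
    qed
  qed
qed

text \<open>Ideals of \<open>T\<close> inside \<open>M\<close> are subsets of \<open>R\<close>, so a chain of primes of \<open>T\<close> inside \<open>M\<close>, without its first
member, continues with the preimages of a chain of \<open>w\<close>-primes of \<open>D\<close>.  These strictly contain \<open>M\<close>, because
\<open>w\<close>-primes are nonzero.\<close>

lemma w_dim_lower_D: "w_dim k D + dimTM \<le> w_dim K R"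
proof (rule enat_leI)
  fix n assume "enat n \<le> w_dim k D + dimTM"
  then obtain a b where n: "n = a + b" "enat a \<le> w_dim k D" "enat b \<le> dimTM" by (rule enat_le_plusE)
  obtain p where p: "\<And>i. i < a \<Longrightarrow> w_prime k D (p i)" "\<And>i. Suc i < a \<Longrightarrow> p i \<subset> p (Suc i)"
    using n(2) unfolding k.enat_le_w_dim_iff by blast
  obtain Q where Q: "\<And>i. i \<le> b \<Longrightarrow> prime_in K T (Q i)" "\<And>i. i \<le> b \<Longrightarrow> Q i \<subseteq> M" "\<And>i. i < b \<Longrightarrow> Q i \<subset> Q (Suc i)"
    using n(3) unfolding dimTM_iff by blast
  show "enat n \<le> w_dim K R"
    unfolding K.enat_le_w_dim_iff
  proof (intro exI[of _ "\<lambda>i. if i < b then Q (Suc i) else pre (p (i - b))"] conjI allI impI)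
    fix i assume i: "i < n"
    show "w_prime K R (if i < b then Q (Suc i) else pre (p (i - b)))"
    proof (cases "i < b")
      case True
      have "Q (Suc i) \<noteq> {\<zero>}" using Q(3)[OF True] K.prime_inD(5)[OF Q(1)[of i]] True by auto
      then show ?thesis using w_prime_R_if_sub_M[OF Q(1,2)[of "Suc i"]] True by simp
    next
      case False
      then show ?thesis using w_prime_pre(1)[OF p(1)[of "i - b"]] i n(1) by simp
    qed
  next
    fix i assume i: "Suc i < n"
    consider "Suc i < b" | "Suc i = b" | "b \<le> i" by linarith
    then show "(if i < b then Q (Suc i) else pre (p (i - b))) \<subset>
        (if Suc i < b then Q (Suc (Suc i)) else pre (p (Suc i - b)))"
    proof cases
      case 1 then show ?thesis using Q(3)[of "Suc i"] by simp
    next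
      case 2
      have "Q (Suc i) \<subset> pre (p 0)" using w_prime_pre(2)[OF p(1)[of 0]] Q(2)[of "Suc i"] 2 i n(1) by auto
      then show ?thesis using 2 by simp
    next
      case 3
      have lt: "Suc (i - b) < a" using i n(1) 3 by simp
      obtain y where y: "y \<in> p (Suc (i - b))" "y \<notin> p (i - b)" using p(2)[OF lt] by blast
      have "prime_in k D (p (Suc (i - b)))" using p(1)[OF lt] unfolding k.w_prime_iff[OF D] by blast
      then have "y \<in> \<phi> ` T" using y(1) k.prime_inD(4) k.subring_carrier[OF D] phi_surj by blast
      then obtain x where x: "x \<in> T" "\<phi> x = y" by blast
      have "x \<in> pre (p (Suc (i - b)))" "x \<notin> pre (p (i - b))" using x y unfolding pre_def by auto
      moreover have "pre (p (i - b)) \<subseteq> pre (p (Suc (i - b)))" unfolding pre_def using p(2)[OF lt] by blast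
      ultimately have "pre (p (i - b)) \<subset> pre (p (Suc (i - b)))" by blast
      then show ?thesis using 3 by (simp add: Suc_diff_le)
    qed
  qed
qed

lemma w_dim_lower_T: "w_dim K T \<le> w_dim K R"
proof (rule enat_leI)
  fix n assume "enat n \<le> w_dim K T"
  then obtain Q where Q: "\<And>i. i < n \<Longrightarrow> w_prime K T (Q i)" "\<And>i. Suc i < n \<Longrightarrow> Q i \<subset> Q (Suc i)"
    unfolding K.enat_le_w_dim_iff by blast
  have Qp: "prime_in K T (Q i)" "Q i \<noteq> {\<zero>}" if "i < n" for i
    using Q(1)[OF that] unfolding K.w_prime_iff[OF T] by auto
  show "enat n \<le> w_dim K R"
  proof (cases "n = 0 \<or> \<not> Q (n - 1) \<subseteq> M")
    case True
    have nM: "\<not> M \<subseteq> Q i" if i: "i < n" for i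
    proof
      assume Mi: "M \<subseteq> Q i"
      have "Q i \<subseteq> M"
      proof (rule ccontr)
        assume n: "\<not> Q i \<subseteq> M"
        obtain q where q: "q \<in> Q i" "q \<in> T" "\<one> \<ominus> q \<in> M"
          using ideal_not_in_M[OF K.prime_inD(1)[OF Qp(1)[OF i]] n] by blast
        then show False using K.prime_in_no_complement[OF Qp(1)[OF i] q(1) Tc[OF q(2)]] Mi by blast
      qed
      then have "i \<noteq> n - 1" using True i by auto
      then have s: "Suc i < n" using i by simp
      have big: "Q i \<subset> Q (Suc i)" using Q(2)[OF s] .
      then have n: "\<not> Q (Suc i) \<subseteq> M" using Mi by blast
      obtain q where q: "q \<in> Q (Suc i)" "q \<in> T" "\<one> \<ominus> q \<in> M"
        using ideal_not_in_M[OF K.prime_inD(1)[OF Qp(1)[OF s]] n] by blast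
      then show False using K.prime_in_no_complement[OF Qp(1)[OF s] q(1) Tc[OF q(2)]] Mi big by blast
    qed
    show ?thesis
      unfolding K.enat_le_w_dim_iff
    proof (intro exI[of _ "\<lambda>i. Q i \<inter> R"] conjI allI impI)
      show "w_prime K R (Q i \<inter> R)" if "i < n" for i using contract_w_prime[OF Q(1)[OF that]] .
      fix i assume i: "Suc i < n"
      then have i': "i < n" by simp
      have "\<not> Q (Suc i) \<inter> R \<subseteq> Q i \<inter> R"
        using contract_inj[OF Qp(1)[OF i'] nM[OF i'] Qp(1)[OF i]] Q(2)[OF i] by blast
      then show "Q i \<inter> R \<subset> Q (Suc i) \<inter> R" using Q(2)[OF i] by blast
    qed
  next
    case False
    have sub: "Q i \<subseteq> M" if i: "i < n" for i
    proof -
      have "Q i \<subseteq> Q (n - 1)" by (rule chain_mono[of n Q]) (use Q(2) i in auto)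
      then show ?thesis using False by blast
    qed
    have "enat n \<le> dimTM"
      unfolding dimTM_iff
    proof (intro exI[of _ "\<lambda>i. if i = 0 then {\<zero>} else Q (i - 1)"] conjI allI impI)
      fix i assume i: "i \<le> n"
      show "prime_in K T (if i = 0 then {\<zero>} else Q (i - 1))" using K.prime_in_zero[OF T] Qp(1)[of "i - 1"] i by simp
      show "(if i = 0 then {\<zero>} else Q (i - 1)) \<subseteq> M" using zero_M sub[of "i - 1"] i by simp
    next
      fix i assume i: "i < n"
      show "(if i = 0 then {\<zero>} else Q (i - 1)) \<subset> (if Suc i = 0 then {\<zero>} else Q (Suc i - 1))"
      proof (cases "i = 0")
        case True
        then show ?thesis using Qp[OF i] K.prime_inD(5)[OF Qp(1)[OF i]] by auto
      next
        case False
        then show ?thesis using Q(2)[of "i - 1"] i by simp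
      qed
    qed
    then have "enat n \<le> w_dim k D + dimTM" using add_increasing[OF zero_le] by blast
    then show ?thesis using w_dim_lower_D order_trans by blast
  qed
qed

theorem w_dim_pullback: "w_dim K R = max (w_dim K T) (w_dim k D + dimTM)"
  using w_dim_upper w_dim_lower_D w_dim_lower_T by (simp add: antisym)

end

section \<open>The w-valuative dimension of the pullback\<close>

context pullback
begin

abbreviation TM where "TM \<equiv> localize K T M"
abbreviation F where "F \<equiv> qf k D"

lemma F_subfield: "subfield F k"
  by (rule k.qf_subfield[OF D])

lemma F_carrier: "F \<subseteq> carrier k"
  using subringE(1)[OF subfieldE(1)[OF F_subfield]] .

lemma TM_subset_iff:
  assumes W: "val_ring K L W"
  shows "TM \<subseteq> W \<longleftrightarrow> T \<subseteq> W \<and> nonunits K W \<inter> T \<subseteq> M"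
  using K.localize_subset_iff[OF T M_prime L W] K.localize_subring(2)[OF T M_prime] by blast

lemma enat_le_val_dim_TM_iff:
  "enat n \<le> val_dim K TM \<longleftrightarrow>
    (\<exists>W. val_ring K L W \<and> T \<subseteq> W \<and> nonunits K W \<inter> T \<subseteq> M \<and> ring_chain K L W n)"
  unfolding K.enat_le_val_dim_iff[OF K.localize_subring(1)[OF T M_prime]]
    K.localize_subring(4)[OF T M_prime]
  using TM_subset_iff by blast

lemma residue_field_T:
  assumes "T \<subseteq> W" "M \<subseteq> nonunits K W" shows "K.residue_field W T"
  unfolding K.residue_field_def
proof (intro conjI ballI impI)
  fix t assume t: "t \<in> T" "t \<notin> nonunits K W"
  then have "t \<notin> M" using assms(2) by blast
  then show "\<exists>b\<in>T. t \<otimes> b \<ominus> \<one> \<in> nonunits K W" using inverse_mod_M[OF t(1)] assms(2) by blast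
qed (use T assms in auto)

lemma k_residue_field:
  assumes "F \<subseteq> E" "nonunits k E \<inter> F \<subseteq> {\<zero>\<^bsub>k\<^esub>}" "\<zero>\<^bsub>k\<^esub> \<in> nonunits k E"
  shows "k.residue_field E F"
  unfolding k.residue_field_def
proof (intro conjI ballI impI)
  show "subring F k" by (rule subfieldE(1)[OF F_subfield])
  show "F \<subseteq> E" by (rule assms(1))
  fix a assume a: "a \<in> F" "a \<notin> nonunits k E"
  then have nz: "a \<noteq> \<zero>\<^bsub>k\<^esub>" "a \<in> carrier k" using assms(3) F_carrier by auto
  have "a \<otimes>\<^bsub>k\<^esub> inv\<^bsub>k\<^esub> a \<ominus>\<^bsub>k\<^esub> \<one>\<^bsub>k\<^esub> = \<zero>\<^bsub>k\<^esub>" using nz by (simp add: k.minus_eq k.r_neg)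
  then show "\<exists>b\<in>F. a \<otimes>\<^bsub>k\<^esub> b \<ominus>\<^bsub>k\<^esub> \<one>\<^bsub>k\<^esub> \<in> nonunits k E"
    using assms(3) k.subfield_inv[OF F_subfield a(1) nz(1)] by (intro bexI[of _ "inv\<^bsub>k\<^esub> a"]) auto
qed

lemma saturated:
  assumes A: "subring A K" "M \<subseteq> A" "A \<subseteq> T" and t: "t \<in> T" "\<phi> t \<in> \<phi> ` A"
  shows "t \<in> A"
proof -
  obtain a where a: "a \<in> A" "\<phi> t = \<phi> a" using t(2) by blast
  have aT: "a \<in> T" using a A(3) by blast
  have "t \<ominus> a \<in> A" using phi_eq_iff[OF t(1) aT] a(2) A(2) by blast
  then have "(t \<ominus> a) \<oplus> a \<in> A" using subringE(7)[OF A(1)] a(1) by blast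
  moreover have "(t \<ominus> a) \<oplus> a = t" using Tc[OF t(1)] Tc[OF aT] by algebra
  ultimately show ?thesis by simp
qed

lemma image_ring_chain:
  assumes "ring_chain K T B s" "M \<subseteq> B" shows "ring_chain k (carrier k) (\<phi> ` B) s"
proof -
  obtain Zs where Zs: "\<And>i. i \<le> s \<Longrightarrow> subring (Zs i) K" "\<And>i. i \<le> s \<Longrightarrow> B \<subseteq> Zs i" "\<And>i. i \<le> s \<Longrightarrow> Zs i \<subseteq> T"
      "\<And>i. i < s \<Longrightarrow> Zs (Suc i) \<subset> Zs i" by (rule ring_chainE[OF assms(1)]) blast
  show ?thesis
  proof (rule ring_chainI[of _ "\<lambda>i. \<phi> ` Zs i"])
    fix i assume i: "i \<le> s"
    show "subring (\<phi> ` Zs i) k" by (rule image_subring[OF Zs(1)[OF i] Zs(3)[OF i]])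
    show "\<phi> ` B \<subseteq> \<phi> ` Zs i" by (rule image_mono[OF Zs(2)[OF i]])
    show "\<phi> ` Zs i \<subseteq> carrier k" unfolding phi_surj[symmetric] by (rule image_mono[OF Zs(3)[OF i]])
  next
    fix i assume i: "i < s"
    have le: "i \<le> s" "Suc i \<le> s" using i by auto
    obtain t where t: "t \<in> Zs i" "t \<notin> Zs (Suc i)" using Zs(4)[OF i] by blast
    have tT: "t \<in> T" using t(1) Zs(3)[OF le(1)] by blast
    have MZ: "M \<subseteq> Zs (Suc i)" using assms(2) Zs(2)[OF le(2)] by blast
    have "\<phi> t \<notin> \<phi> ` Zs (Suc i)" using saturated[OF Zs(1)[OF le(2)] MZ Zs(3)[OF le(2)] tT] t(2) by blast
    moreover have "\<phi> t \<in> \<phi> ` Zs i" using t(1) by (rule imageI)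
    moreover have "\<phi> ` Zs (Suc i) \<subseteq> \<phi> ` Zs i" using Zs(4)[OF i] by (intro image_mono) blast
    ultimately show "\<phi> ` Zs (Suc i) \<subset> \<phi> ` Zs i" by blast
  qed
qed

lemma pre_ring_chain:
  assumes "ring_chain k (carrier k) E s" shows "ring_chain K T (pre E) s"
proof -
  obtain Zs where Zs: "\<And>i. i \<le> s \<Longrightarrow> subring (Zs i) k" "\<And>i. i \<le> s \<Longrightarrow> E \<subseteq> Zs i" "\<And>i. i \<le> s \<Longrightarrow> Zs i \<subseteq> carrier k"
      "\<And>i. i < s \<Longrightarrow> Zs (Suc i) \<subset> Zs i" by (rule ring_chainE[OF assms(1)]) blast
  show ?thesis
  proof (rule ring_chainI[of _ "\<lambda>i. pre (Zs i)"])
    fix i assume i: "i \<le> s"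
    show "subring (pre (Zs i)) K" by (rule pre_subring(1)[OF Zs(1)[OF i]])
    show "pre E \<subseteq> pre (Zs i)" "pre (Zs i) \<subseteq> T" using Zs(2)[OF i] unfolding pre_def by auto
  next
    fix i assume i: "i < s"
    obtain y where y: "y \<in> Zs i" "y \<notin> Zs (Suc i)" using Zs(4)[OF i] by blast
    have "y \<in> \<phi> ` T" using y(1) Zs(3)[of i] i phi_surj by auto
    then obtain t where t: "t \<in> T" "\<phi> t = y" by blast
    have "t \<in> pre (Zs i)" "t \<notin> pre (Zs (Suc i))" using t y unfolding pre_def by auto
    moreover have "pre (Zs (Suc i)) \<subseteq> pre (Zs i)" using Zs(4)[OF i] unfolding pre_def by blast
    ultimately show "pre (Zs (Suc i)) \<subset> pre (Zs i)" by blast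
  qed
qed

text \<open>If \<open>M\<close> consists of nonunits of \<open>V\<close>, then \<open>V\<close> induces a valuation ring on \<open>k\<close>: an inverse of \<open>t\<close> modulo \<open>M\<close>
differs from \<open>inv t\<close> by a factor \<open>1 + m\<close> with \<open>m\<close> in \<open>M\<close>, which lies in \<open>V\<close>.\<close>

lemma residue_val_ring:
  assumes V: "val_ring K L V" and MV: "M \<subseteq> nonunits K V"
  shows "val_ring k (carrier k) (\<phi> ` (T \<inter> V))"
    "\<And>t. t \<in> T \<inter> V \<Longrightarrow> \<phi> t \<in> nonunits k (\<phi> ` (T \<inter> V)) \<Longrightarrow> t \<in> nonunits K V"
proof -
  note V' = K.val_ringD[OF V]
  let ?E = "\<phi> ` (T \<inter> V)"
  have sub: "subring (T \<inter> V) K"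
    using subringE[OF T] subringE[OF V'(1)] by (intro K.subringI) auto
  have M_V: "M \<subseteq> V" using MV unfolding nonunits_def by blast
  have inverse: "inv\<^bsub>k\<^esub> \<phi> t \<in> ?E" if t: "t \<in> T" "t \<notin> M" "inv t \<in> V" for t
  proof -
    obtain u where u: "u \<in> T" "\<phi> u = inv\<^bsub>k\<^esub> \<phi> t" "t \<otimes> u \<ominus> \<one> \<in> M" using inverse_mod_M[OF t(1,2)] by blast
    define m where "m = t \<otimes> u \<ominus> \<one>"
    have nz: "t \<noteq> \<zero>" using t(2) zero_M by blast
    have c: "t \<in> carrier K" "u \<in> carrier K" "m \<in> carrier K" "inv t \<in> carrier K"
      using Tc t u nz unfolding m_def by auto
    have "t \<otimes> u = \<one> \<oplus> m" unfolding m_def using c by algebra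
    then have "inv t \<otimes> (\<one> \<oplus> m) = (inv t \<otimes> t) \<otimes> u" using c by (simp add: K.m_assoc)
    also have "\<dots> = u" using c nz by simp
    finally have "u = inv t \<otimes> (\<one> \<oplus> m)" ..
    moreover have "\<one> \<oplus> m \<in> V" using u(3) M_V subringE(3,7)[OF V'(1)] unfolding m_def by blast
    ultimately have "u \<in> V" using subringE(6)[OF V'(1) t(3)] by simp
    then have "\<phi> u \<in> ?E" using u(1) by blast
    then show ?thesis using u(2) by simp
  qed
  show "val_ring k (carrier k) ?E"
    unfolding val_ring_def
  proof (intro conjI ballI)
    show "subring ?E k" by (rule image_subring[OF sub]) blast
    then show "?E \<subseteq> carrier k" by (rule subringE(1))
    fix y assume "y \<in> carrier k"
    then have "y \<in> \<phi> ` T" using phi_surj by simp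
    then obtain t where t: "t \<in> T" "y = \<phi> t" by blast
    show "y = \<zero>\<^bsub>k\<^esub> \<or> y \<in> ?E \<or> inv\<^bsub>k\<^esub> y \<in> ?E"
    proof (cases "t \<in> M")
      case True then show ?thesis using phi_zero_iff[OF t(1)] t(2) by blast
    next
      case False
      have "t \<in> V \<or> inv t \<in> V" using V'(3)[of t] t(1) T_L False zero_M by blast
      then show ?thesis using inverse[OF t(1) False] t by blast
    qed
  qed
  fix t assume t: "t \<in> T \<inter> V" "\<phi> t \<in> nonunits k ?E"
  show "t \<in> nonunits K V"
  proof (rule ccontr)
    assume n: "t \<notin> nonunits K V"
    then have "t \<notin> M" "inv t \<in> V" using MV t K.val_ring_unitD[OF V, of t] by auto
    then have "inv\<^bsub>k\<^esub> \<phi> t \<in> ?E" "\<phi> t \<noteq> \<zero>\<^bsub>k\<^esub>" using inverse[of t] t phi_zero_iff[of t] by auto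
    then show False using t(2) unfolding nonunits_def by blast
  qed
qed

lemma w_val_dim_upper:
  "w_val_dim K R \<le> max (w_val_dim K T) (w_val_dim k D + val_dim K TM + trdeg k F)"
proof (rule enat_leI)
  let ?sum = "w_val_dim k D + val_dim K TM + trdeg k F"
  fix n assume "enat n \<le> w_val_dim K R"
  then obtain V where V: "val_ring K L V" "R \<subseteq> V" and nogv: "\<And>us. K.gv_list R us \<Longrightarrow> \<not> set us \<subseteq> nonunits K V"
    and ch: "ring_chain K L V n"
    unfolding K.enat_le_w_val_dim_iff[OF R_subring] qf_R by blast
  note V' = K.val_ringD[OF V(1)] and pV = K.nonunits_prime[OF L V(1)]
  show "enat n \<le> max (w_val_dim K T) ?sum"
  proof (cases "M \<subseteq> nonunits K V")
    case False
    then obtain m where m: "m \<in> M" "m \<notin> nonunits K V" by blast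
    have mV: "m \<in> V" "m \<in> T" using m M_R V(2) M_sub by auto
    have mu: "m \<noteq> \<zero>" "inv m \<in> V" using K.val_ring_unitD[OF V(1) mV(1) m(2)] .
    \<comment> \<open>a unit of \<open>V\<close> in \<open>M\<close> is a denominator that brings \<open>T\<close> into \<open>R\<close>\<close>
    have TV: "T \<subseteq> V"
    proof
      fix t assume t: "t \<in> T"
      have "t \<otimes> m \<in> V" using MD(4)[OF t m(1)] M_R V(2) by blast
      then have "t \<otimes> m \<otimes> inv m \<in> V" using subringE(6)[OF V'(1)] mu by blast
      then show "t \<in> V" using Tc[OF t] Tc[OF mV(2)] mu by simp
    qed
    show ?thesis
    proof (cases "nonunits K V \<inter> T \<subseteq> M")
      case True
      then have "enat n \<le> val_dim K TM" unfolding enat_le_val_dim_TM_iff using V(1) TV ch by blast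
      also have "\<dots> \<le> ?sum" by (metis add.commute add_increasing2 order_refl zero_le)
      finally show ?thesis by (simp add: le_max_iff_disj)
    next
      case f: False
      have id: "ideal_in K T (nonunits K V \<inter> T)"
        using K.prime_inD(1)[OF K.prime_in_contract[OF T V'(1) TV pV]] .
      have "\<not> set us \<subseteq> nonunits K V" if us: "K.gv_list T us" for us
      proof
        assume "set us \<subseteq> nonunits K V"
        then have "set us \<subseteq> nonunits K V \<inter> T" using K.gv_listD(1)[OF us] by blast
        then obtain vs where "K.gv_list R vs" "set vs \<subseteq> nonunits K V \<inter> T" by (rule gv_T_R[OF us id f])
        then show False using nogv by blast
      qed
      then have "enat n \<le> w_val_dim K T" unfolding K.enat_le_w_val_dim_iff[OF T] using V(1) TV ch by blast
      then show ?thesis by (simp add: le_max_iff_disj)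
    qed
  next
    case MV: True
    \<comment> \<open>the smallest ring containing \<open>V\<close> and \<open>T\<close>; its centre on \<open>T\<close> is \<open>M\<close>\<close>
    define W where "W = K.set_prod V T"
    have W: "subring W K" "V \<subseteq> W" "T \<subseteq> W"
      unfolding W_def using K.set_prod_subring[OF L V(1) T T_L] .
    have WL: "W \<subseteq> L" unfolding W_def by (rule K.set_prod_subset[OF subfieldE(1)[OF L] V'(2) T_L])
    have vW: "val_ring K L W" using K.val_ring_over(1)[OF L V(1) W(1,2) WL] .
    note pW = K.nonunits_prime[OF L vW]
    have MW: "M \<subseteq> nonunits K W"
    proof
      fix m assume m: "m \<in> M"
      show "m \<in> nonunits K W"
      proof (rule ccontr)
        assume n: "m \<notin> nonunits K W"
        have mT: "m \<in> T" "m \<in> W" using m M_sub W(3) by auto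
        have mu: "m \<noteq> \<zero>" "inv m \<in> W" using K.val_ring_unitD[OF vW mT(2) n] .
        then obtain v t where vt: "inv m = v \<otimes> t" "v \<in> V" "t \<in> T" unfolding W_def K.set_prod_def by blast
        have c: "m \<in> carrier K" "v \<in> carrier K" "t \<in> carrier K"
          using Tc mT vt K.subring_carrier[OF V'(1)] by auto
        have "(m \<otimes> t) \<otimes> v = m \<otimes> inv m" unfolding vt(1) using c by (simp add: K.m_ac)
        also have "\<dots> = \<one>" using c mu by simp
        finally show False
          using K.nonunits_not_unit[OF V'(1) _ vt(2), of "m \<otimes> t"] M_mult_r[OF m vt(3)] MV by blast
      qed
    qed
    have WM: "nonunits K W \<inter> T \<subseteq> M"
    proof (rule ccontr)
      assume f: "\<not> nonunits K W \<inter> T \<subseteq> M"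
      have id: "ideal_in K T (nonunits K W \<inter> T)"
        using K.prime_inD(1)[OF K.prime_in_contract[OF T W(1,3) pW]] .
      obtain q where q: "q \<in> nonunits K W \<inter> T" "q \<in> T" "\<one> \<ominus> q \<in> M" using ideal_not_in_M[OF id f] by blast
      then show False using K.prime_in_no_complement[OF pW _ Tc[OF q(2)]] MW by blast
    qed
    obtain a b where ab: "n \<le> a + b" "ring_chain K L W a" "ring_chain K W V b"
      by (rule K.ring_chain_split[OF L V(1) W(1,2) WL ch])
    \<comment> \<open>the steps below \<open>W\<close> that collapse on \<open>T\<close> move above \<open>W'\<close>, the others induce a chain on \<open>k\<close>\<close>
    obtain S s where S: "finite S" "S \<subseteq> W" "res_indep K W T S" "b = card S + s" "ring_chain K T (T \<inter> V) s"
      by (rule K.rank_inequality[OF L vW V(1) W(2) residue_field_T[OF W(3) MW] ab(3)])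
    obtain W' where W': "val_ring K L W'" "W' \<subseteq> W" "T \<subseteq> W'" "nonunits K W' \<inter> T = nonunits K W \<inter> T"
        "ring_chain K W W' (card S)"
      by (rule K.refine_by_independent_set[OF L vW T W(3) S(1-3)])
    have "ring_chain K L W' (a + card S)" by (rule ring_chain_append[OF ab(2) W'(5)])
    then have le1: "enat (a + card S) \<le> val_dim K TM"
      unfolding enat_le_val_dim_TM_iff using W' WM by blast
    define E where "E = \<phi> ` (T \<inter> V)"
    have E: "val_ring k (carrier k) E" and Eu: "\<And>t. t \<in> T \<inter> V \<Longrightarrow> \<phi> t \<in> nonunits k E \<Longrightarrow> t \<in> nonunits K V"
      unfolding E_def using residue_val_ring[OF V(1) MV] by auto
    note E' = k.val_ringD[OF E]
    have "M \<subseteq> T \<inter> V" using M_sub M_R V(2) by blast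
    then have chE: "ring_chain k (carrier k) E s" unfolding E_def by (rule image_ring_chain[OF S(5)])
    have rf: "k.residue_field (carrier k) F"
      by (rule k_residue_field[OF F_carrier]) (simp_all add: k.nonunits_field[OF k.carrier_is_subfield])
    \<comment> \<open>the steps in \<open>k\<close> that collapse on \<open>F\<close> are counted by the transcendence degree, the others by \<open>D\<close>\<close>
    obtain S2 s2 where S2: "finite S2" "S2 \<subseteq> carrier k" "res_indep k (carrier k) F S2" "s = card S2 + s2"
        "ring_chain k F (F \<inter> E) s2"
      by (rule k.rank_inequality[OF k.carrier_is_subfield k.val_ring_field[OF k.carrier_is_subfield] E E'(2) rf chE])
    have le2: "enat (card S2) \<le> trdeg k F"
      using k.card_le_trdeg[of F S2] S2(1-3) unfolding k.alg_independent_iff by blast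
    have vD: "val_ring k F (F \<inter> E)"
      unfolding val_ring_def
    proof (intro conjI ballI)
      show "subring (F \<inter> E) k"
        using subringE[OF subfieldE(1)[OF F_subfield]] subringE[OF E'(1)] by (intro k.subringI) auto
      fix x assume x: "x \<in> F"
      show "x = \<zero>\<^bsub>k\<^esub> \<or> x \<in> F \<inter> E \<or> inv\<^bsub>k\<^esub> x \<in> F \<inter> E"
        using E'(3)[of x] x F_carrier k.subfield_inv[OF F_subfield x] by blast
    qed blast
    have DE: "D \<subseteq> F \<inter> E"
    proof -
      have "\<phi> ` R \<subseteq> E" unfolding E_def using R_T V(2) by (intro image_mono) blast
      then show ?thesis using phi_R k.qf_incl[OF D] by blast
    qed
    have nuE: "y \<in> nonunits k E" if "y \<in> nonunits k (F \<inter> E)" for y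
      using that k.subfield_inv[OF F_subfield, of y] unfolding nonunits_def by blast
    have "\<not> set ds \<subseteq> nonunits k (F \<inter> E)" if ds: "k.gv_list D ds" for ds
    proof
      assume sub: "set ds \<subseteq> nonunits k (F \<inter> E)"
      obtain us where us: "K.gv_list R us" "\<phi> ` set us \<subseteq> set ds \<union> {\<zero>\<^bsub>k\<^esub>}" by (rule gv_D_R[OF ds])
      have z: "\<zero>\<^bsub>k\<^esub> \<in> nonunits k (F \<inter> E)"
        using k.prime_inD(5)[OF k.nonunits_prime[OF F_subfield vD]] .
      have "u \<in> nonunits K V" if u: "u \<in> set us" for u
      proof (rule Eu)
        show "u \<in> T \<inter> V" using K.gv_listD(1)[OF us(1)] R_T V(2) u by blast
        have "\<phi> u \<in> set ds \<union> {\<zero>\<^bsub>k\<^esub>}" using subsetD[OF us(2) imageI[OF u]] .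
        moreover have "set ds \<union> {\<zero>\<^bsub>k\<^esub>} \<subseteq> nonunits k (F \<inter> E)" using sub z by simp
        ultimately have "\<phi> u \<in> nonunits k (F \<inter> E)" by (rule rev_subsetD)
        then show "\<phi> u \<in> nonunits k E" by (rule nuE)
      qed
      then show False using nogv[OF us(1)] by blast
    qed
    then have le3: "enat s2 \<le> w_val_dim k D"
      unfolding k.enat_le_w_val_dim_iff[OF D] using vD DE S2(5) by blast
    have "enat n \<le> enat s2 + enat (a + card S) + enat (card S2)" using ab(1) S(4) S2(4) by simp
    also have "\<dots> \<le> ?sum" by (rule add_mono[OF add_mono[OF le3 le1] le2])
    finally show ?thesis by (simp add: le_max_iff_disj)
  qed
qed

text \<open>Given \<open>D'\<close> over \<open>D\<close>, \<open>W0\<close> over the localization of \<open>T\<close>, and an independent set \<open>S\<close> in \<open>k\<close>: refine \<open>W0\<close> to \<open>W\<close> with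
centre \<open>M\<close>; use \<open>S\<close> to refine the trivial valuation ring of \<open>k\<close> over \<open>F\<close> to \<open>E\<close>; refine \<open>E\<close> to \<open>E'\<close> so that
it restricts to \<open>D'\<close> on \<open>F\<close>; finally refine \<open>W\<close> to \<open>V\<close> so that it induces \<open>E'\<close> on \<open>k\<close>.  The chains of rings add
up along these refinements.\<close>

lemma w_val_dim_lower_D: "w_val_dim k D + val_dim K TM + trdeg k F \<le> w_val_dim K R"
proof (rule enat_leI)
  fix n assume "enat n \<le> w_val_dim k D + val_dim K TM + trdeg k F"
  then obtain n' c where n': "n = n' + c" "enat n' \<le> w_val_dim k D + val_dim K TM" "enat c \<le> trdeg k F"
    by (rule enat_le_plusE)
  obtain a b where ab: "n' = a + b" "enat a \<le> w_val_dim k D" "enat b \<le> val_dim K TM"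
    using n'(2) by (rule enat_le_plusE)
  obtain D' where D': "val_ring k F D'" "D \<subseteq> D'" "\<And>ds. k.gv_list D ds \<Longrightarrow> \<not> set ds \<subseteq> nonunits k D'"
      "ring_chain k F D' a"
    using ab(2) unfolding k.enat_le_w_val_dim_iff[OF D] by blast
  note vD' = k.val_ringD[OF D'(1)] and pD' = k.nonunits_prime[OF F_subfield D'(1)]
  obtain W0 where W0: "val_ring K L W0" "T \<subseteq> W0" "nonunits K W0 \<inter> T \<subseteq> M" "ring_chain K L W0 b"
    using ab(3) unfolding enat_le_val_dim_TM_iff by blast
  obtain S where S: "alg_independent k F S" "finite S" "card S = c" by (rule k.enat_le_trdegE[OF F_carrier n'(3)])
  obtain W where W: "val_ring K L W" "W \<subseteq> W0" "T \<subseteq> W" "nonunits K W \<inter> T = M"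
    by (rule K.val_ring_refine_prime[OF L W0(1) T W0(2) M_prime W0(3)])
  have chW: "ring_chain K L W b" by (rule ring_chain_mono[OF W0(4) subset_refl W(2) le_refl])
  have MW: "M \<subseteq> nonunits K W" using W(4) by blast
  note kc = k.carrier_is_subfield
  have S': "S \<subseteq> carrier k" "res_indep k (carrier k) F S" using S(1) unfolding k.alg_independent_iff by auto
  obtain E where E: "val_ring k (carrier k) E" "E \<subseteq> carrier k" "F \<subseteq> E"
      "nonunits k E \<inter> F = nonunits k (carrier k) \<inter> F" "ring_chain k (carrier k) E c"
    using k.refine_by_independent_set[OF kc k.val_ring_field[OF kc] subfieldE(1)[OF F_subfield] F_carrier S(2) S'] S(3)
    by metis
  note pE = k.nonunits_prime[OF kc E(1)]
  have EF: "nonunits k E \<inter> F \<subseteq> {\<zero>\<^bsub>k\<^esub>}" unfolding E(4) k.nonunits_field[OF kc] by blast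
  have DE: "D' \<subseteq> E" "nonunits k E \<inter> D' \<subseteq> nonunits k D'" using vD'(2) E(3) EF k.prime_inD(5)[OF pD'] by auto
  obtain E' where E': "val_ring k (carrier k) E'" "E' \<subseteq> E" "D' \<subseteq> E'" "nonunits k E' \<inter> D' = nonunits k D'"
    by (rule k.val_ring_refine_prime[OF kc E(1) vD'(1) DE(1) pD' DE(2)])
  note vE' = k.val_ringD[OF E'(1)] and pE' = k.nonunits_prime[OF kc E'(1)]
  have "F \<inter> E' \<subseteq> D'"
  proof
    fix x assume x: "x \<in> F \<inter> E'"
    show "x \<in> D'"
    proof (rule ccontr)
      assume n: "x \<notin> D'"
      have i: "x \<noteq> \<zero>\<^bsub>k\<^esub>" "inv\<^bsub>k\<^esub> x \<in> nonunits k D'" using k.not_in_val_ring[OF F_subfield D'(1) _ n] x by auto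
      then have "inv\<^bsub>k\<^esub> x \<in> nonunits k E'" using E'(4) by blast
      then show False using k.nonunits_not_unit[OF vE'(1), of "inv\<^bsub>k\<^esub> x" x] x i F_carrier by auto
    qed
  qed
  then have FE: "F \<inter> E' = D'" using vD'(2) E'(3) by blast
  have ch1: "ring_chain k E E' a"
    by (rule k.lift_ring_chain[OF kc E(1) E'(1,2) k_residue_field[OF E(3) EF k.prime_inD(5)[OF pE]]])
      (use D'(4) FE in simp)
  have ch2: "ring_chain k (carrier k) E' (c + a)" by (rule ring_chain_append[OF E(5) ch1])
  have ch3: "ring_chain K T (pre E') (c + a)" by (rule pre_ring_chain[OF ch2])
  note B = pre_subring[OF vE'(1)]
  have pP: "prime_in K (pre E') (pre (nonunits k E'))" by (rule pre_prime[OF vE'(1) pE'])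
  have BW: "pre E' \<subseteq> W" using B(3) W(3) by blast
  have "nonunits K W \<inter> pre E' \<subseteq> pre (nonunits k E')"
  proof
    fix x assume x: "x \<in> nonunits K W \<inter> pre E'"
    then have xT: "x \<in> T" using B(3) by blast
    then have "x \<in> M" using x W(4) by blast
    then have "\<phi> x = \<zero>\<^bsub>k\<^esub>" using phi_zero_iff[OF xT] by blast
    then show "x \<in> pre (nonunits k E')" unfolding pre_def using xT k.prime_inD(5)[OF pE'] by simp
  qed
  then obtain V where V: "val_ring K L V" "V \<subseteq> W" "pre E' \<subseteq> V" "nonunits K V \<inter> pre E' = pre (nonunits k E')"
      "nonunits K W \<subseteq> nonunits K V"
    by (rule K.val_ring_refine_prime[OF L W(1) B(1) BW pP])
  note pV = K.nonunits_prime[OF L V(1)] and V' = K.val_ringD[OF V(1)]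
  have TV: "T \<inter> V = pre E'"
  proof
    show "pre E' \<subseteq> T \<inter> V" using B(3) V(3) by blast
    show "T \<inter> V \<subseteq> pre E'"
    proof
      fix x assume x: "x \<in> T \<inter> V"
      show "x \<in> pre E'"
      proof (rule ccontr)
        assume "x \<notin> pre E'"
        then have n: "\<phi> x \<notin> E'" using x unfolding pre_def by blast
        have i: "\<phi> x \<noteq> \<zero>\<^bsub>k\<^esub>" "inv\<^bsub>k\<^esub> \<phi> x \<in> nonunits k E'"
          using k.not_in_val_ring[OF kc E'(1) _ n] x phi_carrier by auto
        have xM: "x \<in> T" "x \<notin> M" using i(1) x phi_zero_iff by auto
        obtain u where u: "u \<in> T" "\<phi> u = inv\<^bsub>k\<^esub> \<phi> x" "x \<otimes> u \<ominus> \<one> \<in> M" using inverse_mod_M[OF xM] by blast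
        have "u \<in> pre (nonunits k E')" unfolding pre_def using u i by simp
        then have uV: "u \<in> nonunits K V" using V(4) by blast
        have xu: "x \<otimes> u \<in> nonunits K V" using K.ideal_inD(4)[OF K.prime_inD(1)[OF pV] _ uV] x by blast
        have mV: "x \<otimes> u \<ominus> \<one> \<in> nonunits K V" using u(3) MW V(5) by blast
        have "x \<otimes> u \<ominus> (x \<otimes> u \<ominus> \<one>) \<in> nonunits K V"
          by (rule K.ideal_in_minus[OF V'(1) K.prime_inD(1)[OF pV] xu mV])
        moreover have "x \<otimes> u \<ominus> (x \<otimes> u \<ominus> \<one>) = \<one>" using Tc[OF xM(1)] Tc[OF u(1)] by algebra
        ultimately show False using K.prime_inD(2)[OF pV] by simp
      qed
    qed
  qed
  have "ring_chain K W V (c + a)"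
    by (rule K.lift_ring_chain[OF L W(1) V(1,2) residue_field_T[OF W(3) MW]]) (use ch3 TV in simp)
  then have ch: "ring_chain K L V (b + (c + a))" by (rule ring_chain_append[OF chW])
  have RV: "R \<subseteq> V" using V(3) D'(2) E'(3) unfolding R_eq pre_def by blast
  have "\<not> set us \<subseteq> nonunits K V" if us: "K.gv_list R us" for us
  proof
    assume sub: "set us \<subseteq> nonunits K V"
    have "\<phi> u \<in> nonunits k D'" if u: "u \<in> set us" for u
    proof -
      have uR: "u \<in> R" using K.gv_listD(1)[OF us] u by blast
      then have uD: "u \<in> T" "\<phi> u \<in> D" unfolding R_def by auto
      then have "u \<in> pre E'" using D'(2) E'(3) unfolding pre_def by blast
      then have "u \<in> pre (nonunits k E')" using V(4) sub u by blast
      then have "\<phi> u \<in> nonunits k E'" unfolding pre_def by blast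
      then show ?thesis using uD(2) D'(2) E'(4) by blast
    qed
    then have "set (map \<phi> us) \<subseteq> nonunits k D'" by auto
    then show False using D'(3)[OF gv_R_D[OF us gv_R_not_M[OF us]]] by blast
  qed
  then have "enat (b + (c + a)) \<le> w_val_dim K R"
    unfolding K.enat_le_w_val_dim_iff[OF R_subring] qf_R using V(1) RV ch by blast
  then show "enat n \<le> w_val_dim K R" using n'(1) ab(1) by (simp add: add.commute add.left_commute)
qed

lemma w_val_dim_lower_T: "w_val_dim K T \<le> w_val_dim K R"
proof (rule enat_leI)
  fix n assume "enat n \<le> w_val_dim K T"
  then obtain V where V: "val_ring K L V" "T \<subseteq> V" "\<And>us. K.gv_list T us \<Longrightarrow> \<not> set us \<subseteq> nonunits K V"
    "ring_chain K L V n"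
    unfolding K.enat_le_w_val_dim_iff[OF T] by blast
  have "R \<subseteq> V" using V(2) R_T by blast
  then show "enat n \<le> w_val_dim K R"
    unfolding K.enat_le_w_val_dim_iff[OF R_subring] qf_R using V(1,3,4) gv_R_T by blast
qed

theorem w_val_dim_pullback:
  "w_val_dim K R = max (w_val_dim K T) (w_val_dim k D + val_dim K TM + trdeg k F)"
  using w_val_dim_upper w_val_dim_lower_D w_val_dim_lower_T by (simp add: antisym)

end

theorem theorem2p12:
  fixes K :: "('a, 'b) ring_scheme"
    and T M R :: "'a set"
    and k :: "'a set ring"
    and D F :: "'a set set"
    and d :: enat
  assumes "field K"
    and "subdomain T K"
    and "maximalideal M (K\<lparr>carrier := T\<rparr>)"
    and "M \<noteq> {\<zero>\<^bsub>K\<^esub>}"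
    and "k = K\<lparr>carrier := T\<rparr> Quot M"
    and "subring D k"
    and "D \<noteq> carrier k"
    and "R = {x \<in> T. M +>\<^bsub>K\<lparr>carrier := T\<rparr>\<^esub> x \<in> D}"
    and "F = qf k D"
    and "d = trdeg k F"
  shows "w_dim K R = max (w_dim K T) (w_dim k D + krull_dim (K\<lparr>carrier := localize K T M\<rparr>)) \<and>
         w_val_dim K R = max (w_val_dim K T) (w_val_dim k D + val_dim K (localize K T M) + d)"
proof -
  let ?T = "K\<lparr>carrier := T\<rparr>"
  interpret K: ambient_field K by (rule ambient_field.intro[OF assms(1)])
  have T: "subring T K" using subdomain.axioms(1)[OF assms(2)] subcring.axioms(1) by blast
  interpret T: cring ?T using K.subring_is_domain[OF T] domain.axioms(1) by blast
  interpret M: maximalideal M ?T by (rule assms(3))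
  have "field k" unfolding assms(5) by (rule M.quotient_is_field[OF T.cring_axioms])
  interpret k: ambient_field k by (rule ambient_field.intro[OF \<open>field k\<close>])
  have hom: "(\<lambda>x. M +>\<^bsub>?T\<^esub> x) \<in> ring_hom ?T k" unfolding assms(5) using M.rcos_ring_hom .
  have zero: "M +>\<^bsub>?T\<^esub> x = \<zero>\<^bsub>k\<^esub> \<longleftrightarrow> x \<in> M" if "x \<in> T" for x
  proof -
    have "\<zero>\<^bsub>k\<^esub> = M" unfolding assms(5) by (simp add: FactRing_def)
    then show ?thesis using M.a_rcos_const[of x] M.a_rcos_self[of x] that by auto
  qed
  interpret pullback K k T M "\<lambda>x. M +>\<^bsub>?T\<^esub> x" D
  proof (intro pullback.intro pullback_axioms.intro)
    show "ambient_field K" "ambient_field k" by (rule K.ambient_field_axioms, rule k.ambient_field_axioms)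
    show "subring T K" by (rule T)
    show "M +>\<^bsub>?T\<^esub> (x \<oplus>\<^bsub>K\<^esub> y) = (M +>\<^bsub>?T\<^esub> x) \<oplus>\<^bsub>k\<^esub> (M +>\<^bsub>?T\<^esub> y)" if "x \<in> T" "y \<in> T" for x y
      using ring_hom_add[OF hom, of x y] that by simp
    show "M +>\<^bsub>?T\<^esub> (x \<otimes>\<^bsub>K\<^esub> y) = (M +>\<^bsub>?T\<^esub> x) \<otimes>\<^bsub>k\<^esub> (M +>\<^bsub>?T\<^esub> y)" if "x \<in> T" "y \<in> T" for x y
      using ring_hom_mult[OF hom, of x y] that by simp
    show "M +>\<^bsub>?T\<^esub> \<one>\<^bsub>K\<^esub> = \<one>\<^bsub>k\<^esub>" using ring_hom_one[OF hom] by simp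
    show "(\<lambda>x. M +>\<^bsub>?T\<^esub> x) ` T = carrier k"
      unfolding assms(5) FactRing_def A_RCOSETS_def' by auto
    show "M \<subseteq> T" using M.a_subset by simp
  qed (use zero assms in auto)
  have R: "R = pullback.R T (\<lambda>x. M +>\<^bsub>?T\<^esub> x) D" unfolding assms(8) R_def ..
  show ?thesis
    unfolding assms(9,10) R using w_dim_pullback w_val_dim_pullback by blast
qed

end
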